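(* Let $(T,\mathcal T,\lambda)$ be a complete atomless probability space, $\mathcal F$ a countably generated sub-$\sigma$-algebra of $\mathcal T$, and $X$ a separable Banach space whose dual $X^*$ has the Radon–Nikodým property. If $\mathcal T$ is nowhere equivalent to $\mathcal F$, then for every sub-$\sigma$-algebra $\mathcal G$ of $\mathcal F$ the following hold. (A1) For any $\mathcal F$-measurable and weakly compact valued correspondence $F$ from $T$ to $X$, $CI_F^{(\mathcal T,\mathcal G)}$ is convex. (A2) For any $1\le p<\infty$ and any $\mathcal F$-measurable, $p$-integrably bounded and weakly compact valued correspondence $F$ from $T$ to $X$, $CI_F^{(\mathcal T,\mathcal G)}$ is weakly compact in $L_p^{\mathcal G}(T,X)$. (A3) For any $1\le p<\infty$ and any $\mathcal F$-measurable, $p$-integrably bounded and weakly compact valued correspondence $F$ from $T$ to $X$, $CI_F^{(\mathcal T,\mathcal G)}=CI_{\overline{co}F}^{(\mathcal T,\mathcal G)}$, where $\overline{co}F(t)$ is the norm closure of the convex hull of $F(t)$ for each $t\in T$. (A4) Let $1\le p<\infty$, let $G$ be an $\mathcal F$-measurable, $p$-integrably bounded and weakly compact valued correspondence from $T$ to $X$, let $Y$ be a metric space, and let $F$ be a weakly closed valued correspondence from $T\times Y$ to $X$. If (a) for every $y\in Y$, $F(t,y)\subseteq G(t)$ for $\lambda$-almost all $t\in T$; (b) for every $y\in Y$, $F(\cdot,y)$ is $\mathcal F$-measurable; (c) for every $t\in T$, $F(t,\cdot)$ is weakly upper hemicontinuous; then $H(y)=CI_{F_y}^{(\mathcal T,\mathcal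 G)}$, with $F_y=F(\cdot,y)$, is weakly upper hemicontinuous from $Y$ to $L_p^{\mathcal G}(T,X)$.
   Context: Nowhere equivalence: $\mathcal T$ is nowhere equivalent to $\mathcal F$ if for every $D\in\mathcal T$ with $\lambda(D)>0$ there is a $\mathcal T$-measurable set $D_0\subseteq D$ such that $\lambda(D_0\triangle D_1)>0$ for every $D_1\in\mathcal F^D:=\{D\cap D':D'\in\mathcal F\}$. Correspondences: a correspondence from $T$ to a set $Z$ assigns to each $t\in T$ a nonempty subset of $Z$. If $Z$ is a topological space, $F$ is $\mathcal F$-measurable if $\{t\in T: F(t)\cap E\ne\emptyset\}\in\mathcal F$ for each closed $E\subseteq Z$; here $X$ carries its norm topology for this purpose. $F$ is convex (closed, compact, ...) valued if $F(t)$ has this property for $\lambda$-almost all $t$. A selection of $F$ is a mapping $f$ with $f(t)\in F(t)$ for $\lambda$-almost all $t$. $F$ is $p$-integrably bounded if there is a measurable real function $h$ with $h^p$ integrable and $\sup\{\|x\|:x\in F(t)\}\le h(t)$ for $\lambda$-almost all $t$. A correspondence $F$ from a topological space $Y$ to a topological space $Z$ is upper hemicontinuous if for each $y_0\in Y$ and each open $O_Z\supseteq F(y_0)$ there is an open neighborhood $O_Y$ of $y_0$ with $F(y)\subseteq O_Z$ for all $y\in O_Y$; "weakly" means that the target carries its weak topology. Conditional expectation: for a Bochner integrable $f:T\to X$, $E(f|\mathcal G)$ is the ($\lambda$-a.e. unique) $\mathcal G$-measurable Bochner integrable $g$ with $\int_D f\,d\lambda=\int_D g\,d\lambda$ for all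 $D\in\mathcal G$. Define $CI_F^{(\mathcal T,\mathcal G)}=\{E(f|\mathcal G): f$ is a $\mathcal T$-measurable Bochner integrable selection of $F\}$. $L_p^{\mathcal G}(T,X)$ is the Banach space of (classes of) $\mathcal G$-measurable Bochner integrable mappings $f:T\to X$ with $\int_T\|f\|^p\,d\lambda<\infty$, with the usual norm. *)

theory Defs
  imports "HOL-Probability.Probability"
begin

section \<open>Measure-theoretic hypotheses\<close>

definition atomless :: "'a measure \<Rightarrow> bool" where
  "atomless M \<longleftrightarrow>
    (\<forall>A\<in>sets M. measure M A > 0 \<longrightarrow>
      (\<exists>B\<in>sets M. B \<subseteq> A \<and> 0 < measure M B \<and> measure M B < measure M A))"

definition countably_generated :: "'a measure \<Rightarrow> bool" where
  "countably_generated N \<longleftrightarrow>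
    (\<exists>C. countable C \<and> C \<subseteq> Pow (space N) \<and> sets N = sigma_sets (space N) C)"

definition nowhere_equivalent :: "'a measure \<Rightarrow> 'a measure \<Rightarrow> bool" where
  "nowhere_equivalent M F \<longleftrightarrow>
    (\<forall>D\<in>sets M. measure M D > 0 \<longrightarrow>
      (\<exists>D0\<in>sets M. D0 \<subseteq> D \<and>
        (\<forall>D1\<in>{D \<inter> D' |D'. D' \<in> sets F}. measure M (sym_diff D0 D1) > 0)))"


section \<open>The Radon--Nikodym property\<close>

definition vector_measure :: "'s measure \<Rightarrow> ('s set \<Rightarrow> 'z::real_normed_vector) \<Rightarrow> bool" where
  "vector_measure M \<nu> \<longleftrightarrow>
    (\<forall>A::nat \<Rightarrow> 's set. range A \<subseteq> sets M \<longrightarrow> disjoint_family A \<longrightarrow>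
      (\<lambda>i. \<nu> (A i)) sums \<nu> (\<Union>i. A i))"

definition bounded_variation :: "'s measure \<Rightarrow> ('s set \<Rightarrow> 'z::real_normed_vector) \<Rightarrow> bool" where
  "bounded_variation M \<nu> \<longleftrightarrow>
    (\<exists>K. \<forall>P. finite P \<and> P \<subseteq> sets M \<and> partition_on (space M) P \<longrightarrow> (\<Sum>A\<in>P. norm (\<nu> A)) \<le> K)"

text \<open>The dual of a separable space need not be separable, whereas the library's
  \<^const>\<open>has_bochner_integral\<close> is restricted to second countable target types.  The following is
  that definition without the sort constraint; the second condition makes \<open>f\<close> almost everywhere
  a pointwise limit of simple functions, i.e. strongly measurable.\<close>

definition has_strong_bochner_integral ::
    "'s measure \<Rightarrow> ('s \<Rightarrow> 'z::real_normed_vector) \<Rightarrow> 'z \<Rightarrow> bool" where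
  "has_strong_bochner_integral M f x \<longleftrightarrow>
    f \<in> borel_measurable M \<and>
    (\<exists>s. (\<forall>i. Bochner_Integration.simple_bochner_integrable M (s i)) \<and>
      (\<lambda>i. \<integral>\<^sup>+ t. ennreal (norm (f t - s i t)) \<partial>M) \<longlonglongrightarrow> 0 \<and>
      (\<lambda>i. Bochner_Integration.simple_bochner_integral M (s i)) \<longlonglongrightarrow> x)"

text \<open>Every vector measure of bounded variation that is absolutely continuous with respect to
  a finite measure has a Bochner integrable density.  A definition cannot quantify over types, so
  the type \<open>'s\<close> carrying the finite measure spaces is a parameter.  As soon as \<open>'s\<close> carries an
  atomless probability measure this is the full property: Lebesgue measure on the unit interval is
  then the image of a measure on \<open>'s\<close>, and the property for Lebesgue measure implies it for
  all finite measure spaces.\<close>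

definition radon_nikodym_property :: "'s itself \<Rightarrow> 'z::banach itself \<Rightarrow> bool" where
  "radon_nikodym_property _ _ \<longleftrightarrow>
    (\<forall>(M::'s measure) (\<nu>::'s set \<Rightarrow> 'z).
      finite_measure M \<and> vector_measure M \<nu> \<and> bounded_variation M \<nu> \<and>
      (\<forall>A\<in>null_sets M. \<nu> A = 0) \<longrightarrow>
      (\<exists>g. \<forall>A\<in>sets M. has_strong_bochner_integral M (\<lambda>t. indicator A t *\<^sub>R g t) (\<nu> A)))"


section \<open>Weak topologies\<close>

text \<open>The coarsest topology on \<open>V\<close> making all functionals in \<open>D\<close> continuous.\<close>

definition weak_topology_by :: "'v set \<Rightarrow> ('v \<Rightarrow> real) set \<Rightarrow> 'v topology" where
  "weak_topology_by V D =
    topology_generated_by {{x \<in> V. \<phi> x \<in> U} |\<phi> U. \<phi> \<in> D \<and> open U}"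

definition weak_topology :: "'x::real_normed_vector topology" where
  "weak_topology = weak_topology_by UNIV {\<phi>. bounded_linear \<phi>}"


section \<open>The spaces \<open>L\<^sub>p\<close> of classes of Bochner integrable functions\<close>

definition ae_class ::
    "'a measure \<Rightarrow> 'a measure \<Rightarrow> ('a \<Rightarrow> 'x::real_normed_vector) \<Rightarrow> ('a \<Rightarrow> 'x) set" where
  "ae_class M G f = {g \<in> borel_measurable G. AE t in M. g t = f t}"

definition Lp_fun ::
    "'a measure \<Rightarrow> 'a measure \<Rightarrow> real \<Rightarrow> ('a \<Rightarrow> 'x::{banach, second_countable_topology}) set" where
  "Lp_fun M G p =
    {f \<in> borel_measurable G. integrable M f \<and> integrable M (\<lambda>t. norm (f t) powr p)}"

definition Lp_norm ::
    "'a measure \<Rightarrow> real \<Rightarrow> ('a \<Rightarrow> 'x::{banach, second_countable_topology}) \<Rightarrow> real" where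
  "Lp_norm M p f = (\<integral>t. norm (f t) powr p \<partial>M) powr (1 / p)"

definition Lp_space ::
    "'a measure \<Rightarrow> 'a measure \<Rightarrow> real \<Rightarrow> ('a \<Rightarrow> 'x::{banach, second_countable_topology}) set set" where
  "Lp_space M G p = ae_class M G ` Lp_fun M G p"

text \<open>Bounded linear functionals on the normed space \<^const>\<open>Lp_space\<close>.  The vector operations
  and the norm on classes are those of representatives.\<close>

definition Lp_dual ::
    "'a measure \<Rightarrow> 'a measure \<Rightarrow> real \<Rightarrow>
      (('a \<Rightarrow> 'x::{banach, second_countable_topology}) set \<Rightarrow> real) set" where
  "Lp_dual M G p = {\<phi>.
    (\<forall>f\<in>Lp_fun M G p. \<forall>g\<in>Lp_fun M G p.
      \<phi> (ae_class M G (\<lambda>t. f t + g t)) = \<phi> (ae_class M G f) + \<phi> (ae_class M G g)) \<and>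
    (\<forall>f\<in>Lp_fun M G p. \<forall>c.
      \<phi> (ae_class M G (\<lambda>t. c *\<^sub>R f t)) = c * \<phi> (ae_class M G f)) \<and>
    (\<exists>K. \<forall>f\<in>Lp_fun M G p. \<bar>\<phi> (ae_class M G f)\<bar> \<le> K * Lp_norm M p f)}"

definition Lp_weak_topology ::
    "'a measure \<Rightarrow> 'a measure \<Rightarrow> real \<Rightarrow>
      ('a \<Rightarrow> 'x::{banach, second_countable_topology}) set topology" where
  "Lp_weak_topology M G p = weak_topology_by (Lp_space M G p) (Lp_dual M G p)"

lemma topspace_weak_topology_by:
  assumes "(\<lambda>_. 0) \<in> D"
  shows "topspace (weak_topology_by V D) = V"
proof -
  let ?B = "{{x \<in> V. \<phi> x \<in> U} |\<phi> U. \<phi> \<in> D \<and> open U}"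
  have "{x \<in> V. (\<lambda>_. 0) x \<in> (UNIV :: real set)} \<in> ?B"
    using assms open_UNIV by blast
  then have "V \<in> ?B" by simp
  moreover have "\<Union>?B \<subseteq> V" by blast
  ultimately have "\<Union>?B = V" by blast
  then show ?thesis
    unfolding weak_topology_by_def topology_generated_by_topspace .
qed

lemma topspace_weak_topology: "topspace weak_topology = UNIV"
  unfolding weak_topology_def by (rule topspace_weak_topology_by) simp

lemma topspace_Lp_weak_topology: "topspace (Lp_weak_topology M G p) = Lp_space M G p"
  unfolding Lp_weak_topology_def
  by (rule topspace_weak_topology_by) (auto simp: Lp_dual_def intro!: exI[of _ 0])

text \<open>Convexity of a set of classes with respect to the operations of representatives.\<close>

definition convex_classes ::
    "'a measure \<Rightarrow> 'a measure \<Rightarrow> ('a \<Rightarrow> 'x::real_normed_vector) set set \<Rightarrow> bool" where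
  "convex_classes M G C \<longleftrightarrow>
    (\<forall>f\<in>borel_measurable G. \<forall>g\<in>borel_measurable G. \<forall>u\<ge>0. \<forall>v\<ge>0.
      ae_class M G f \<in> C \<and> ae_class M G g \<in> C \<and> u + v = 1 \<longrightarrow>
      ae_class M G (\<lambda>t. u *\<^sub>R f t + v *\<^sub>R g t) \<in> C)"


section \<open>Correspondences\<close>

definition correspondence_on :: "'t set \<Rightarrow> ('t \<Rightarrow> 'z set) \<Rightarrow> bool" where
  "correspondence_on S \<Phi> \<longleftrightarrow> (\<forall>t\<in>S. \<Phi> t \<noteq> {})"

definition measurable_correspondence ::
    "'a measure \<Rightarrow> ('a \<Rightarrow> 'x::topological_space set) \<Rightarrow> bool" where
  "measurable_correspondence N \<Phi> \<longleftrightarrow>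
    (\<forall>E. closed E \<longrightarrow> {t \<in> space N. \<Phi> t \<inter> E \<noteq> {}} \<in> sets N)"

definition weakly_compact_valued ::
    "'a measure \<Rightarrow> ('a \<Rightarrow> 'x::real_normed_vector set) \<Rightarrow> bool" where
  "weakly_compact_valued M \<Phi> \<longleftrightarrow> (AE t in M. compactin weak_topology (\<Phi> t))"

definition weakly_closed_valued ::
    "'a measure \<Rightarrow> ('a \<Rightarrow> 'x::real_normed_vector set) \<Rightarrow> bool" where
  "weakly_closed_valued M \<Phi> \<longleftrightarrow> (AE t in M. closedin weak_topology (\<Phi> t))"

definition p_integrably_bounded ::
    "'a measure \<Rightarrow> real \<Rightarrow> ('a \<Rightarrow> 'x::real_normed_vector set) \<Rightarrow> bool" where
  "p_integrably_bounded M p \<Phi> \<longleftrightarrow>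
    (\<exists>h::'a \<Rightarrow> real. h \<in> borel_measurable M \<and> integrable M (\<lambda>t. h t powr p) \<and>
      (AE t in M. \<forall>x\<in>\<Phi> t. norm x \<le> h t))"

definition upper_hemicontinuous_on ::
    "'y topology \<Rightarrow> 'z topology \<Rightarrow> ('y \<Rightarrow> 'z set) \<Rightarrow> bool" where
  "upper_hemicontinuous_on Y Z \<Phi> \<longleftrightarrow>
    correspondence_on (topspace Y) \<Phi> \<and> (\<forall>y\<in>topspace Y. \<Phi> y \<subseteq> topspace Z) \<and>
    (\<forall>y0\<in>topspace Y. \<forall>V. openin Z V \<and> \<Phi> y0 \<subseteq> V \<longrightarrow>
      (\<exists>U. openin Y U \<and> y0 \<in> U \<and> (\<forall>y\<in>U. \<Phi> y \<subseteq> V)))"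


section \<open>Conditional expectations of correspondences\<close>

definition is_cond_exp ::
    "'a measure \<Rightarrow> 'a measure \<Rightarrow> ('a \<Rightarrow> 'x::{banach, second_countable_topology}) \<Rightarrow>
      ('a \<Rightarrow> 'x) \<Rightarrow> bool" where
  "is_cond_exp M G f g \<longleftrightarrow>
    g \<in> borel_measurable G \<and> integrable M g \<and>
    (\<forall>D\<in>sets G. (LINT t:D|M. f t) = (LINT t:D|M. g t))"

text \<open>\<^const>\<open>integrable\<close> includes measurability of \<open>f\<close> with respect to \<open>M\<close>.\<close>

definition CI ::
    "'a measure \<Rightarrow> 'a measure \<Rightarrow> ('a \<Rightarrow> 'x::{banach, second_countable_topology} set) \<Rightarrow>
      ('a \<Rightarrow> 'x) set set" where
  "CI M G \<Phi> =
    {ae_class M G g |f g. integrable M f \<and> (AE t in M. f t \<in> \<Phi> t) \<and> is_cond_exp M G f g}"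

end

theory Submission
  imports Defs
begin

text \<open>
  A selection of \<open>\<Phi>\<close> matters only through its conditional law given \<open>F\<close>, and nowhere equivalence
  makes every conditional law realisable: since each set of positive measure contains subsets of
  arbitrarily small conditional probability given \<open>F\<close>, an exhaustion argument splits any set with
  a prescribed conditional probability.  Points of \<open>X\<close> are coded by the bits \<open>\<psi> x < q\<close> with \<open>\<psi>\<close> in a
  norming sequence of functionals and \<open>q\<close> rational.  Given selections, or random finite mixtures of
  selections, the conditional laws of their codes converge along a subsequence because \<open>F\<close> is
  countably generated; splitting successively along the binary tree of codes realises the limit
  law on \<open>M\<close>, and weak compactness of the values turns almost every realised code into a point of
  the limit correspondence.

  Mixtures of two selections give (A1).  A selection of the closed convex hull is a limit of random
  averages of countably many dense selections, which gives (A3).  Plain sequences of selections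
  give (A2) and (A4).  There the Radon--Nikodym property represents a functional on \<open>L\<^sub>p\<close>, on
  uniformly bounded functions and up to a small error, by a simple function into \<open>X\<^sup>*\<close>, so that
  weak convergence in \<open>L\<^sub>p\<close> follows from convergence of integrals over the sets of \<open>G\<close>.
\<close>

section \<open>Norming functionals on a separable Banach space\<close>

text \<open>A code fixes a point only through weakly closed conditions: a bit decides between
  \<open>\<psi> x \<le> q\<close> and \<open>q \<le> \<psi> x\<close>, and these overlap. As the
  thresholds \<open>q\<close> are dense, the value of each \<open>\<psi>\<close> at a realised point
  is nevertheless determined by the bits. This also yields measurability: the realised point is
  picked by bare choice, but its level sets agree up to null sets with unions of the sets that
  realise the bits, and \<open>M\<close> is complete. In (A1) the correspondence has no integrable
  bound, so limits are tested with clamped functionals, and bits of the form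
  \<open>norm x \<le> q\<close> supply the integrability of the limit. In the other parts the bound
  makes the clamping error uniformly small. The density of a functional on \<open>L_p\<close> takes
  values in the dual of \<open>X\<close>, on whose type no countable base is available; replacing it
  by simple functions keeps every pairing a finite sum of scalar integrals. Compactness in a weak
  topology that need not be metrizable is reached through a compact set in a countable product of
  lines.\<close>

definition sublinear :: "('x::real_vector \<Rightarrow> real) \<Rightarrow> bool" where
  "sublinear q \<longleftrightarrow>
    (\<forall>x y. q (x + y) \<le> q x + q y) \<and> (\<forall>c x. 0 \<le> c \<longrightarrow> q (c *\<^sub>R x) = c * q x)"

lemma sublinear_add: "sublinear q \<Longrightarrow> q (x + y) \<le> q x + q y"
  and sublinear_scale: "sublinear q \<Longrightarrow> 0 \<le> c \<Longrightarrow> q (c *\<^sub>R x) = c * q x"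
  by (auto simp: sublinear_def)

lemma sublinear_zero: "sublinear q \<Longrightarrow> q 0 = 0"
  using sublinear_scale[of q 0 0] by simp

lemma sublinear_minus_le: "sublinear q \<Longrightarrow> - q (- x) \<le> q x"
  using sublinear_add[of q x "- x"] sublinear_zero[of q] by simp

text \<open>The inequality for the factor \<open>1 / c\<close> is the reverse inequality for
  \<open>c\<close>, so one half of homogeneity suffices.\<close>

lemma sublinearI_pos:
  assumes "\<And>x y. q (x + y) \<le> q x + q y" and "q 0 = 0"
    and "\<And>c x. 0 < c \<Longrightarrow> q (c *\<^sub>R x) \<le> c * q x"
  shows "sublinear q"
proof -
  have "q (c *\<^sub>R x) = c * q x" if "0 \<le> c" for c x
  proof (cases "c = 0")
    case False
    then have c: "0 < c" using that by simp
    have "q ((1 / c) *\<^sub>R (c *\<^sub>R x)) \<le> (1 / c) * q (c *\<^sub>R x)" using c by (intro assms(3)) simp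
    then have "q x \<le> q (c *\<^sub>R x) / c" using c by simp
    then have "c * q x \<le> q (c *\<^sub>R x)" using c by (simp add: field_simps)
    then show ?thesis using assms(3)[OF c, of x] by linarith
  qed (simp add: assms(2))
  then show ?thesis using assms(1) by (auto simp: sublinear_def)
qed

text \<open>The term \<open>s = 1\<close> gives \<open>tilt q y x \<le> q (x + y) - q y\<close>. So
  a functional equal to its tilts is superadditive, and anything below the tilt is at most
  \<open>- q y\<close> at \<open>- y\<close>.\<close>

definition tilt :: "('x::real_vector \<Rightarrow> real) \<Rightarrow> 'x \<Rightarrow> 'x \<Rightarrow> real" where
  "tilt q y x = (INF s\<in>{0..}. q (x + s *\<^sub>R y) - s * q y)"

text \<open>The infimum is finite because \<open>s * q y = q (s *\<^sub>R y) \<le> q (x + s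
  *\<^sub>R y) + q (- x)\<close>. It is subadditive because the parameters of two competing terms
  may be added, and homogeneous because they may be rescaled.\<close>

lemma
  assumes "sublinear q"
  shows tilt_le: "0 \<le> s \<Longrightarrow> tilt q y x \<le> q (x + s *\<^sub>R y) - s * q y"
    and tilt_le_self: "tilt q y x \<le> q x"
    and sublinear_tilt: "sublinear (tilt q y)"
proof -
  have bdd: "bdd_below ((\<lambda>s. q (x + s *\<^sub>R y) - s * q y) ` {0..})" for x
  proof (rule bdd_belowI2[where m = "- q (- x)"])
    fix s :: real assume "s \<in> {0..}"
    then have "s * q y = q (s *\<^sub>R y)" using sublinear_scale[OF assms] by simp
    also have "\<dots> \<le> q (x + s *\<^sub>R y) + q (- x)"
      using sublinear_add[OF assms, of "x + s *\<^sub>R y" "- x"] by simp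
    finally show "- q (- x) \<le> q (x + s *\<^sub>R y) - s * q y" by simp
  qed
  have le: "tilt q y x \<le> q (x + s *\<^sub>R y) - s * q y" if "0 \<le> s" for s x
    unfolding tilt_def by (rule cINF_lower[OF bdd]) (use that in simp)
  show "0 \<le> s \<Longrightarrow> tilt q y x \<le> q (x + s *\<^sub>R y) - s * q y" using le .
  show "tilt q y x \<le> q x" using le[of 0 x] by simp
  have ge: "u \<le> tilt q y x" if "\<And>s. 0 \<le> s \<Longrightarrow> u \<le> q (x + s *\<^sub>R y) - s * q y" for u x
    unfolding tilt_def by (rule cINF_greatest) (use that in auto)
  show "sublinear (tilt q y)"
  proof (rule sublinearI_pos)
    fix a b
    have "tilt q y (a + b) - (q (a + s *\<^sub>R y) - s * q y) \<le> tilt q y b" if s: "0 \<le> s" for s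
    proof (rule ge)
      fix r :: real assume r: "0 \<le> r"
      have "tilt q y (a + b) \<le> q (a + b + (s + r) *\<^sub>R y) - (s + r) * q y"
        using s r by (intro le) simp
      moreover have "a + b + (s + r) *\<^sub>R y = (a + s *\<^sub>R y) + (b + r *\<^sub>R y)"
        by (simp add: algebra_simps)
      ultimately show "tilt q y (a + b) - (q (a + s *\<^sub>R y) - s * q y) \<le> q (b + r *\<^sub>R y) - r * q y"
        using sublinear_add[OF assms, of "a + s *\<^sub>R y" "b + r *\<^sub>R y"] by (simp add: algebra_simps)
    qed
    then have "tilt q y (a + b) - tilt q y b \<le> tilt q y a"
      by (intro ge) (smt (verit))
    then show "tilt q y (a + b) \<le> tilt q y a + tilt q y b" by simp
  next
    have "0 \<le> tilt q y 0" by (rule ge) (simp add: sublinear_scale[OF assms])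
    moreover have "tilt q y 0 \<le> 0" using le[of 0 0] sublinear_zero[OF assms] by simp
    ultimately show "tilt q y 0 = 0" by simp
  next
    fix c x assume c: "0 < (c::real)"
    have "tilt q y (c *\<^sub>R x) / c \<le> tilt q y x"
    proof (rule ge)
      fix s :: real assume s: "0 \<le> s"
      have "tilt q y (c *\<^sub>R x) \<le> q (c *\<^sub>R x + (c * s) *\<^sub>R y) - (c * s) * q y"
        using s c by (intro le) simp
      also have "c *\<^sub>R x + (c * s) *\<^sub>R y = c *\<^sub>R (x + s *\<^sub>R y)" by (simp add: algebra_simps)
      also have "q \<dots> = c * q (x + s *\<^sub>R y)" using c by (simp add: sublinear_scale[OF assms])
      finally show "tilt q y (c *\<^sub>R x) / c \<le> q (x + s *\<^sub>R y) - s * q y"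
        using c by (simp add: field_simps)
    qed
    then show "tilt q y (c *\<^sub>R x) \<le> c * tilt q y x" using c by (simp add: field_simps)
  qed
qed

text \<open>Two members of a chain have a common lower member, whose subadditivity carries over to
  the infimum of the whole chain. The bound by \<open>p\<close> keeps the infimum above
  \<open>- p (- x)\<close>.\<close>

lemma sublinear_Inf_chain:
  assumes C: "C \<noteq> {}" "\<And>q. q \<in> C \<Longrightarrow> sublinear q" "\<And>q x. q \<in> C \<Longrightarrow> q x \<le> p x"
    and chain: "\<And>q r. q \<in> C \<Longrightarrow> r \<in> C \<Longrightarrow> (\<forall>x. q x \<le> r x) \<or> (\<forall>x. r x \<le> q x)"
  shows "sublinear (\<lambda>x. INF q\<in>C. q x)" and "q \<in> C \<Longrightarrow> (INF q\<in>C. q x) \<le> q x"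
proof -
  have bdd: "bdd_below ((\<lambda>q. q x) ` C)" for x
  proof (rule bdd_belowI2[where m = "- p (- x)"])
    fix q assume "q \<in> C"
    then show "- p (- x) \<le> q x" using sublinear_minus_le[OF C(2), of q x] C(3)[of q "- x"] by simp
  qed
  have le: "(INF q\<in>C. q x) \<le> q x" if "q \<in> C" for q x
    by (rule cINF_lower[OF bdd that])
  show "q \<in> C \<Longrightarrow> (INF q\<in>C. q x) \<le> q x" by (rule le)
  have ge: "u \<le> (INF q\<in>C. q x)" if "\<And>q. q \<in> C \<Longrightarrow> u \<le> q x" for u x
    by (rule cINF_greatest) (use C that in auto)
  show "sublinear (\<lambda>x. INF q\<in>C. q x)"
  proof (rule sublinearI_pos)
    fix a b
    have *: "(INF q\<in>C. q (a + b)) \<le> q a + r b" if qr: "q \<in> C" "r \<in> C" for q r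
    proof -
      obtain m where m: "m \<in> C" "\<And>x. m x \<le> q x" "\<And>x. m x \<le> r x"
        using chain[OF qr] qr by (metis order_refl)
      have "(INF q\<in>C. q (a + b)) \<le> m (a + b)" by (rule le[OF m(1)])
      also have "\<dots> \<le> m a + m b" by (rule sublinear_add[OF C(2)[OF m(1)]])
      also have "\<dots> \<le> q a + r b" by (intro add_mono m)
      finally show ?thesis .
    qed
    have "(INF q\<in>C. q (a + b)) - q a \<le> (INF q\<in>C. q b)" if "q \<in> C" for q
      by (rule ge) (use *[OF that] in force)
    then have "(INF q\<in>C. q (a + b)) - (INF q\<in>C. q b) \<le> (INF q\<in>C. q a)"
      by (intro ge) (smt (verit))
    then show "(INF q\<in>C. q (a + b)) \<le> (INF q\<in>C. q a) + (INF q\<in>C. q b)" by simp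
  next
    have "(INF q\<in>C. q 0) = (INF q\<in>C. 0)" using C(2) by (intro INF_cong) (auto simp: sublinear_zero)
    then show "(INF q\<in>C. q 0) = 0" using C(1) by simp
  next
    fix c x assume c: "0 < (c::real)"
    have "(INF q\<in>C. q (c *\<^sub>R x)) / c \<le> (INF q\<in>C. q x)"
    proof (rule ge)
      fix q assume q: "q \<in> C"
      have "(INF q\<in>C. q (c *\<^sub>R x)) \<le> q (c *\<^sub>R x)" by (rule le[OF q])
      also have "\<dots> = c * q x" using c C(2)[OF q] by (simp add: sublinear_scale)
      finally show "(INF q\<in>C. q (c *\<^sub>R x)) / c \<le> q x" using c by (simp add: field_simps)
    qed
    then show "(INF q\<in>C. q (c *\<^sub>R x)) \<le> c * (INF q\<in>C. q x)" using c by (simp add: field_simps)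
  qed
qed

text \<open>A pointwise minimal sublinear functional coincides with all of its tilts, and this makes it
  additive.\<close>

lemma ex_linear_below_sublinear:
  assumes p: "sublinear p"
  shows "\<exists>f. linear f \<and> (\<forall>x. f x \<le> p x)"
proof -
  define S where "S = {q. sublinear q \<and> (\<forall>x. q x \<le> p x)}"
  \<comment> \<open>Zorn for the reversed pointwise order, so that a maximal element is a minimal
    functional.\<close>
  have "\<exists>m\<in>S. \<forall>q\<in>S. m \<ge> q \<longrightarrow> q = m"
  proof (rule predicate_Zorn)
    show "partial_order_on S (relation_of (\<ge>) S)"
      by (rule partial_order_on_relation_ofI) auto
    fix C assume C: "C \<in> Chains (relation_of (\<ge>) S)"
    then have CS: "C \<subseteq> S" and tot: "\<And>q r. q \<in> C \<Longrightarrow> r \<in> C \<Longrightarrow> q \<le> r \<or> r \<le> q"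
      by (auto simp: Chains_def relation_of_def)
    show "\<exists>u\<in>S. \<forall>a\<in>C. a \<ge> u"
    proof (cases "C = {}")
      case True
      then show ?thesis using p by (auto simp: S_def)
    next
      case False
      note inf = sublinear_Inf_chain[of C p, OF False]
      have 1: "sublinear (\<lambda>x. INF q\<in>C. q x)"
        by (rule inf(1)) (use CS tot in \<open>auto simp: S_def le_fun_def\<close>)
      have 2: "(INF q\<in>C. q x) \<le> q x" if "q \<in> C" for q x
        by (rule inf(2)) (use CS tot that in \<open>auto simp: S_def le_fun_def\<close>)
      obtain q0 where "q0 \<in> C" using False by auto
      then have "q0 \<in> S" and "(INF q\<in>C. q x) \<le> q0 x" for x using CS 2 by auto
      then have "(INF q\<in>C. q x) \<le> p x" for x unfolding S_def by (metis (mono_tags) mem_Collect_eq order_trans)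
      then show ?thesis using 1 2 by (intro bexI[of _ "\<lambda>x. INF q\<in>C. q x"]) (auto simp: S_def le_fun_def)
    qed
  qed
  then obtain m where m: "m \<in> S" "\<And>q. q \<in> S \<Longrightarrow> (\<forall>x. q x \<le> m x) \<Longrightarrow> q = m"
    by (auto simp: le_fun_def)
  have sub: "sublinear m" and mp: "m x \<le> p x" for x using m(1) by (auto simp: S_def)
  have tilt: "tilt m y = m" for y
  proof (rule m(2))
    show "\<forall>x. tilt m y x \<le> m x" using tilt_le_self[OF sub] by blast
    then show "tilt m y \<in> S" using mp sublinear_tilt[OF sub] by (auto simp: S_def intro: order_trans)
  qed
  have add: "m (x + y) = m x + m y" for x y
    using tilt_le[OF sub, of 1 y x] sublinear_add[OF sub, of x y] by (simp add: tilt)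
  have neg: "m (- x) = - m x" for x
    using add[of x "- x"] sublinear_zero[OF sub] by simp
  have "m (c *\<^sub>R x) = c * m x" for c x
  proof (cases "0 \<le> c")
    case False
    then have "m ((- c) *\<^sub>R x) = (- c) * m x" by (intro sublinear_scale[OF sub]) simp
    then show ?thesis using neg[of "c *\<^sub>R x"] by simp
  qed (rule sublinear_scale[OF sub])
  then have "linear m" using add by (intro linearI) auto
  then show ?thesis using mp by blast
qed

text \<open>The tilt of the norm at \<open>x0\<close> lies below the norm and is at most
  \<open>- norm x0\<close> at \<open>- x0\<close>; a linear functional below it therefore attains
  the norm at \<open>x0\<close>.\<close>

lemma ex_norming_functional:
  fixes x0 :: "'x::real_normed_vector"
  shows "\<exists>\<psi>::'x \<Rightarrow>\<^sub>L real. norm \<psi> \<le> 1 \<and> blinfun_apply \<psi> x0 = norm x0"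
proof -
  have sub: "sublinear (norm :: 'x \<Rightarrow> real)" by (auto simp: sublinear_def norm_triangle_ineq)
  obtain f where f: "linear f" "\<And>x. f x \<le> tilt norm x0 x"
    using ex_linear_below_sublinear[OF sublinear_tilt[OF sub]] by blast
  have le: "f x \<le> norm x" for x using f(2)[of x] tilt_le_self[OF sub, of x0 x] by simp
  have abs: "\<bar>f x\<bar> \<le> norm x" for x
    using le[of x] le[of "- x"] linear_neg[OF f(1), of x] by simp
  have "f (- x0) \<le> - norm x0"
    using f(2)[of "- x0"] tilt_le[OF sub, of 1 x0 "- x0"] by simp
  then have eq: "f x0 = norm x0" using le[of x0] linear_neg[OF f(1), of x0] by simp
  have bl: "bounded_linear f"
    using f(1) abs by (intro bounded_linear_intro[where K = 1]) (auto simp: linear_add linear_scale)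
  have "norm (Blinfun f) \<le> 1"
    by (rule norm_blinfun_bound) (use abs in \<open>auto simp: bounded_linear_Blinfun_apply[OF bl]\<close>)
  then show ?thesis using eq by (intro exI[of _ "Blinfun f"]) (auto simp: bounded_linear_Blinfun_apply[OF bl])
qed

text \<open>Members of norm above 1 may occur but cannot witness the estimate. Hence an arbitrary
  functional can be inserted into the sequence without spoiling the property.\<close>

definition norming :: "(nat \<Rightarrow> ('x::real_normed_vector \<Rightarrow>\<^sub>L real)) \<Rightarrow> bool" where
  "norming \<psi> \<longleftrightarrow> (\<forall>x e. 0 < e \<longrightarrow> (\<exists>i. norm (\<psi> i) \<le> 1 \<and> norm x - e < \<psi> i x))"

text \<open>The functionals attain the norm at the points \<open>d\<close> of a dense sequence. At
  \<open>x\<close> such a functional is at least \<open>norm d - norm (x - d)\<close>, hence at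
  least \<open>norm x - 2 * norm (x - d)\<close>.\<close>

lemma ex_norming: "\<exists>\<psi> :: nat \<Rightarrow> ('x::{real_normed_vector, second_countable_topology} \<Rightarrow>\<^sub>L real). norming \<psi>"
proof -
  obtain D :: "'x set" where D: "countable D" "\<And>U. open U \<Longrightarrow> U \<noteq> {} \<Longrightarrow> \<exists>d\<in>D. d \<in> U"
    using countable_dense_setE by blast
  have "D \<noteq> {}" using D(2)[of UNIV] by auto
  then have ran: "range (from_nat_into D) = D" using D(1) by (rule range_from_nat_into)
  obtain \<psi> :: "'x \<Rightarrow> ('x \<Rightarrow>\<^sub>L real)" where \<psi>: "\<And>x. norm (\<psi> x) \<le> 1" "\<And>x. \<psi> x x = norm x"
    using ex_norming_functional by metis
  have "\<exists>i. norm (\<psi> (from_nat_into D i)) \<le> 1 \<and> norm x - e < \<psi> (from_nat_into D i) x"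
    if e: "0 < e" for x e
  proof -
    obtain d where d: "d \<in> D" "d \<in> ball x (e / 2)" using D(2)[of "ball x (e / 2)"] e by auto
    obtain i where i: "from_nat_into D i = d" using ran d(1) by (metis imageE)
    have "\<bar>\<psi> d (x - d)\<bar> \<le> norm (x - d)"
      using norm_blinfun[of "\<psi> d" "x - d"] \<psi>(1)[of d] mult_right_mono[of "norm (\<psi> d)" 1 "norm (x - d)"] by simp
    moreover have "\<psi> d x = norm d + \<psi> d (x - d)" by (simp add: blinfun.diff_right \<psi>(2))
    moreover have "norm (x - d) < e / 2" using d(2) by (simp add: dist_norm)
    moreover have "norm x \<le> norm d + norm (x - d)" using norm_triangle_ineq[of d "x - d"] by simp
    ultimately have "norm x - e < \<psi> d x" by linarith
    then show ?thesis using i \<psi>(1) by auto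
  qed
  then show ?thesis unfolding norming_def by (intro exI[of _ "\<lambda>i. \<psi> (from_nat_into D i)"]) blast
qed

lemma norming_le:
  assumes "norming \<psi>" "\<And>i. norm (\<psi> i) \<le> 1 \<Longrightarrow> \<psi> i x \<le> b"
  shows "norm x \<le> b"
proof (rule field_le_epsilon)
  fix e :: real assume "0 < e"
  then obtain i where "norm (\<psi> i) \<le> 1" "norm x - e < \<psi> i x" using assms(1) norming_def by blast
  then show "norm x \<le> b + e" using assms(2)[of i] by simp
qed

lemma abs_blinfun_le: "norm (\<psi>::'x::real_normed_vector \<Rightarrow>\<^sub>L real) \<le> 1 \<Longrightarrow> \<bar>\<psi> x\<bar> \<le> norm x"
  using norm_blinfun[of \<psi> x] mult_right_mono[of "norm \<psi>" 1 "norm x"] by simp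

lemma norming_eqI:
  assumes "norming \<psi>" "\<And>i. \<psi> i x = \<psi> i y"
  shows "x = y"
proof -
  have "norm (x - y) \<le> 0"
    by (rule norming_le[OF assms(1)]) (simp add: blinfun.diff_right assms(2))
  then show ?thesis by simp
qed

text \<open>Pettis' criterion. The distance of \<open>f t\<close> to a fixed point is a countable
  supremum of measurable scalar functions, and every open set is a countable union of balls with
  centres in a dense set and rational radii.\<close>

lemma borel_measurable_norming:
  fixes f :: "'a \<Rightarrow> 'x::{real_normed_vector, second_countable_topology}"
  assumes \<psi>: "norming \<psi>" and meas: "\<And>i. (\<lambda>t. \<psi> i (f t)) \<in> borel_measurable N"
  shows "f \<in> borel_measurable N"
proof -
  have dist: "(\<lambda>t. norm (f t - d)) \<in> borel_measurable N" for d
  proof -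
    have eq: "norm (f t - d) = (SUP i\<in>{i. norm (\<psi> i) \<le> 1}. \<psi> i (f t) - \<psi> i d)" for t
    proof (rule antisym)
      have bdd: "bdd_above ((\<lambda>i. \<psi> i (f t) - \<psi> i d) ` {i. norm (\<psi> i) \<le> 1})"
        by (rule bdd_aboveI2[where M = "norm (f t - d)"])
          (use abs_blinfun_le[of _ "f t - d"] in \<open>force simp: blinfun.diff_right\<close>)
      show "norm (f t - d) \<le> (SUP i\<in>{i. norm (\<psi> i) \<le> 1}. \<psi> i (f t) - \<psi> i d)"
        by (rule norming_le[OF \<psi>]) (auto simp: blinfun.diff_right intro!: cSUP_upper2[OF bdd])
      have "{i. norm (\<psi> i) \<le> 1} \<noteq> {}" using \<psi> zero_less_one unfolding norming_def by blast
      then show "(SUP i\<in>{i. norm (\<psi> i) \<le> 1}. \<psi> i (f t) - \<psi> i d) \<le> norm (f t - d)"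
        by (rule cSUP_least) (use abs_blinfun_le[of _ "f t - d"] in \<open>force simp: blinfun.diff_right\<close>)
    qed
    have bdd: "bdd_above ((\<lambda>i. \<psi> i (f t) - \<psi> i d) ` {i. norm (\<psi> i) \<le> 1})" for t
      by (rule bdd_aboveI2[where M = "norm (f t - d)"])
        (use abs_blinfun_le[of _ "f t - d"] in \<open>force simp: blinfun.diff_right\<close>)
    have "(\<lambda>t. SUP i\<in>{i. norm (\<psi> i) \<le> 1}. \<psi> i (f t) - \<psi> i d) \<in> borel_measurable N"
      by (rule borel_measurable_cSUP) (use meas bdd in auto)
    then show ?thesis by (simp only: eq)
  qed
  show ?thesis
  proof (rule borel_measurableI)
    fix U :: "'x set" assume U: "open U"
    obtain D :: "'x set" where D: "countable D" "\<And>U. open U \<Longrightarrow> U \<noteq> {} \<Longrightarrow> \<exists>d\<in>D. d \<in> U"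
      using countable_dense_setE by blast
    define P where "P = {(d, q). d \<in> D \<and> q \<in> \<rat> \<and> ball d q \<subseteq> U}"
    have P: "countable P"
      by (rule countable_subset[of _ "D \<times> \<rat>"]) (auto simp: P_def D(1) countable_rat)
    have "\<exists>(d, q)\<in>P. x \<in> ball d q" if x: "x \<in> U" for x
    proof -
      obtain e where e: "0 < e" "ball x e \<subseteq> U" using U x open_contains_ball by blast
      obtain d where d: "d \<in> D" "dist x d < e / 2" using D(2)[of "ball x (e / 2)"] e(1) by auto
      obtain q where q: "q \<in> \<rat>" "dist x d < q" "q < e / 2" using Rats_dense_in_real[OF d(2)] by auto
      have "ball d q \<subseteq> ball x e"
      proof
        fix z assume "z \<in> ball d q"
        then show "z \<in> ball x e" using dist_triangle[of x z d] d(2) q(3) by (simp add: dist_commute)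
      qed
      then show ?thesis using e d q by (auto simp: P_def dist_commute intro!: bexI[of _ "(d, q)"])
    qed
    then have "f -` U \<inter> space N = (\<Union>(d, q)\<in>P. {t \<in> space N. norm (f t - d) < q})"
      by (fastforce simp: P_def dist_norm norm_minus_commute mem_ball)
    moreover have "{t \<in> space N. norm (f t - d) < q} \<in> sets N" for d q
      using dist[of d] by measurable
    ultimately show "f -` U \<inter> space N \<in> sets N"
      by (auto intro!: sets.countable_UN'[OF P])
  qed
qed

section \<open>Conditional expectations of Banach space valued functions\<close>

lemma integrable_blinfun:
  fixes f :: "'a \<Rightarrow> 'x::{banach, second_countable_topology}" and \<psi> :: "'x \<Rightarrow>\<^sub>L real"
  shows "integrable M f \<Longrightarrow> integrable M (\<lambda>t. \<psi> (f t))"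
  by (rule integrable_bounded_linear[OF blinfun.bounded_linear_right])

lemma set_integral_blinfun:
  fixes f :: "'a \<Rightarrow> 'x::{banach, second_countable_topology}" and \<psi> :: "'x \<Rightarrow>\<^sub>L real"
  assumes "integrable M f" "D \<in> sets M"
  shows "(LINT t:D|M. \<psi> (f t)) = \<psi> (LINT t:D|M. f t)"
proof -
  have "integrable M (\<lambda>t. indicator D t *\<^sub>R f t)" by (rule integrable_mult_indicator[OF assms(2,1)])
  from integral_bounded_linear[OF blinfun.bounded_linear_right this, of \<psi>] show ?thesis
    unfolding set_lebesgue_integral_def by (simp add: blinfun.scaleR_right)
qed

context finite_measure_subalgebra
begin

lemma sets_subalg: "A \<in> sets F \<Longrightarrow> A \<in> sets M" and space_subalg: "space F = space M"
  using subalg by (auto simp: subalgebra_def)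

lemma is_cond_exp_blinfun:
  fixes \<psi> :: "'x::{banach, second_countable_topology} \<Rightarrow>\<^sub>L real"
  assumes f: "integrable M f" and g: "is_cond_exp M F f g"
  shows "AE t in M. real_cond_exp M F (\<lambda>t. \<psi> (f t)) t = \<psi> (g t)"
proof (rule real_cond_exp_charact)
  have [measurable]: "g \<in> borel_measurable F" and gi: "integrable M g"
    and eq: "\<And>D. D \<in> sets F \<Longrightarrow> (LINT t:D|M. f t) = (LINT t:D|M. g t)"
    using g by (auto simp: is_cond_exp_def)
  show "integrable M (\<lambda>t. \<psi> (f t))" "integrable M (\<lambda>t. \<psi> (g t))"
    using f gi by (auto intro: integrable_blinfun)
  show "(\<lambda>t. \<psi> (g t)) \<in> borel_measurable F"
    by (rule borel_measurable_continuous_on[where f = "\<lambda>x. \<psi> x"])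
      (auto intro!: linear_continuous_on blinfun.bounded_linear_right)
  fix A assume "A \<in> sets F"
  then show "(LINT t:A|M. \<psi> (f t)) = (LINT t:A|M. \<psi> (g t))"
    using f gi eq by (simp add: set_integral_blinfun sets_subalg)
qed

text \<open>The scalar inequality holds for each functional of a norming sequence; the sequence is
  countable, so the exceptional null sets can be united before the supremum is taken.\<close>

lemma is_cond_exp_norm_le:
  fixes f :: "'a \<Rightarrow> 'x::{banach, second_countable_topology}"
  assumes f: "integrable M f" and g: "is_cond_exp M F f g"
  shows "AE t in M. norm (g t) \<le> real_cond_exp M F (\<lambda>t. norm (f t)) t"
proof -
  obtain \<psi> :: "nat \<Rightarrow> ('x \<Rightarrow>\<^sub>L real)" where \<psi>: "norming \<psi>" using ex_norming by blast
  have "AE t in M. norm (\<psi> i) \<le> 1 \<longrightarrow> \<psi> i (g t) \<le> real_cond_exp M F (\<lambda>t. norm (f t)) t" for i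
  proof (cases "norm (\<psi> i) \<le> 1")
    case True
    then have "AE t in M. \<psi> i (f t) \<le> norm (f t)" using abs_blinfun_le by (auto simp: abs_le_iff)
    then have "AE t in M. real_cond_exp M F (\<lambda>t. \<psi> i (f t)) t \<le> real_cond_exp M F (\<lambda>t. norm (f t)) t"
      by (rule real_cond_exp_mono) (use f in \<open>auto intro: integrable_blinfun\<close>)
    then show ?thesis using is_cond_exp_blinfun[OF f g, of "\<psi> i"] by eventually_elim simp
  qed simp
  then have "AE t in M. \<forall>i. norm (\<psi> i) \<le> 1 \<longrightarrow> \<psi> i (g t) \<le> real_cond_exp M F (\<lambda>t. norm (f t)) t"
    by (simp add: AE_all_countable)
  then show ?thesis by eventually_elim (auto intro: norming_le[OF \<psi>])
qed

lemma is_cond_exp_integral_norm_le: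
  fixes f :: "'a \<Rightarrow> 'x::{banach, second_countable_topology}"
  assumes f: "integrable M f" and g: "is_cond_exp M F f g"
  shows "(\<integral>t. norm (g t) \<partial>M) \<le> (\<integral>t. norm (f t) \<partial>M)"
proof -
  have "(\<integral>t. norm (g t) \<partial>M) \<le> (\<integral>t. real_cond_exp M F (\<lambda>t. norm (f t)) t \<partial>M)"
    using is_cond_exp_norm_le[OF f g] f g
    by (intro integral_mono_AE) (auto simp: is_cond_exp_def intro: real_cond_exp_int)
  also have "\<dots> = (\<integral>t. norm (f t) \<partial>M)" using f by (intro real_cond_exp_int) auto
  finally show ?thesis .
qed

lemma is_cond_exp_diff:
  fixes f :: "'a \<Rightarrow> 'x::{banach, second_countable_topology}"
  assumes f: "integrable M f" "is_cond_exp M F f g" and f': "integrable M f'" "is_cond_exp M F f' g'"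
  shows "is_cond_exp M F (\<lambda>t. f t - f' t) (\<lambda>t. g t - g' t)"
proof -
  have "set_integrable M D f" "set_integrable M D f'" "set_integrable M D g" "set_integrable M D g'"
    if "D \<in> sets F" for D
    using assms sets_subalg[OF that] unfolding set_integrable_def is_cond_exp_def
    by (auto intro: integrable_mult_indicator)
  then show ?thesis using f(2) f'(2) unfolding is_cond_exp_def
    by (intro conjI borel_measurable_diff) (simp_all add: set_integral_diff)
qed

text \<open>Two possibly different functions are compared because different selections can have the
  same integrals. The difference of \<open>g\<close> and \<open>g'\<close> is a conditional
  expectation of \<open>0\<close>, which the contraction in the mean forces to vanish.\<close>

lemma is_cond_exp_unique:
  fixes f :: "'a \<Rightarrow> 'x::{banach, second_countable_topology}"
  assumes f: "integrable M f" "integrable M f'" and g: "is_cond_exp M F f g" "is_cond_exp M F f' g'"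
    and eq: "\<And>D. D \<in> sets F \<Longrightarrow> (LINT t:D|M. f t) = (LINT t:D|M. f' t)"
  shows "AE t in M. g t = g' t"
proof -
  have "is_cond_exp M F (\<lambda>t. 0) (\<lambda>t. g t - g' t)"
    using is_cond_exp_diff[OF f(1) g(1) f(1), of g'] eq g(2)
    by (auto simp: is_cond_exp_def set_lebesgue_integral_def)
  from is_cond_exp_integral_norm_le[OF _ this] have "(\<integral>t. norm (g t - g' t) \<partial>M) \<le> 0" by simp
  then have "(\<integral>t. norm (g t - g' t) \<partial>M) = 0" by (simp add: order_antisym)
  moreover have "integrable M (\<lambda>t. norm (g t - g' t))" using g by (auto simp: is_cond_exp_def)
  ultimately have "AE t in M. norm (g t - g' t) = 0"
    by (subst (asm) integral_nonneg_eq_0_iff_AE) auto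
  then show ?thesis by simp
qed

text \<open>By contraction the increments of \<open>g k\<close> have summable mean norms, so the
  telescoping series converges almost everywhere and in the mean; its sum is the conditional
  expectation of \<open>f\<close>.\<close>

lemma is_cond_exp_L1_limit:
  fixes f :: "'a \<Rightarrow> 'x::{banach, second_countable_topology}"
  assumes s: "\<And>k. integrable M (s k)" "\<And>k. is_cond_exp M F (s k) (g k)" and f: "integrable M f"
    and lim: "\<And>k. (\<integral>t. norm (s k t - f t) \<partial>M) \<le> (1 / 2) ^ k"
  shows "\<exists>h. is_cond_exp M F f h"
proof -
  define d where "d k t = g (Suc k) t - g k t" for k t
  have g: "g k \<in> borel_measurable F" "integrable M (g k)" for k using s(2) by (auto simp: is_cond_exp_def)
  have d: "d k \<in> borel_measurable F" "integrable M (d k)" for k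
    using g unfolding d_def[abs_def] by auto
  have "(\<integral>t. norm (d k t) \<partial>M) \<le> 2 * (1 / 2) ^ k" for k
  proof -
    have "(\<integral>t. norm (d k t) \<partial>M) \<le> (\<integral>t. norm (s (Suc k) t - s k t) \<partial>M)"
      unfolding d_def using s by (intro is_cond_exp_integral_norm_le is_cond_exp_diff) auto
    also have "\<dots> \<le> (\<integral>t. norm (s (Suc k) t - f t) + norm (s k t - f t) \<partial>M)"
    proof (rule integral_mono)
      fix t
      show "norm (s (Suc k) t - s k t) \<le> norm (s (Suc k) t - f t) + norm (s k t - f t)"
        using norm_triangle_ineq4[of "s (Suc k) t - f t" "s k t - f t"] by simp
    qed (use s f in auto)
    also have "\<dots> \<le> (1 / 2) ^ Suc k + (1 / 2) ^ k"
      using s f lim[of "Suc k"] lim[of k] by (subst Bochner_Integration.integral_add) auto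
    also have "\<dots> \<le> 2 * (1 / 2) ^ k" by simp
    finally show ?thesis .
  qed
  moreover have "summable (\<lambda>k. 2 * (1 / 2 :: real) ^ k)" by (intro summable_mult summable_geometric) simp
  ultimately have sumd: "summable (\<lambda>k. \<integral>t. norm (d k t) \<partial>M)"
    by (intro summable_comparison_test'[of "\<lambda>k. 2 * (1 / 2) ^ k" 0 "\<lambda>k. \<integral>t. norm (d k t) \<partial>M"]) simp_all
  have AEsum: "AE t in M. summable (\<lambda>k. norm (d k t))"
  proof -
    have "(\<integral>\<^sup>+t. (\<Sum>k. ennreal (norm (d k t))) \<partial>M) = (\<Sum>k. \<integral>\<^sup>+t. ennreal (norm (d k t)) \<partial>M)"
      using d(2) by (intro nn_integral_suminf) auto
    also have "\<dots> = (\<Sum>k. ennreal (\<integral>t. norm (d k t) \<partial>M))"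
      using d(2) by (simp add: nn_integral_eq_integral)
    also have "\<dots> \<noteq> \<infinity>" using sumd by (simp add: ennreal_suminf_neq_top)
    finally have "AE t in M. (\<Sum>k. ennreal (norm (d k t))) \<noteq> \<infinity>"
      using d(2) by (intro nn_integral_PInf_AE) auto
    then show ?thesis
    proof eventually_elim
      case (elim t)
      then show ?case by (intro summable_suminf_not_top) auto
    qed
  qed
  \<comment> \<open>Where the series diverges \<open>suminf\<close> takes an unspecified value; this
    happens on a null set only, and the formula is \<open>F\<close>-measurable all the same.\<close>
  define h where "h t = g 0 t + (\<Sum>k. d k t)" for t
  have hM: "h \<in> borel_measurable F" unfolding h_def[abs_def] using g(1) d(1) by measurable
  have hi: "integrable M h" unfolding h_def[abs_def]
    using g(2) integrable_suminf[OF d(2) AEsum sumd] by auto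
  have "(LINT t:D|M. f t) = (LINT t:D|M. h t)" if D: "D \<in> sets F" for D
  proof -
    have DM: "D \<in> sets M" using D by (rule sets_subalg)
    have int: "set_integrable M D u" if "integrable M u" for u :: "'a \<Rightarrow> 'x"
      using that DM unfolding set_integrable_def by (intro integrable_mult_indicator)
    have diff: "integrable M u \<Longrightarrow> integrable M v \<Longrightarrow>
      (LINT t:D|M. u t - v t) = (LINT t:D|M. u t) - (LINT t:D|M. v t)" for u v :: "'a \<Rightarrow> 'x"
      by (intro set_integral_diff int)
    have "(\<lambda>k. \<integral>t. indicator D t *\<^sub>R d k t \<partial>M) sums (\<integral>t. (\<Sum>k. indicator D t *\<^sub>R d k t) \<partial>M)"
    proof (rule sums_integral)
      show "integrable M (\<lambda>t. indicator D t *\<^sub>R d k t)" for k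
        using d(2) DM by (intro integrable_mult_indicator)
      show "AE t in M. summable (\<lambda>k. norm (indicator D t *\<^sub>R d k t))"
        using AEsum by eventually_elim (auto simp: indicator_def)
      have "(\<integral>t. norm (indicator D t *\<^sub>R d k t) \<partial>M) \<le> (\<integral>t. norm (d k t) \<partial>M)" for k
      proof (rule integral_mono)
        show "integrable M (\<lambda>t. norm (indicator D t *\<^sub>R d k t))"
          using d(2) DM by (intro integrable_norm integrable_mult_indicator)
      qed (use d(2) in \<open>auto simp: indicator_def\<close>)
      then show "summable (\<lambda>k. \<integral>t. norm (indicator D t *\<^sub>R d k t) \<partial>M)"
        by (intro summable_comparison_test'[OF sumd, where N = 0]) auto
    qed
    moreover have "AE t in M. (\<Sum>k. indicator D t *\<^sub>R d k t) = indicator D t *\<^sub>R (h t - g 0 t)"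
      using AEsum by eventually_elim
        (simp add: h_def suminf_scaleR_right[OF summable_norm_cancel, symmetric])
    then have "(\<integral>t. (\<Sum>k. indicator D t *\<^sub>R d k t) \<partial>M) = (LINT t:D|M. h t - g 0 t)"
      unfolding set_lebesgue_integral_def
      using hi g(2) d(2) DM by (intro integral_cong_AE) auto
    ultimately have "(\<lambda>n. \<Sum>k<n. LINT t:D|M. d k t) \<longlonglongrightarrow> (LINT t:D|M. h t) - (LINT t:D|M. g 0 t)"
      using diff[OF hi g(2)] by (simp add: sums_def set_lebesgue_integral_def)
    moreover have "(\<Sum>k<n. LINT t:D|M. d k t) = (LINT t:D|M. g n t) - (LINT t:D|M. g 0 t)" for n
      unfolding d_def using diff[OF g(2) g(2)] sum_lessThan_telescope[of "\<lambda>k. LINT t:D|M. g k t" n]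
      by simp
    ultimately have "(\<lambda>n. (LINT t:D|M. g n t) - (LINT t:D|M. g 0 t)) \<longlonglongrightarrow> (LINT t:D|M. h t) - (LINT t:D|M. g 0 t)"
      by simp
    from tendsto_add[OF this tendsto_const[of "LINT t:D|M. g 0 t"]]
    have "(\<lambda>n. LINT t:D|M. g n t) \<longlonglongrightarrow> (LINT t:D|M. h t)" by simp
    moreover have "(\<lambda>n. LINT t:D|M. g n t) \<longlonglongrightarrow> (LINT t:D|M. f t)"
    proof -
      have "norm ((LINT t:D|M. g n t) - (LINT t:D|M. f t)) \<le> (1 / 2) ^ n" for n
      proof -
        have "(LINT t:D|M. g n t) - (LINT t:D|M. f t) = (LINT t:D|M. s n t - f t)"
          using s(2)[of n] D diff[OF s(1) f, of n] by (auto simp: is_cond_exp_def)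
        also have "norm \<dots> \<le> (\<integral>t. norm (indicator D t *\<^sub>R (s n t - f t)) \<partial>M)"
          unfolding set_lebesgue_integral_def by (rule integral_norm_bound)
        also have "\<dots> \<le> (\<integral>t. norm (s n t - f t) \<partial>M)"
        proof (rule integral_mono)
          show "integrable M (\<lambda>t. norm (indicator D t *\<^sub>R (s n t - f t)))"
            using s(1) f DM by (intro integrable_norm integrable_mult_indicator) auto
        qed (use s(1) f in \<open>auto simp: indicator_def\<close>)
        finally show ?thesis using lim[of n] by simp
      qed
      then have "(\<lambda>n. (LINT t:D|M. g n t) - (LINT t:D|M. f t)) \<longlonglongrightarrow> 0"
        by (intro Lim_null_comparison[OF _ LIMSEQ_power_zero[of "1 / 2 :: real"]] always_eventually) auto
      then show ?thesis by (simp add: LIM_zero_iff)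
    qed
    ultimately show ?thesis by (rule LIMSEQ_unique[symmetric])
  qed
  then have "is_cond_exp M F f h" using hM hi by (auto simp: is_cond_exp_def)
  then show ?thesis by blast
qed

text \<open>For an indicator times a vector, the scalar conditional expectation is multiplied by the
  vector. Limits are reached along a subsequence that converges fast enough in the mean.\<close>

lemma ex_is_cond_exp:
  fixes f :: "'a \<Rightarrow> 'x::{banach, second_countable_topology}"
  assumes "integrable M f"
  shows "\<exists>g. is_cond_exp M F f g"
  using assms
proof (induction f rule: integrable_induct)
  case (base A c)
  define g where "g = real_cond_exp M F (indicator A)"
  have iA: "integrable M (indicator A :: 'a \<Rightarrow> real)" using base by (simp add: integrable_indicator_iff)
  have gi: "integrable M g" unfolding g_def by (rule real_cond_exp_int(1)[OF iA])
  have "(LINT t:D|M. indicator A t *\<^sub>R c) = (LINT t:D|M. g t *\<^sub>R c)" if D: "D \<in> sets F" for D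
  proof -
    have *: "(LINT t:D|M. u t *\<^sub>R c) = (LINT t:D|M. u t) *\<^sub>R c" if "integrable M u" for u :: "'a \<Rightarrow> real"
      unfolding set_lebesgue_integral_def
      using integral_scaleR_left[of c M "\<lambda>t. indicator D t *\<^sub>R u t"]
        integrable_mult_indicator[OF sets_subalg[OF D] that] by simp
    show ?thesis using real_cond_exp_intA[OF iA D] *[OF iA] *[OF gi] by (simp add: g_def)
  qed
  then show ?case using gi by (intro exI[of _ "\<lambda>t. g t *\<^sub>R c"]) (auto simp: is_cond_exp_def g_def)
next
  case (add f f')
  then obtain g g' where *: "is_cond_exp M F f g" "is_cond_exp M F f' g'" by blast
  have "set_integrable M D f" "set_integrable M D f'" "set_integrable M D g" "set_integrable M D g'"
    if "D \<in> sets F" for D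
    using add * sets_subalg[OF that] unfolding set_integrable_def is_cond_exp_def
    by (auto intro: integrable_mult_indicator)
  then have "is_cond_exp M F (\<lambda>t. f t + f' t) (\<lambda>t. g t + g' t)" using * unfolding is_cond_exp_def
    by (intro conjI borel_measurable_add) (simp_all add: set_integral_add)
  then show ?case by blast
next
  case (lim f s)
  \<comment> \<open>The approximants satisfy \<open>norm (s k t) \<le> 2 * norm (f t)\<close>,
    whence the dominating function \<open>3 * norm (f t)\<close>.\<close>
  have "(\<lambda>k. \<integral>t. norm (s k t - f t) \<partial>M) \<longlonglongrightarrow> (\<integral>t. 0 \<partial>M)"
  proof (rule integral_dominated_convergence[where w = "\<lambda>t. 3 * norm (f t)"])
    show "AE t in M. (\<lambda>k. norm (s k t - f t)) \<longlonglongrightarrow> 0"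
      using lim.hyps(2) by (intro AE_I2 tendsto_norm_zero) (simp add: LIM_zero_iff)
    show "AE t in M. norm (norm (s k t - f t)) \<le> 3 * norm (f t)" for k
    proof (rule AE_I2)
      fix t assume "t \<in> space M"
      then show "norm (norm (s k t - f t)) \<le> 3 * norm (f t)"
        using lim.hyps(3)[of t k] norm_triangle_ineq4[of "s k t" "f t"] by simp
    qed
  qed (use lim in auto)
  then have "\<exists>n. (\<integral>t. norm (s n t - f t) \<partial>M) \<le> (1 / 2) ^ k" for k
    using order_tendstoD(2)[of "\<lambda>k. \<integral>t. norm (s k t - f t) \<partial>M" 0 sequentially "(1 / 2) ^ k"]
    by (auto simp: eventually_sequentially intro: less_imp_le)
  then obtain r where r: "\<And>k. (\<integral>t. norm (s (r k) t - f t) \<partial>M) \<le> (1 / 2) ^ k" by metis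
  obtain g where "\<And>k. is_cond_exp M F (s k) (g k)" using lim.IH by metis
  then show ?case
    by (intro is_cond_exp_L1_limit[of "\<lambda>k. s (r k)" "\<lambda>k. g (r k)"]) (use lim r in auto)
qed

end

section \<open>Splitting sets with prescribed conditional probability\<close>

context finite_measure_subalgebra
begin

abbreviation cond_prob :: "'a set \<Rightarrow> 'a \<Rightarrow> real" where
  "cond_prob C \<equiv> real_cond_exp M F (indicator C)"

lemma integrable_indicator_sets: "C \<in> sets M \<Longrightarrow> integrable M (indicator C :: 'a \<Rightarrow> real)"
  by (simp add: integrable_indicator_iff emeasure_eq_measure)

lemma integrable_cond_prob: "C \<in> sets M \<Longrightarrow> integrable M (cond_prob C)"
  by (intro real_cond_exp_int integrable_indicator_sets)

lemma set_integral_cond_prob: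
  assumes "A \<in> sets F" "C \<in> sets M"
  shows "(LINT t:A|M. cond_prob C t) = measure M (A \<inter> C)"
proof -
  have "(LINT t:A|M. cond_prob C t) = (LINT t:A|M. indicator C t)"
    using real_cond_exp_intA[OF integrable_indicator_sets[OF assms(2)] assms(1)] by simp
  also have "\<dots> = (\<integral>t. indicator (A \<inter> C) t \<partial>M)"
    unfolding set_lebesgue_integral_def by (simp add: indicator_inter_arith)
  also have "\<dots> = measure M (A \<inter> C)"
    using sets_subalg[OF assms(1)] assms(2) sets.sets_into_space
    by (simp add: Int_absorb2)
  finally show ?thesis .
qed

lemma cond_prob_nonneg: "C \<in> sets M \<Longrightarrow> AE t in M. 0 \<le> cond_prob C t"
  by (rule real_cond_exp_pos) auto

lemma cond_prob_le_1: "C \<in> sets M \<Longrightarrow> AE t in M. cond_prob C t \<le> 1"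
  by (rule real_cond_exp_le_c) (auto simp: integrable_indicator_sets indicator_def)

lemma cond_prob_Int:
  assumes A: "A \<in> sets F" and C: "C \<in> sets M"
  shows "AE t in M. cond_prob (A \<inter> C) t = indicator A t * cond_prob C t"
proof -
  have eq: "indicator (A \<inter> C) = (\<lambda>t. indicator A t * indicator C t :: real)"
    by (simp add: fun_eq_iff indicator_inter_arith)
  have "integrable M (\<lambda>t. indicator A t * indicator C t :: real)"
    using integrable_indicator_sets[of "A \<inter> C"] C sets_subalg[OF A] unfolding eq by simp
  then show ?thesis unfolding eq
    using A C by (intro real_cond_exp_mult) auto
qed

lemma cond_prob_Diff:
  assumes "C \<in> sets M" "B \<in> sets M" "B \<subseteq> C"
  shows "AE t in M. cond_prob (C - B) t = cond_prob C t - cond_prob B t"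
proof -
  have "indicator (C - B) t = (indicator C t - indicator B t :: real)" for t
    using assms(3) by (auto simp: indicator_def)
  then have "cond_prob (C - B) = real_cond_exp M F (\<lambda>t. indicator C t - indicator B t)" by presburger
  then show ?thesis
    using real_cond_exp_diff[OF integrable_indicator_sets[OF assms(1)] integrable_indicator_sets[OF assms(2)]]
    by simp
qed

end

locale nowhere_equivalent_subalgebra = finite_measure_subalgebra +
  assumes nowhere_equiv: "nowhere_equivalent M F"
begin

text \<open>At each point either \<open>D0\<close> or \<open>D - D0\<close> carries at most half of
  the conditional probability of \<open>D\<close>; the set \<open>A\<close> in \<open>F\<close>
  records where \<open>D0\<close> does, and \<open>B\<close> is its complement. The two good pieces
  together are the symmetric difference of \<open>D0\<close> and \<open>D \<inter> B\<close>, so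
  nowhere equivalence prevents both from being null.\<close>

lemma halve_cond_prob:
  assumes D: "D \<in> sets M" and pos: "0 < measure M D"
  shows "\<exists>D'\<in>sets M. D' \<subseteq> D \<and> 0 < measure M D' \<and> (AE t in M. cond_prob D' t \<le> cond_prob D t / 2)"
proof -
  obtain D0 where D0: "D0 \<in> sets M" "D0 \<subseteq> D"
    and ne0: "\<forall>D1\<in>{D \<inter> D' |D'. D' \<in> sets F}. 0 < measure M (sym_diff D0 D1)"
    using nowhere_equiv[unfolded nowhere_equivalent_def, rule_format, OF D pos] by (elim bexE conjE)
  have ne: "0 < measure M (sym_diff D0 (D \<inter> D'))" if "D' \<in> sets F" for D'
    by (rule bspec[OF ne0]) (use that in auto)
  define A where "A = {t \<in> space F. cond_prob D0 t \<le> cond_prob D t / 2}"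
  have A: "A \<in> sets F" unfolding A_def by measurable
  define B where "B = space F - A"
  have B: "B \<in> sets F" using A by (simp add: B_def)
  have *: "AE t in M. cond_prob (A \<inter> D0) t \<le> cond_prob D t / 2"
    using cond_prob_Int[OF A D0(1)] cond_prob_nonneg[OF D] AE_space
  proof eventually_elim
    case (elim t)
    then show ?case by (cases "t \<in> A") (auto simp: A_def)
  qed
  have **: "AE t in M. cond_prob (B \<inter> (D - D0)) t \<le> cond_prob D t / 2"
    using cond_prob_Int[OF B sets.Diff[OF D D0(1)]] cond_prob_Diff[OF D D0] cond_prob_nonneg[OF D] AE_space
  proof eventually_elim
    case (elim t)
    show ?case
    proof (cases "t \<in> B")
      case True
      then have "\<not> cond_prob D0 t \<le> cond_prob D t / 2" by (auto simp: B_def A_def)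
      then show ?thesis using True elim by simp
    qed (use elim in simp)
  qed
  have "sym_diff D0 (D \<inter> B) = (A \<inter> D0) \<union> (B \<inter> (D - D0))"
    using D0(2) sets.sets_into_space[OF D] by (auto simp: B_def space_subalg)
  then have "0 < measure M ((A \<inter> D0) \<union> (B \<inter> (D - D0)))" using ne[OF B] by simp
  also have "\<dots> \<le> measure M (A \<inter> D0) + measure M (B \<inter> (D - D0))"
    using A B D D0 by (intro measure_Un_le) (auto dest: sets_subalg)
  finally have "0 < measure M (A \<inter> D0) \<or> 0 < measure M (B \<inter> (D - D0))"
    by (metis add_0 less_eq_real_def measure_nonneg not_less)
  then show ?thesis
  proof
    assume "0 < measure M (A \<inter> D0)"
    then show ?thesis using * D0 A by (intro bexI[of _ "A \<inter> D0"]) (auto dest: sets_subalg)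
  next
    assume "0 < measure M (B \<inter> (D - D0))"
    then show ?thesis using ** D D0 B by (intro bexI[of _ "B \<inter> (D - D0)"]) (auto dest: sets_subalg)
  qed
qed

lemma small_cond_prob:
  assumes D: "D \<in> sets M" and pos: "0 < measure M D"
  shows "\<exists>D'\<in>sets M. D' \<subseteq> D \<and> 0 < measure M D' \<and> (AE t in M. cond_prob D' t \<le> (1 / 2) ^ k)"
proof (induction k)
  case 0
  then show ?case using assms cond_prob_le_1[OF D] by (intro bexI[of _ D]) auto
next
  case (Suc k)
  then obtain D' where D': "D' \<in> sets M" "D' \<subseteq> D" "0 < measure M D'"
    and le: "AE t in M. cond_prob D' t \<le> (1 / 2) ^ k" by blast
  obtain D2 where D2: "D2 \<in> sets M" "D2 \<subseteq> D'" "0 < measure M D2"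
    and le2: "AE t in M. cond_prob D2 t \<le> cond_prob D' t / 2" using halve_cond_prob[OF D'(1,3)] by blast
  have "AE t in M. cond_prob D2 t \<le> (1 / 2) ^ Suc k" using le le2 by eventually_elim auto
  then show ?case using D' D2 by (intro bexI[of _ D2]) auto
qed

end

text \<open>Exhaustion in countably many steps: the \<open>n\<close>-th extension comes within
  \<open>(1 / 2) ^ n\<close> of the supremum over all its further extensions, so no member of larger
  measure extends the union.\<close>

lemma (in finite_measure) ex_measure_maximal:
  assumes "S0 \<in> \<S>" "\<S> \<subseteq> sets M"
    and Un: "\<And>S. range S \<subseteq> \<S> \<Longrightarrow> incseq S \<Longrightarrow> (\<Union>n. S n :: 'a set) \<in> \<S>"
  shows "\<exists>S\<in>\<S>. \<forall>S'\<in>\<S>. S \<subseteq> S' \<longrightarrow> measure M S' \<le> measure M S"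
proof -
  have step: "\<exists>S'\<in>\<S>. S \<subseteq> S' \<and> (\<forall>S''\<in>\<S>. S' \<subseteq> S'' \<longrightarrow> measure M S'' \<le> measure M S' + (1 / 2) ^ n)"
    if S: "S \<in> \<S>" for S and n :: nat
  proof -
    define s where "s = (SUP S'\<in>{S' \<in> \<S>. S \<subseteq> S'}. measure M S')"
    have bdd: "bdd_above (measure M ` {S' \<in> \<S>. S \<subseteq> S'})"
      by (rule bdd_aboveI2[where M = "measure M (space M)"]) (rule bounded_measure)
    have "s - (1 / 2) ^ n < s" by simp
    then obtain S' where S': "S' \<in> \<S>" "S \<subseteq> S'" "s - (1 / 2) ^ n < measure M S'"
      using less_cSUP_iff[of "{S' \<in> \<S>. S \<subseteq> S'}", OF _ bdd, of "s - (1 / 2) ^ n"] S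
      unfolding s_def by blast
    have "measure M S'' \<le> measure M S' + (1 / 2) ^ n" if "S'' \<in> \<S>" "S' \<subseteq> S''" for S''
    proof -
      have "measure M S'' \<le> s" unfolding s_def using that S' by (intro cSUP_upper bdd) auto
      then show ?thesis using S'(3) by simp
    qed
    then show ?thesis using S' by blast
  qed
  have "\<exists>S. \<forall>n. S n \<in> \<S> \<and> (S n \<subseteq> S (Suc n) \<and>
      (\<forall>S''\<in>\<S>. S (Suc n) \<subseteq> S'' \<longrightarrow> measure M S'' \<le> measure M (S (Suc n)) + (1 / 2) ^ n))"
  proof (rule dependent_nat_choice[where P = "\<lambda>_ S. S \<in> \<S>" and Q = "\<lambda>n S S'. S \<subseteq> S' \<and>
      (\<forall>S''\<in>\<S>. S' \<subseteq> S'' \<longrightarrow> measure M S'' \<le> measure M S' + (1 / 2) ^ n)"])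
    show "\<exists>S. S \<in> \<S>" using assms(1) by blast
    show "\<exists>S'. S' \<in> \<S> \<and> (S \<subseteq> S' \<and>
        (\<forall>S''\<in>\<S>. S' \<subseteq> S'' \<longrightarrow> measure M S'' \<le> measure M S' + (1 / 2) ^ n))" if "S \<in> \<S>" for S n
      using step[OF that, of n] by (simp only: Bex_def)
  qed
  then obtain S where S0: "\<forall>n. S n \<in> \<S> \<and> (S n \<subseteq> S (Suc n) \<and>
      (\<forall>S''\<in>\<S>. S (Suc n) \<subseteq> S'' \<longrightarrow> measure M S'' \<le> measure M (S (Suc n)) + (1 / 2) ^ n))" ..
  have S: "S n \<in> \<S>" "S n \<subseteq> S (Suc n)"
    "\<forall>S''\<in>\<S>. S (Suc n) \<subseteq> S'' \<longrightarrow> measure M S'' \<le> measure M (S (Suc n)) + (1 / 2) ^ n" for n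
    using S0[rule_format, of n] by simp_all
  define U where "U = (\<Union>n. S n)"
  have U: "U \<in> \<S>" unfolding U_def using S by (intro Un) (auto simp: incseq_SucI)
  have "measure M S' \<le> measure M U" if S': "S' \<in> \<S>" "U \<subseteq> S'" for S'
  proof -
    have "measure M S' \<le> measure M U + (1 / 2) ^ n" for n
    proof -
      have "S (Suc n) \<subseteq> U" unfolding U_def by blast
      then have "measure M S' \<le> measure M (S (Suc n)) + (1 / 2) ^ n" "measure M (S (Suc n)) \<le> measure M U"
        using S' S(3)[of n] U assms(2) by (auto intro!: finite_measure_mono)
      then show ?thesis by simp
    qed
    moreover have "(\<lambda>n. measure M U + (1 / 2) ^ n) \<longlonglongrightarrow> measure M U + 0"
      by (intro tendsto_add tendsto_const LIMSEQ_power_zero) simp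
    ultimately show ?thesis by (intro LIMSEQ_le_const[of _ "measure M U"]) auto
  qed
  then show ?thesis using U by blast
qed

context nowhere_equivalent_subalgebra
begin

text \<open>Exhaustion: a maximal \<open>S \<subseteq> C\<close> of conditional probability at most \<open>q\<close> attains \<open>q\<close>, since
  otherwise a set of small conditional probability could be added to it.\<close>

lemma split_density:
  assumes C: "C \<in> sets M" and q: "q \<in> borel_measurable F" "integrable M q"
    and nonneg: "\<And>A. A \<in> sets F \<Longrightarrow> 0 \<le> (LINT t:A|M. q t)"
    and le: "\<And>A. A \<in> sets F \<Longrightarrow> (LINT t:A|M. q t) \<le> measure M (A \<inter> C)"
  shows "\<exists>S\<in>sets M. S \<subseteq> C \<and> (\<forall>A\<in>sets F. measure M (A \<inter> S) = (LINT t:A|M. q t))"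
proof -
  define \<S> where "\<S> = {S \<in> sets M. S \<subseteq> C \<and> (\<forall>A\<in>sets F. measure M (A \<inter> S) \<le> (LINT t:A|M. q t))}"
  have "\<exists>S\<in>\<S>. \<forall>S'\<in>\<S>. S \<subseteq> S' \<longrightarrow> measure M S' \<le> measure M S"
  proof (rule ex_measure_maximal)
    show "{} \<in> \<S>" using nonneg by (auto simp: \<S>_def)
    show "\<S> \<subseteq> sets M" by (auto simp: \<S>_def)
    fix S :: "nat \<Rightarrow> 'a set" assume S: "range S \<subseteq> \<S>" "incseq S"
    have SM: "S n \<in> sets M" "S n \<subseteq> C" for n using S(1) by (auto simp: \<S>_def)
    have "measure M (A \<inter> (\<Union>n. S n)) \<le> (LINT t:A|M. q t)" if A: "A \<in> sets F" for A
    proof -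
      have "(\<lambda>n. measure M (A \<inter> S n)) \<longlonglongrightarrow> measure M (\<Union>n. A \<inter> S n)"
        using SM sets_subalg[OF A] monoD[OF S(2)]
        by (intro finite_Lim_measure_incseq monoI Int_mono order_refl) (auto intro!: monoI)
      moreover have "measure M (A \<inter> S n) \<le> (LINT t:A|M. q t)" for n
        using S(1) A by (auto simp: \<S>_def)
      ultimately have "measure M (\<Union>n. A \<inter> S n) \<le> (LINT t:A|M. q t)"
        by (intro LIMSEQ_le_const2) auto
      then show ?thesis by (simp only: Int_UN_distrib)
    qed
    then show "(\<Union>n. S n) \<in> \<S>" using SM by (auto simp: \<S>_def)
  qed
  then obtain S where S: "S \<in> sets M" "S \<subseteq> C"
    and Sq: "\<And>A. A \<in> sets F \<Longrightarrow> measure M (A \<inter> S) \<le> (LINT t:A|M. q t)"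
    and max: "\<And>S'. S' \<in> \<S> \<Longrightarrow> S \<subseteq> S' \<Longrightarrow> measure M S' \<le> measure M S"
    by (auto simp: \<S>_def)
  have "measure M (A \<inter> S) = (LINT t:A|M. q t)" if A: "A \<in> sets F" for A
  proof (rule ccontr)
    assume "measure M (A \<inter> S) \<noteq> (LINT t:A|M. q t)"
    then have less: "measure M (A \<inter> S) < (LINT t:A|M. q t)" using Sq[OF A] by simp
    \<comment> \<open>The sets on which the deficit \<open>q - cond_prob S\<close> exceeds
      \<open>(1 / 2) ^ k\<close>. If all of them were null, \<open>S\<close> would have conditional
      probability at least \<open>q\<close>, against the strict inequality on
      \<open>A\<close>.\<close>
    define B where "B k = {t \<in> space F. (1 / 2) ^ k < q t - cond_prob S t}" for k :: nat
    have B: "B k \<in> sets F" for k unfolding B_def using q(1) by measurable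
    have int: "set_integrable M D u" if "integrable M u" "D \<in> sets F" for u :: "'a \<Rightarrow> real" and D
      using that sets_subalg unfolding set_integrable_def by (intro integrable_mult_indicator) auto
    have "\<exists>k. 0 < measure M (B k)"
    proof (rule ccontr)
      assume "\<not> ?thesis"
      then have "measure M (B k) = 0" for k by (metis measure_nonneg order_antisym_conv not_le)
      then have "B k \<in> null_sets M" for k
        using sets_subalg[OF B] by (intro null_setsI) (auto simp: emeasure_eq_measure)
      then have "AE t in M. \<forall>k. t \<notin> B k" by (simp add: AE_all_countable AE_not_in)
      then have "AE t in M. q t \<le> cond_prob S t" using AE_space
      proof eventually_elim
        case (elim t)
        show ?case
        proof (rule ccontr)
          assume "\<not> ?case"
          then have "0 < q t - cond_prob S t" by simp
          then obtain k where "(1 / 2) ^ k < q t - cond_prob S t"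
            using real_arch_pow_inv[of "q t - cond_prob S t" "1 / 2"] by auto
          then show False using elim by (auto simp: B_def space_subalg)
        qed
      qed
      then have "(LINT t:A|M. q t) \<le> (LINT t:A|M. cond_prob S t)"
        using q S A by (intro set_integral_mono_AE int) (auto simp: integrable_cond_prob)
      then show False using less set_integral_cond_prob[OF A S(1)] by simp
    qed
    then obtain k where k: "0 < measure M (B k)" by blast
    have half: "0 < (1 / 2 :: real) ^ k" by simp
    define D where "D = B k \<inter> (C - S)"
    have gap: "measure M (A \<inter> S) + (1 / 2) ^ k * measure M A \<le> (LINT t:A|M. q t)"
      if A: "A \<in> sets F" "A \<subseteq> B k" for A
    proof -
      have c: "integrable M (\<lambda>t. (1 / 2) ^ k :: real)" by simp
      have "(LINT t:A|M. cond_prob S t + (1 / 2) ^ k) \<le> (LINT t:A|M. q t)"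
      proof (rule set_integral_mono)
        show "set_integrable M A (\<lambda>t. cond_prob S t + (1 / 2) ^ k)"
          using A S by (intro int Bochner_Integration.integrable_add c integrable_cond_prob)
      qed (use A q int in \<open>auto simp: B_def\<close>)
      moreover have "(LINT t:A|M. cond_prob S t + (1 / 2) ^ k) = measure M (A \<inter> S) + (1 / 2) ^ k * measure M A"
        using set_integral_add(2)[OF int[OF integrable_cond_prob[OF S(1)] A(1)] int[OF c A(1)]]
          set_integral_cond_prob[OF A(1) S(1)] sets_subalg[OF A(1)]
        by (simp add: mult.commute set_lebesgue_integral_def)
      ultimately show ?thesis by simp
    qed
    have DM: "D \<in> sets M" using B sets_subalg C S by (auto simp: D_def)
    \<comment> \<open>Since \<open>q\<close> integrates over \<open>B k\<close> to at most
      \<open>measure M (B k \<inter> C)\<close>, the deficit leaves room in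
      \<open>C - S\<close>.\<close>
    have "measure M (B k \<inter> S) < measure M (B k \<inter> C)"
      using gap[OF B order_refl] le[OF B, of k] k half by (smt (verit) mult_pos_pos)
    moreover have "measure M (B k \<inter> C) = measure M (B k \<inter> S) + measure M D"
    proof -
      have "B k \<inter> C = (B k \<inter> S) \<union> D" using S(2) by (auto simp: D_def)
      then show ?thesis
        using finite_measure_Union[of "B k \<inter> S" D] DM S sets_subalg[OF B] by (auto simp: D_def)
    qed
    ultimately have "0 < measure M D" by simp
    then obtain D' where D': "D' \<in> sets M" "D' \<subseteq> D" "0 < measure M D'"
      and small: "AE t in M. cond_prob D' t \<le> (1 / 2) ^ k" using small_cond_prob[OF DM] by blast
    have dis: "S \<inter> D' = {}" using D'(2) by (auto simp: D_def)
    \<comment> \<open>Over \<open>B k\<close> the added \<open>D'\<close> has conditional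
      probability at most \<open>(1 / 2) ^ k\<close>, which the deficit exceeds; outside of
      \<open>B k\<close> nothing is added.\<close>
    have "measure M (A \<inter> (S \<union> D')) \<le> (LINT t:A|M. q t)" if A: "A \<in> sets F" for A
    proof -
      define A1 A2 where "A1 = A \<inter> B k" and "A2 = A - B k"
      have A12: "A1 \<in> sets F" "A2 \<in> sets F" "A1 \<inter> A2 = {}" "A = A1 \<union> A2"
        using A B by (auto simp: A1_def A2_def)
      have "A \<inter> (S \<union> D') = (A1 \<inter> S) \<union> (A1 \<inter> D') \<union> (A2 \<inter> S)"
        using D'(2) by (auto simp: A1_def A2_def D_def)
      moreover have "measure M ((A1 \<inter> S) \<union> (A1 \<inter> D') \<union> (A2 \<inter> S))
          = measure M (A1 \<inter> S) + measure M (A1 \<inter> D') + measure M (A2 \<inter> S)"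
      proof -
        have "A1 \<inter> S \<in> sets M" "A1 \<inter> D' \<in> sets M" "A2 \<inter> S \<in> sets M"
          using A12 S D' sets_subalg by auto
        moreover have "(A1 \<inter> S) \<inter> (A1 \<inter> D') = {}" "((A1 \<inter> S) \<union> (A1 \<inter> D')) \<inter> (A2 \<inter> S) = {}"
          using dis A12(3) by auto
        ultimately show ?thesis by (simp add: finite_measure_Union)
      qed
      moreover have "measure M (A1 \<inter> D') \<le> (1 / 2) ^ k * measure M A1"
      proof -
        have "measure M (A1 \<inter> D') = (LINT t:A1|M. cond_prob D' t)"
          using set_integral_cond_prob[OF A12(1) D'(1)] by simp
        also have "\<dots> \<le> (LINT t:A1|M. (1 / 2) ^ k)"
        proof (rule set_integral_mono_AE)
          show "set_integrable M A1 (cond_prob D')" "set_integrable M A1 (\<lambda>t. (1 / 2) ^ k :: real)"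
            using A12 D' by (auto intro!: int integrable_cond_prob)
          show "AE t\<in>A1 in M. cond_prob D' t \<le> (1 / 2) ^ k" using small by eventually_elim simp
        qed
        also have "\<dots> = (1 / 2) ^ k * measure M A1"
          using sets_subalg[OF A12(1)] by (simp add: mult.commute set_lebesgue_integral_def)
        finally show ?thesis .
      qed
      moreover have "measure M (A1 \<inter> S) + (1 / 2) ^ k * measure M A1 \<le> (LINT t:A1|M. q t)"
        by (rule gap[OF A12(1)]) (simp add: A1_def)
      moreover have "measure M (A2 \<inter> S) \<le> (LINT t:A2|M. q t)" by (rule Sq[OF A12(2)])
      moreover have "(LINT t:A|M. q t) = (LINT t:A1|M. q t) + (LINT t:A2|M. q t)"
        by (subst A12(4), rule set_integral_Un[OF A12(3)]) (use A12(1,2) q int in auto)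
      ultimately show ?thesis by simp
    qed
    then have "S \<union> D' \<in> \<S>" using S D' by (auto simp: \<S>_def D_def)
    then have "measure M (S \<union> D') \<le> measure M S" by (rule max) auto
    moreover have "measure M (S \<union> D') = measure M S + measure M D'"
      using S D' dis by (intro finite_measure_Union) auto
    ultimately show False using D'(3) by simp
  qed
  then show ?thesis using S by blast
qed

text \<open>Domination by \<open>measure M (A \<inter> C)\<close> turns finite additivity into
  continuity at the empty set, hence into countable additivity, and gives absolute continuity. The
  scalar Radon--Nikodym theorem on \<open>F\<close> supplies the density to be split off.\<close>

lemma split_measure:
  fixes \<nu> :: "'a set \<Rightarrow> real"
  assumes C: "C \<in> sets M" and nonneg: "\<And>A. A \<in> sets F \<Longrightarrow> 0 \<le> \<nu> A"
    and le: "\<And>A. A \<in> sets F \<Longrightarrow> \<nu> A \<le> measure M (A \<inter> C)"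
    and add: "\<And>A B. A \<in> sets F \<Longrightarrow> B \<in> sets F \<Longrightarrow> A \<inter> B = {} \<Longrightarrow> \<nu> (A \<union> B) = \<nu> A + \<nu> B"
  shows "\<exists>S\<in>sets M. S \<subseteq> C \<and> (\<forall>A\<in>sets F. measure M (A \<inter> S) = \<nu> A)"
proof -
  let ?R = "restr_to_subalg M F"
  interpret R: finite_measure ?R
    by (rule finite_measure_restr_to_subalg[OF subalg]) (rule finite_measure_axioms)
  define N where "N = measure_of (space F) (sets F) (\<lambda>A. ennreal (\<nu> A))"
  have emp: "\<nu> {} = 0" using nonneg[of "{}"] le[of "{}"] by simp
  have ca: "countably_additive (sets F) (\<lambda>A. ennreal (\<nu> A))"
  proof (rule sets.empty_continuous_imp_countably_additive)
    show "positive (sets F) (\<lambda>A. ennreal (\<nu> A))" by (simp add: positive_def emp)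
    show "additive (sets F) (\<lambda>A. ennreal (\<nu> A))" unfolding additive_def
      using add nonneg by (auto simp: ennreal_plus)
    show "\<forall>A\<in>sets F. ennreal (\<nu> A) \<noteq> \<infinity>" by simp
    fix A :: "nat \<Rightarrow> 'a set" assume A: "range A \<subseteq> sets F" "decseq A" "(\<Inter>i. A i) = {}"
    have AM: "A i \<in> sets F" "A i \<in> sets M" for i using A(1) sets_subalg by auto
    have "(\<lambda>i. measure M (A i)) \<longlonglongrightarrow> measure M (\<Inter>i. A i)"
      using AM A(2) by (intro finite_Lim_measure_decseq) auto
    then have lim: "(\<lambda>i. measure M (A i)) \<longlonglongrightarrow> 0" using A(3) by simp
    have "\<nu> (A i) \<le> measure M (A i)" for i
      using le[OF AM(1), of i] finite_measure_mono[of "A i \<inter> C" "A i"] AM by force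
    then have "(\<lambda>i. \<nu> (A i)) \<longlonglongrightarrow> 0"
      using nonneg AM by (intro tendsto_sandwich[OF _ _ tendsto_const lim]) auto
    then show "(\<lambda>i. ennreal (\<nu> (A i))) \<longlonglongrightarrow> 0" by (simp add: tendsto_ennrealI[of _ 0, simplified])
  qed
  have setsN: "sets N = sets F" "space N = space F"
    unfolding N_def by (auto simp: sets.sigma_sets_eq sets.space_closed space_measure_of_conv)
  have emN: "emeasure N A = ennreal (\<nu> A)" if "A \<in> sets F" for A
    unfolding N_def using that ca emp
    by (intro emeasure_measure_of_sigma) (auto simp: positive_def sets.sigma_algebra_axioms)
  have ac: "absolutely_continuous ?R N"
    unfolding absolutely_continuous_def
  proof
    fix A assume "A \<in> null_sets ?R"
    then have A: "A \<in> sets F" "emeasure M A = 0"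
      using null_sets_restr_to_subalg[OF subalg] by auto
    then have "measure M (A \<inter> C) \<le> 0"
      using finite_measure_mono[of "A \<inter> C" A] sets_subalg by (force simp: measure_def)
    then have "\<nu> A = 0" using le[OF A(1)] nonneg[OF A(1)] by simp
    then show "A \<in> null_sets N" using A emN setsN by (intro null_setsI) auto
  qed
  obtain f where f: "f \<in> borel_measurable ?R" "density ?R f = N"
    using R.Radon_Nikodym[OF ac] setsN sets_restr_to_subalg[OF subalg] by auto
  have fF [measurable]: "f \<in> borel_measurable F" by (rule measurable_in_subalg'[OF subalg f(1)])
  have fM [measurable]: "f \<in> borel_measurable M" by (rule measurable_from_subalg[OF subalg fF])
  have nnf: "(\<integral>\<^sup>+t. f t * indicator A t \<partial>M) = ennreal (\<nu> A)" if A [measurable]: "A \<in> sets F" for A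
  proof -
    have "ennreal (\<nu> A) = emeasure (density ?R f) A" using emN[OF A] f(2) by simp
    also have "\<dots> = (\<integral>\<^sup>+t. f t * indicator A t \<partial>?R)"
      using A f(1) sets_restr_to_subalg[OF subalg] by (intro emeasure_density) auto
    also have "\<dots> = (\<integral>\<^sup>+t. f t * indicator A t \<partial>M)"
      by (intro nn_integral_subalgebra2[OF subalg]) measurable
    finally show ?thesis by simp
  qed
  have top: "space M \<in> sets F" using sets.top[of F] by (simp add: space_subalg)
  have "(\<integral>\<^sup>+t. f t \<partial>M) = (\<integral>\<^sup>+t. f t * indicator (space M) t \<partial>M)"
    by (intro nn_integral_cong) auto
  then have "(\<integral>\<^sup>+t. f t \<partial>M) \<noteq> \<infinity>" using nnf[OF top] by simp
  then have fin: "AE t in M. f t \<noteq> \<infinity>" by (intro nn_integral_PInf_AE) auto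
  \<comment> \<open>The density is finite almost everywhere, so sending the value infinity to
    \<open>0\<close> changes no integral.\<close>
  define q where "q t = enn2real (f t)" for t
  have qF: "q \<in> borel_measurable F" unfolding q_def[abs_def] by measurable
  have qint: "(\<integral>\<^sup>+t. ennreal (indicator A t *\<^sub>R q t) \<partial>M) = ennreal (\<nu> A)" if A: "A \<in> sets F" for A
  proof -
    have "(\<integral>\<^sup>+t. ennreal (indicator A t *\<^sub>R q t) \<partial>M) = (\<integral>\<^sup>+t. f t * indicator A t \<partial>M)"
      using fin by (intro nn_integral_cong_AE) (auto simp: q_def indicator_def less_top)
    then show ?thesis using nnf[OF A] by simp
  qed
  have qset: "(LINT t:A|M. q t) = \<nu> A" if A: "A \<in> sets F" for A
    unfolding set_lebesgue_integral_def
    using qint[OF A] sets_subalg[OF A] nonneg[OF A] measurable_from_subalg[OF subalg qF]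
    by (subst integral_eq_nn_integral) (auto simp: q_def)
  have "integrable M q"
  proof (rule integrableI_nonneg)
    have "(\<integral>\<^sup>+t. ennreal (q t) \<partial>M) = (\<integral>\<^sup>+t. ennreal (indicator (space M) t *\<^sub>R q t) \<partial>M)"
      by (intro nn_integral_cong) auto
    then show "(\<integral>\<^sup>+t. ennreal (q t) \<partial>M) < \<infinity>" using qint[OF top] by simp
  qed (use measurable_from_subalg[OF subalg qF] in \<open>auto simp: q_def\<close>)
  from split_density[OF C qF this] show ?thesis using nonneg le by (simp add: qset)
qed

end

section \<open>Weak topologies\<close>

lemma openin_weak_topology_by:
  assumes "\<phi> \<in> D" "open U"
  shows "openin (weak_topology_by V D) {x \<in> V. \<phi> x \<in> U}"
  unfolding weak_topology_by_def by (rule topology_generated_by_Basis) (use assms in blast)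

text \<open>A nonempty \<open>D\<close> makes \<open>V\<close> itself a generating set, so that the
  image of \<open>f\<close> lies in the carrier of the generated topology.\<close>

lemma continuous_map_into_weak_topology_by:
  assumes "\<And>x. x \<in> topspace T \<Longrightarrow> f x \<in> V" "D \<noteq> {}"
    and cont: "\<And>\<phi>. \<phi> \<in> D \<Longrightarrow> continuous_map T euclideanreal (\<lambda>x. \<phi> (f x))"
  shows "continuous_map T (weak_topology_by V D) f"
  unfolding weak_topology_by_def
proof (rule continuous_on_generated_topo)
  fix U assume "U \<in> {{x \<in> V. \<phi> x \<in> U} |\<phi> U. \<phi> \<in> D \<and> open U}"
  then obtain \<phi> W where *: "\<phi> \<in> D" "open W" and U: "U = {x \<in> V. \<phi> x \<in> W}" by blast
  have "f -` U \<inter> topspace T = {x \<in> topspace T. \<phi> (f x) \<in> W}" using assms(1) U by auto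
  then show "openin T (f -` U \<inter> topspace T)"
    using openin_continuous_map_preimage[OF cont[OF *(1)]] *(2) by simp
next
  obtain \<phi> where "\<phi> \<in> D" using assms(2) by blast
  then have "{x \<in> V. \<phi> x \<in> UNIV} \<in> {{x \<in> V. \<phi> x \<in> U} |\<phi> U. \<phi> \<in> D \<and> open U}" by blast
  then show "f ` topspace T \<subseteq> \<Union> {{x \<in> V. \<phi> x \<in> U} |\<phi> U. \<phi> \<in> D \<and> open U}"
    using assms(1) by blast
qed

lemma openin_weak_halfspace:
  fixes \<psi> :: "'x::real_normed_vector \<Rightarrow>\<^sub>L real"
  assumes "open U"
  shows "openin weak_topology {x. \<psi> x \<in> U}"
  using openin_weak_topology_by[of "blinfun_apply \<psi>" "{\<phi>. bounded_linear \<phi>}" U UNIV] assms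
  by (simp add: weak_topology_def blinfun.bounded_linear_right)

lemma closedin_weak_halfspace:
  fixes \<psi> :: "'x::real_normed_vector \<Rightarrow>\<^sub>L real"
  shows "closedin weak_topology {x. \<psi> x \<le> r}" and "closedin weak_topology {x. r \<le> \<psi> x}"
proof -
  have "- {x. \<psi> x \<le> r} = {x. \<psi> x \<in> {r<..}}" "- {x. r \<le> \<psi> x} = {x. \<psi> x \<in> {..<r}}" by auto
  then show "closedin weak_topology {x. \<psi> x \<le> r}" "closedin weak_topology {x. r \<le> \<psi> x}"
    using openin_weak_halfspace[of "{r<..}" \<psi>] openin_weak_halfspace[of "{..<r}" \<psi>]
    by (auto simp: closedin_def topspace_weak_topology Compl_eq_Diff_UNIV)
qed

text \<open>A ball is the intersection of the halfspaces given by the norming functionals of norm at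
  most 1.\<close>

lemma closedin_weak_cball:
  "closedin weak_topology {x::'x::{real_normed_vector, second_countable_topology}. norm x \<le> r}"
proof -
  obtain \<psi> :: "nat \<Rightarrow> ('x \<Rightarrow>\<^sub>L real)" where \<psi>: "norming \<psi>" using ex_norming by blast
  have ne: "{i. norm (\<psi> i) \<le> 1} \<noteq> {}" using \<psi> zero_less_one unfolding norming_def by blast
  have "{x::'x. norm x \<le> r} = (\<Inter>i\<in>{i. norm (\<psi> i) \<le> 1}. {x. \<psi> i x \<le> r})"
  proof (intro equalityI subsetI)
    fix x assume "x \<in> {x::'x. norm x \<le> r}"
    then show "x \<in> (\<Inter>i\<in>{i. norm (\<psi> i) \<le> 1}. {x. \<psi> i x \<le> r})"
      using abs_blinfun_le by (auto simp: abs_le_iff intro: order_trans)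
  qed (auto intro: norming_le[OF \<psi>])
  then show ?thesis using ne closedin_weak_halfspace(1) by (auto intro!: closedin_Inter)
qed

lemma openin_weak_imp_open:
  assumes "openin weak_topology (U::'x::real_normed_vector set)"
  shows "open U"
proof -
  have "continuous_map euclidean (weak_topology :: 'x topology) (\<lambda>x. x)"
    unfolding weak_topology_def
  proof (rule continuous_map_into_weak_topology_by)
    show "{\<phi>::'x \<Rightarrow> real. bounded_linear \<phi>} \<noteq> {}" using bounded_linear_zero by blast
  qed (auto intro: linear_continuous_on)
  from openin_continuous_map_preimage[OF this assms] show ?thesis by simp
qed

lemma closedin_weak_imp_closed: "closedin weak_topology (C::'x::real_normed_vector set) \<Longrightarrow> closed C"
  using openin_weak_imp_open[of "- C"]
  by (simp add: closedin_def topspace_weak_topology closed_def Compl_eq_Diff_UNIV)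

lemma Hausdorff_weak_topology: "Hausdorff_space (weak_topology :: 'x::real_normed_vector topology)"
  unfolding Hausdorff_space_def
proof (intro allI impI)
  fix x y :: 'x assume "x \<in> topspace weak_topology \<and> y \<in> topspace weak_topology \<and> x \<noteq> y"
  then have "x - y \<noteq> 0" by simp
  obtain \<psi> :: "'x \<Rightarrow>\<^sub>L real" where "\<psi> (x - y) = norm (x - y)" using ex_norming_functional by blast
  then have "\<psi> x - \<psi> y = norm (x - y)" by (simp add: blinfun.diff_right)
  moreover have "0 < norm (x - y)" using \<open>x - y \<noteq> 0\<close> by simp
  ultimately have "\<psi> y < \<psi> x" by linarith
  then obtain r where r: "\<psi> y < r" "r < \<psi> x" using dense by blast
  then show "\<exists>U V. openin weak_topology U \<and> openin weak_topology V \<and> x \<in> U \<and> y \<in> V \<and> disjnt U V"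
    using openin_weak_halfspace[of "{r<..}" \<psi>] openin_weak_halfspace[of "{..<r}" \<psi>]
    by (intro exI[of _ "{x. \<psi> x \<in> {r<..}}"] exI[of _ "{x. \<psi> x \<in> {..<r}}"]) (auto simp: disjnt_def)
qed

lemma compactin_weak_imp_closed: "compactin weak_topology (C::'x::real_normed_vector set) \<Longrightarrow> closed C"
  by (rule closedin_weak_imp_closed[OF compactin_imp_closedin[OF Hausdorff_weak_topology]])

lemma compactin_Inter_nonempty:
  assumes S: "compactin X S" and K: "\<And>n::nat. closedin X (K n)" "decseq K"
    and ne: "\<And>n. S \<inter> K n \<noteq> {}"
  shows "S \<inter> (\<Inter>n. K n) \<noteq> {}"
proof -
  have "compact_space (subtopology X S)" using S by (simp add: compact_space_subtopology)
  then have "(\<Inter>n. S \<inter> K n) \<noteq> {}"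
  proof (rule compact_space_imp_nest)
    show "closedin (subtopology X S) (S \<inter> K n)" for n
      by (rule closedin_subtopology_Int_closed[OF K(1)])
    show "decseq (\<lambda>n. S \<inter> K n)" using K(2) by (auto simp: decseq_def)
  qed (use ne in auto)
  then show ?thesis by auto
qed


section \<open>Measurable selections\<close>

text \<open>The set of points whose value meets a union is the union of the sets for its members.
  This extends measurability from closed sets to open sets of a metric space and to the cells of a
  code.\<close>

lemma measurable_correspondence_fsigma:
  assumes "measurable_correspondence N \<Phi>" "fsigma_in euclidean E"
  shows "{t \<in> space N. \<Phi> t \<inter> E \<noteq> {}} \<in> sets N"
proof -
  have "closedin euclidean = (closed :: 'b set \<Rightarrow> bool)" by (simp add: fun_eq_iff)
  then have "\<exists>\<E>. countable \<E> \<and> \<E> \<subseteq> Collect closed \<and> \<Union>\<E> = E"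
    using assms(2) by (simp add: fsigma_in_def union_of_def)
  then obtain \<E> where \<E>: "countable \<E>" "\<And>C. C \<in> \<E> \<Longrightarrow> closed C" "\<Union>\<E> = E"
    by (elim exE conjE) (simp add: subset_iff)
  have "{t \<in> space N. \<Phi> t \<inter> E \<noteq> {}} = (\<Union>C\<in>\<E>. {t \<in> space N. \<Phi> t \<inter> C \<noteq> {}})"
    using \<E>(3) by auto
  moreover have "{t \<in> space N. \<Phi> t \<inter> C \<noteq> {}} \<in> sets N" if "C \<in> \<E>" for C
    using assms(1) \<E>(2)[OF that] by (auto simp: measurable_correspondence_def)
  ultimately show ?thesis using \<E>(1) by (auto intro!: sets.countable_UN')
qed

lemma open_fsigma: "open U \<Longrightarrow> fsigma_in euclidean (U::'x::metric_space set)"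
  by (rule open_imp_fsigma_in[OF metrizable_space_euclidean]) simp

lemma ex_dense_sequence:
  "\<exists>e::nat \<Rightarrow> 'x::{metric_space, second_countable_topology}. \<forall>x r. 0 < r \<longrightarrow> (\<exists>i. dist (e i) x < r)"
proof -
  obtain D :: "'x set" where D: "countable D" "\<And>U. open U \<Longrightarrow> U \<noteq> {} \<Longrightarrow> \<exists>d\<in>D. d \<in> U"
    using countable_dense_setE by blast
  have "D \<noteq> {}" using D(2)[of UNIV] by auto
  then have ran: "range (from_nat_into D) = D" using D(1) by (rule range_from_nat_into)
  have "\<exists>i. dist (from_nat_into D i) x < r" if "0 < r" for x r
  proof -
    obtain d where d: "d \<in> D" "d \<in> ball x r" using D(2)[of "ball x r"] \<open>0 < r\<close> by auto
    then obtain i where "from_nat_into D i = d" using ran by (metis imageE)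
    then show ?thesis using d(2) by (auto simp: dist_commute)
  qed
  then show ?thesis by blast
qed

text \<open>Each index is the least one whose ball of radius \<open>(1 / 2) ^ k\<close> meets
  \<open>\<Phi> t\<close> inside the preceding ball, so the centres form a Cauchy sequence. The
  limit is placed in the closure of \<open>\<Phi> t\<close> because the correspondences to come have
  closed values only almost everywhere.\<close>

lemma kuratowski_ryll_nardzewski:
  fixes \<Phi> :: "'a \<Rightarrow> 'x::{banach, second_countable_topology} set"
  assumes ne: "\<And>t. t \<in> space N \<Longrightarrow> \<Phi> t \<noteq> {}"
    and meas: "\<And>U. open U \<Longrightarrow> {t \<in> space N. \<Phi> t \<inter> U \<noteq> {}} \<in> sets N"
  shows "\<exists>s\<in>borel_measurable N. \<forall>t\<in>space N. s t \<in> closure (\<Phi> t)"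
proof -
  obtain e :: "nat \<Rightarrow> 'x" where e: "\<And>x r. 0 < r \<Longrightarrow> \<exists>i. dist (e i) x < r"
    using ex_dense_sequence by blast
  define B where "B k i = ball (e i) ((1 / 2) ^ k)" for k i
  define idx where "idx = rec_nat (\<lambda>t. LEAST i. \<Phi> t \<inter> B 0 i \<noteq> {})
    (\<lambda>k n t. LEAST i. \<Phi> t \<inter> (B (Suc k) i \<inter> B k (n t)) \<noteq> {})"
  have idx0: "idx 0 t = (LEAST i. \<Phi> t \<inter> B 0 i \<noteq> {})"
    and idxS: "idx (Suc k) t = (LEAST i. \<Phi> t \<inter> (B (Suc k) i \<inter> B k (idx k t)) \<noteq> {})" for k t
    by (simp_all add: idx_def)
  have pred: "Measurable.pred N (\<lambda>t. \<Phi> t \<inter> U \<noteq> {})" if "open U" for U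
    using meas[OF that] by (simp add: pred_def)
  have idx_meas [measurable]: "idx k \<in> measurable N (count_space UNIV)" for k
  proof (induction k)
    case 0
    show ?case unfolding idx0[abs_def] by (intro measurable_Least pred) (simp add: B_def)
  next
    case (Suc k)
    \<comment> \<open>The preceding index takes countably many values, so it may be treated as a
      constant.\<close>
    have "Measurable.pred N (\<lambda>t. \<Phi> t \<inter> (B (Suc k) i \<inter> B k (idx k t)) \<noteq> {})" for i
      by (rule measurable_compose_countable[where f = "\<lambda>j t. \<Phi> t \<inter> (B (Suc k) i \<inter> B k j) \<noteq> {}", OF _ Suc])
        (intro pred, auto simp: B_def)
    then show ?case unfolding idxS[abs_def] by (rule measurable_Least)
  qed
  have cover: "\<exists>i. z \<in> B k i" for z k using e[of "(1 / 2) ^ k" z] by (auto simp: B_def)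
  have inv: "\<Phi> t \<inter> B k (idx k t) \<noteq> {}" if t: "t \<in> space N" for k t
  proof (induction k)
    case 0
    obtain z where "z \<in> \<Phi> t" using ne[OF t] by blast
    then have "\<exists>i. \<Phi> t \<inter> B 0 i \<noteq> {}" using cover by blast
    then show ?case unfolding idx0 by (rule LeastI_ex)
  next
    case (Suc k)
    then obtain z where "z \<in> \<Phi> t" "z \<in> B k (idx k t)" by blast
    then have "\<exists>i. \<Phi> t \<inter> (B (Suc k) i \<inter> B k (idx k t)) \<noteq> {}" using cover by blast
    then have "\<Phi> t \<inter> (B (Suc k) (idx (Suc k) t) \<inter> B k (idx k t)) \<noteq> {}" unfolding idxS by (rule LeastI_ex)
    then show ?case by blast
  qed
  have step: "dist (e (idx k t)) (e (idx (Suc k) t)) \<le> 2 * (1 / 2) ^ k" if t: "t \<in> space N" for k t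
  proof -
    obtain z where "z \<in> \<Phi> t" "z \<in> B k (idx k t)" using inv[OF t] by blast
    then have "\<exists>i. \<Phi> t \<inter> (B (Suc k) i \<inter> B k (idx k t)) \<noteq> {}" using cover by blast
    then have "\<Phi> t \<inter> (B (Suc k) (idx (Suc k) t) \<inter> B k (idx k t)) \<noteq> {}" unfolding idxS by (rule LeastI_ex)
    then obtain z where "dist (e (idx (Suc k) t)) z < (1 / 2) ^ Suc k" "dist (e (idx k t)) z < (1 / 2) ^ k"
      by (auto simp: B_def)
    moreover have "(1 / 2 :: real) ^ Suc k \<le> (1 / 2) ^ k" by simp
    moreover note dist_triangle2[of "e (idx k t)" "e (idx (Suc k) t)" z]
    ultimately show ?thesis by linarith
  qed
  have lim: "(\<lambda>k. e (idx k t)) \<longlonglongrightarrow> lim (\<lambda>k. e (idx k t))" if t: "t \<in> space N" for t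
  proof -
    have "summable (\<lambda>k. norm (e (idx (Suc k) t) - e (idx k t)))"
    proof (rule summable_comparison_test'[of "\<lambda>k. 2 * (1 / 2) ^ k" 0])
      show "summable (\<lambda>k. 2 * (1 / 2 :: real) ^ k)" by (intro summable_mult summable_geometric) simp
      show "norm (norm (e (idx (Suc k) t) - e (idx k t))) \<le> 2 * (1 / 2) ^ k" for k
        using step[OF t, of k] by (simp add: dist_norm norm_minus_commute)
    qed
    then have "summable (\<lambda>k. e (idx (Suc k) t) - e (idx k t))" by (rule summable_norm_cancel)
    then have "convergent (\<lambda>n. \<Sum>k<n. e (idx (Suc k) t) - e (idx k t))"
      by (simp add: summable_iff_convergent)
    then have "convergent (\<lambda>n. e (idx n t) - e (idx 0 t))"
      using sum_lessThan_telescope[of "\<lambda>k. e (idx k t)"] by simp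
    then have "convergent (\<lambda>n. e (idx n t))" using convergent_diff_const_right_iff by blast
    then show ?thesis by (simp add: convergent_LIMSEQ_iff)
  qed
  define s where "s t = lim (\<lambda>k. e (idx k t))" for t
  have "s \<in> borel_measurable N" unfolding s_def[abs_def]
  proof (rule borel_measurable_lim_metric)
    show "(\<lambda>t. e (idx k t)) \<in> borel_measurable N" for k
      by (rule measurable_compose[OF idx_meas]) simp
  qed
  moreover have "s t \<in> closure (\<Phi> t)" if t: "t \<in> space N" for t
    unfolding closure_approachable
  proof (intro allI impI)
    fix r :: real assume r: "0 < r"
    have "\<forall>\<^sub>F k in sequentially. dist (e (idx k t)) (s t) < r / 2"
      using tendstoD[OF lim[OF t], of "r / 2"] r by (simp add: s_def)
    moreover have "\<forall>\<^sub>F k in sequentially. (1 / 2) ^ k < r / 2"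
      using order_tendstoD(2)[OF LIMSEQ_power_zero[of "1 / 2 :: real"], of "r / 2"] r by simp
    ultimately have "\<forall>\<^sub>F k in sequentially. dist (e (idx k t)) (s t) < r / 2 \<and> (1 / 2) ^ k < r / 2"
      by (rule eventually_conj)
    then obtain k where k: "dist (e (idx k t)) (s t) < r / 2" "(1 / 2) ^ k < r / 2"
      using eventually_happens by force
    obtain z where z: "z \<in> \<Phi> t" "dist (e (idx k t)) z < (1 / 2) ^ k" using inv[OF t, of k] by (auto simp: B_def)
    have "dist z (s t) \<le> dist (e (idx k t)) z + dist (e (idx k t)) (s t)" by (rule dist_triangle3)
    then show "\<exists>y\<in>\<Phi> t. dist y (s t) < r" using z k by (intro bexI[of _ z]) auto
  qed
  ultimately show ?thesis by blast
qed

text \<open>A Castaing representation: for each ball \<open>B i k\<close> a selection of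
  \<open>\<Phi> t \<inter> B i k\<close> is used wherever this set is nonempty. Small balls around a
  dense sequence come close to every point of \<open>\<Phi> t\<close>.\<close>

lemma ex_dense_selections:
  fixes \<Phi> :: "'a \<Rightarrow> 'x::{banach, second_countable_topology} set"
  assumes ne: "\<And>t. t \<in> space N \<Longrightarrow> \<Phi> t \<noteq> {}" and meas: "measurable_correspondence N \<Phi>"
  shows "\<exists>s::nat \<Rightarrow> 'a \<Rightarrow> 'x. (\<forall>i. s i \<in> borel_measurable N) \<and>
    (\<forall>i. \<forall>t\<in>space N. s i t \<in> closure (\<Phi> t)) \<and>
    (\<forall>t\<in>space N. \<forall>x\<in>\<Phi> t. \<forall>r>0. \<exists>i. dist (s i t) x < r)"
proof -
  obtain e :: "nat \<Rightarrow> 'x" where e: "\<And>x r. 0 < r \<Longrightarrow> \<exists>i. dist (e i) x < r"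
    using ex_dense_sequence by blast
  have open_meas: "{t \<in> space N. \<Phi> t \<inter> U \<noteq> {}} \<in> sets N" if "open U" for U
    using measurable_correspondence_fsigma[OF meas open_fsigma[OF that]] .
  define B where "B i k = ball (e i) ((1 / 2) ^ k)" for i k
  define \<Psi> where "\<Psi> i k t = (if \<Phi> t \<inter> B i k \<noteq> {} then \<Phi> t \<inter> B i k else \<Phi> t)" for i k t
  have "\<exists>s\<in>borel_measurable N. \<forall>t\<in>space N. s t \<in> closure (\<Psi> i k t)" for i k
  proof (rule kuratowski_ryll_nardzewski)
    fix U :: "'x set" assume U: "open U"
    have "{t \<in> space N. \<Psi> i k t \<inter> U \<noteq> {}} = {t \<in> space N. \<Phi> t \<inter> (B i k \<inter> U) \<noteq> {}} \<union>
      ({t \<in> space N. \<Phi> t \<inter> U \<noteq> {}} - {t \<in> space N. \<Phi> t \<inter> B i k \<noteq> {}})"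
      by (auto simp: \<Psi>_def)
    then show "{t \<in> space N. \<Psi> i k t \<inter> U \<noteq> {}} \<in> sets N"
      using U by (auto simp: B_def intro!: sets.Un sets.Diff open_meas)
  qed (use ne in \<open>auto simp: \<Psi>_def\<close>)
  then have "\<exists>s. \<forall>i k. s i k \<in> borel_measurable N \<and> (\<forall>t\<in>space N. s i k t \<in> closure (\<Psi> i k t))"
    by (metis (no_types))
  then obtain s where s: "\<And>i k. s i k \<in> borel_measurable N"
    "\<And>i k t. t \<in> space N \<Longrightarrow> s i k t \<in> closure (\<Psi> i k t)" by blast
  have "\<Psi> i k t \<subseteq> \<Phi> t" for i k t by (auto simp: \<Psi>_def)
  then have cl: "s i k t \<in> closure (\<Phi> t)" if "t \<in> space N" for i k t
    using s(2)[OF that, of i k] closure_mono by blast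
  have dense: "\<exists>i k. dist (s i k t) x < r" if t: "t \<in> space N" and x: "x \<in> \<Phi> t" and r: "0 < r" for t x r
  proof -
    obtain k where k: "(1 / 2) ^ k < r / 2" using real_arch_pow_inv[of "r / 2" "1 / 2"] r by auto
    obtain i where i: "dist (e i) x < (1 / 2) ^ k" using e[of "(1 / 2) ^ k"] by auto
    then have "\<Psi> i k t \<subseteq> cball (e i) ((1 / 2) ^ k)" using x by (auto simp: \<Psi>_def B_def)
    then have "s i k t \<in> cball (e i) ((1 / 2) ^ k)"
      using s(2)[OF t, of i k] closure_minimal[OF _ closed_cball] by blast
    then have "dist (s i k t) x < r"
      using dist_triangle3[of "s i k t" x "e i"] i k by simp
    then show ?thesis by blast
  qed
  show ?thesis
  proof (intro exI[of _ "\<lambda>n. s (fst (prod_decode n)) (snd (prod_decode n))"] conjI allI ballI impI)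
    fix t x r assume "t \<in> space N" "x \<in> \<Phi> t" "0 < (r::real)"
    then obtain i k where "dist (s i k t) x < r" using dense by blast
    then show "\<exists>n. dist (s (fst (prod_decode n)) (snd (prod_decode n)) t) x < r"
      by (intro exI[of _ "prod_encode (i, k)"]) simp
  qed (use s cl in auto)
qed


section \<open>Convex hulls as closures of averages\<close>

text \<open>Lists with repetitions encode convex combinations with rational weights by a countable
  index set.\<close>

definition average :: "(nat \<Rightarrow> 'x::real_vector) \<Rightarrow> nat list \<Rightarrow> 'x" where
  "average s l = sum_list (map s l) /\<^sub>R real (length l)"

lemma sum_list_concat_replicate:
  fixes s :: "nat \<Rightarrow> 'x::real_vector"
  shows "sum_list (map s (concat (replicate k l))) = real k *\<^sub>R sum_list (map s l)"
  by (induction k) (auto simp: algebra_simps)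

lemma length_concat_replicate: "length (concat (replicate k l)) = k * length l"
  by (induction k) auto

text \<open>Taking \<open>p * length m\<close> copies of \<open>l\<close> and
  \<open>q * length l\<close> copies of \<open>m\<close> makes the lengths of the two blocks stand
  in the ratio of \<open>p\<close> to \<open>q\<close>.\<close>

lemma average_combination:
  fixes s :: "nat \<Rightarrow> 'x::real_vector"
  assumes "l \<noteq> []" "m \<noteq> []" "0 < p + q"
  shows "\<exists>l'. l' \<noteq> [] \<and>
    average s l' = (real p / real (p + q)) *\<^sub>R average s l + (real q / real (p + q)) *\<^sub>R average s m"
proof -
  define l' where "l' = concat (replicate (p * length m) l) @ concat (replicate (q * length l) m)"
  have len: "length l' = (p + q) * (length l * length m)"
    by (simp add: l'_def length_concat_replicate algebra_simps)
  have pos: "0 < length l" "0 < length m" using assms by auto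
  then have "0 < length l'" unfolding len using assms(3) by simp
  moreover have "average s l' = (real (p * length m) / real (length l')) *\<^sub>R sum_list (map s l)
      + (real (q * length l) / real (length l')) *\<^sub>R sum_list (map s m)"
    unfolding average_def
    by (simp add: l'_def sum_list_concat_replicate scaleR_add_right divide_inverse_commute)
  moreover have "real (p * length m) / real (length l') = real p / real (p + q) / real (length l)"
    "real (q * length l) / real (length l') = real q / real (p + q) / real (length m)"
    using pos by (simp_all only: len of_nat_mult, simp_all add: mult.assoc mult.left_commute)
  moreover have "(real p / real (p + q)) *\<^sub>R average s l = (real p / real (p + q) / real (length l)) *\<^sub>R sum_list (map s l)"
    "(real q / real (p + q)) *\<^sub>R average s m = (real q / real (p + q) / real (length m)) *\<^sub>R sum_list (map s m)"
    by (simp_all add: average_def divide_inverse)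
  ultimately show ?thesis by (intro exI[of _ l'] conjI) (simp, simp only:)
qed

lemma convex_closure_averages:
  fixes s :: "nat \<Rightarrow> 'x::real_normed_vector"
  shows "convex (closure {average s l |l. l \<noteq> []})" (is "convex (closure ?A)")
proof (rule convexI)
  fix x y and u v :: real
  assume xy: "x \<in> closure ?A" "y \<in> closure ?A" and uv: "0 \<le> u" "0 \<le> v" "u + v = 1"
  obtain a where a: "\<And>n. a n \<in> ?A" "a \<longlonglongrightarrow> x" using xy(1) by (auto simp: closure_sequential)
  obtain b where b: "\<And>n. b n \<in> ?A" "b \<longlonglongrightarrow> y" using xy(2) by (auto simp: closure_sequential)
  \<comment> \<open>The weight \<open>u\<close> is approximated from below by fractions with
    denominator \<open>Suc n\<close>, for which a combination of averages is again an
    average.\<close>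
  define p where "p n = nat \<lfloor>u * real (Suc n)\<rfloor>" for n
  have p_le: "p n \<le> Suc n" for n
  proof -
    have "u * real (Suc n) \<le> 1 * real (Suc n)" using uv by (intro mult_right_mono) auto
    also have "\<dots> < real_of_int (int (Suc n)) + 1" by simp
    finally have "u * real (Suc n) < real_of_int (int (Suc n)) + 1" .
    then show ?thesis unfolding p_def by (simp only: nat_le_iff floor_le_iff)
  qed
  define c where "c n = (real (p n) / real (Suc n)) *\<^sub>R a n + (1 - real (p n) / real (Suc n)) *\<^sub>R b n" for n
  have "c n \<in> ?A" for n
  proof -
    obtain l m where l: "l \<noteq> []" "a n = average s l" "m \<noteq> []" "b n = average s m" using a(1)[of n] b(1)[of n] by blast
    have "p n + (Suc n - p n) = Suc n" using p_le[of n] by simp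
    moreover have "real (Suc n - p n) / real (Suc n) = 1 - real (p n) / real (Suc n)"
      using p_le[of n] by (simp add: of_nat_diff field_simps)
    ultimately obtain l' where "l' \<noteq> []" "average s l' = c n"
      using average_combination[OF l(1,3), of "p n" "Suc n - p n" s] l by (auto simp: c_def)
    then show ?thesis by (intro CollectI exI[of _ l']) simp
  qed
  moreover have plim: "(\<lambda>n. real (p n) / real (Suc n)) \<longlonglongrightarrow> u"
  proof (rule tendsto_sandwich)
    show "\<forall>\<^sub>F n in sequentially. u - 1 / real (Suc n) \<le> real (p n) / real (Suc n)"
    proof (rule always_eventually, rule allI)
      fix n
      have "u * real (Suc n) - 1 \<le> real (p n)" unfolding p_def by linarith
      then have "(u * real (Suc n) - 1) / real (Suc n) \<le> real (p n) / real (Suc n)"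
        by (rule divide_right_mono) simp
      then show "u - 1 / real (Suc n) \<le> real (p n) / real (Suc n)" by (simp add: diff_divide_distrib)
    qed
    show "\<forall>\<^sub>F n in sequentially. real (p n) / real (Suc n) \<le> u"
    proof (rule always_eventually, rule allI)
      fix n
      have "0 \<le> u * real (Suc n)" using uv by simp
      then have "real (p n) \<le> u * real (Suc n)" unfolding p_def by linarith
      then show "real (p n) / real (Suc n) \<le> u" by (simp add: divide_le_eq)
    qed
    have "(\<lambda>n. u - 1 / real (Suc n)) \<longlonglongrightarrow> u - 0"
      by (intro tendsto_diff tendsto_const LIMSEQ_Suc lim_1_over_n)
    then show "(\<lambda>n. u - 1 / real (Suc n)) \<longlonglongrightarrow> u" by simp
  qed simp
  have "c \<longlonglongrightarrow> u *\<^sub>R x + (1 - u) *\<^sub>R y"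
    unfolding c_def by (intro tendsto_intros plim a b)
  moreover have "1 - u = v" using uv by simp
  ultimately show "u *\<^sub>R x + v *\<^sub>R y \<in> closure ?A" by (auto simp: closure_sequential)
qed

lemma closure_convex_hull_average:
  fixes s :: "nat \<Rightarrow> 'x::real_normed_vector"
  assumes dense: "\<And>z r. z \<in> S \<Longrightarrow> 0 < r \<Longrightarrow> \<exists>i. dist (s i) z < r"
    and x: "x \<in> closure (convex hull S)" and r: "0 < r"
  shows "\<exists>l. l \<noteq> [] \<and> dist (average s l) x < r"
proof -
  let ?A = "{average s l |l. l \<noteq> []}"
  have "S \<subseteq> closure ?A"
  proof
    fix z assume z: "z \<in> S"
    have "\<exists>y\<in>?A. dist y z < r" if "0 < r" for r
    proof -
      obtain i where i: "dist (s i) z < r" using dense[OF z \<open>0 < r\<close>] by blast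
      have "average s [i] \<in> ?A" by blast
      then show ?thesis using i by (intro bexI[of _ "average s [i]"]) (simp_all add: average_def)
    qed
    then show "z \<in> closure ?A" unfolding closure_approachable by blast
  qed
  then have "convex hull S \<subseteq> closure ?A" by (rule hull_minimal) (rule convex_closure_averages)
  then have "closure (convex hull S) \<subseteq> closure ?A" by (rule closure_minimal) simp
  then have "x \<in> closure ?A" using x by blast
  then show ?thesis using r unfolding closure_approachable by blast
qed

lemma sum_count_list_scaleR:
  fixes f :: "nat \<Rightarrow> 'x::real_vector"
  assumes "finite X" "set l \<subseteq> X"
  shows "(\<Sum>i\<in>X. real (count_list l i) *\<^sub>R f i) = sum_list (map f l)"
  using assms(2)
proof (induction l)
  case (Cons a l)
  have "(\<Sum>i\<in>X. real (count_list (a # l) i) *\<^sub>R f i) =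
    (\<Sum>i\<in>X. (if i = a then f i else 0) + real (count_list l i) *\<^sub>R f i)"
    by (rule sum.cong) (auto simp: algebra_simps)
  also have "\<dots> = f a + (\<Sum>i\<in>X. real (count_list l i) *\<^sub>R f i)"
    using Cons.prems assms(1) by (simp add: sum.distrib)
  finally show ?case using Cons by simp
qed simp

text \<open>With weights attached to the indices, an average becomes the barycentre of a finite
  mixture.\<close>

lemma average_eq_sum:
  fixes f :: "nat \<Rightarrow> 'x::real_vector"
  assumes "finite X" "set l \<subseteq> X"
  shows "average f l = (\<Sum>i\<in>X. (real (count_list l i) / real (length l)) *\<^sub>R f i)"
  unfolding average_def sum_count_list_scaleR[OF assms, symmetric]
  by (simp add: scaleR_sum_right divide_inverse_commute)

section \<open>Convergence of set functions on a countably generated \<open>\<sigma>\<close>-algebra\<close>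

text \<open>Finite intersections of generators are still countably many and contain the whole space
  as the empty intersection, so that Dynkin induction can start from them.\<close>

lemma countably_generated_Int_stable:
  assumes "countably_generated N"
  shows "\<exists>A::nat \<Rightarrow> 'a set. Int_stable (range A) \<and> range A \<subseteq> sets N \<and>
    space N \<in> range A \<and> sets N = sigma_sets (space N) (range A)"
proof -
  obtain C where C: "countable C" "C \<subseteq> Pow (space N)" "sets N = sigma_sets (space N) C"
    using assms by (auto simp: countably_generated_def)
  define P where "P = (\<lambda>K. space N \<inter> \<Inter>K) ` {K. finite K \<and> K \<subseteq> C}"
  have "countable P" unfolding P_def by (intro countable_image countable_Collect_finite_subset C)
  have PN: "P \<subseteq> sets N"
  proof
    fix A assume "A \<in> P"
    then obtain K where K: "finite K" "K \<subseteq> C" "A = space N \<inter> \<Inter>K" by (auto simp: P_def)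
    have "K \<subseteq> sets N" using K(2) C(3) by (auto intro: sigma_sets.Basic)
    then show "A \<in> sets N" using K(1,3)
    proof (cases "K = {}")
      case False
      then have "\<Inter>K \<in> sets N" using \<open>K \<subseteq> sets N\<close> K(1) sets.finite_INT[of K "\<lambda>A. A" N] False by auto
      then show ?thesis using K(3) by auto
    qed auto
  qed
  have "Int_stable P"
  proof (rule Int_stableI)
    fix A B assume "A \<in> P" "B \<in> P"
    then obtain K L where "finite K" "K \<subseteq> C" "A = space N \<inter> \<Inter>K" "finite L" "L \<subseteq> C" "B = space N \<inter> \<Inter>L"
      by (auto simp: P_def)
    then show "A \<inter> B \<in> P" unfolding P_def by (intro image_eqI[of _ _ "K \<union> L"]) auto
  qed
  moreover have "sets N = sigma_sets (space N) P"
  proof (rule antisym)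
    have "c \<in> P" if "c \<in> C" for c
      unfolding P_def using that C(2) by (intro image_eqI[of _ _ "{c}"]) auto
    then have "C \<subseteq> P" by blast
    then show "sets N \<subseteq> sigma_sets (space N) P"
      unfolding C(3) by (rule sigma_sets_mono')
    show "sigma_sets (space N) P \<subseteq> sets N" using PN by (rule sets.sigma_sets_subset)
  qed
  moreover have "space N \<in> P" unfolding P_def by (rule image_eqI[of _ _ "{}"]) auto
  moreover from this have "P \<noteq> {}" by blast
  then have "range (from_nat_into P) = P" using \<open>countable P\<close> by (rule range_from_nat_into)
  ultimately show ?thesis using PN by metis
qed

lemma convergent_uniform_approx:
  fixes x :: "nat \<Rightarrow> real"
  assumes "\<And>e. 0 < e \<Longrightarrow> \<exists>y. convergent y \<and> (\<forall>n. \<bar>x n - y n\<bar> \<le> e)"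
  shows "convergent x"
proof -
  have "Cauchy x"
  proof (rule metric_CauchyI)
    fix e :: real assume e: "0 < e"
    then obtain y where y: "convergent y" "\<And>n. \<bar>x n - y n\<bar> \<le> e / 4" using assms[of "e / 4"] by auto
    obtain M where M: "\<forall>m\<ge>M. \<forall>n\<ge>M. dist (y m) (y n) < e / 4"
      using metric_CauchyD[OF convergent_Cauchy[OF y(1)], of "e / 4"] e by auto
    have "dist (x m) (x n) < e" if "M \<le> m" "M \<le> n" for m n
      using M[rule_format, OF that] y(2)[of m] y(2)[of n] e unfolding dist_real_def by linarith
    then show "\<exists>M. \<forall>m\<ge>M. \<forall>n\<ge>M. dist (x m) (x n) < e" by blast
  qed
  then show ?thesis by (rule Cauchy_convergent)
qed

text \<open>Tychonoff's theorem in a countable product of intervals, where compactness and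
  sequential compactness agree, takes the place of a diagonal argument.\<close>

lemma ex_pointwise_convergent_subseq:
  fixes x :: "nat \<Rightarrow> nat \<Rightarrow> real"
  assumes "\<And>n i. \<bar>x n i\<bar> \<le> b i"
  shows "\<exists>r. strict_mono r \<and> (\<forall>i. convergent (\<lambda>k. x (r k) i))"
proof -
  have "compactin (product_topology (\<lambda>i. euclidean) UNIV) (PiE UNIV (\<lambda>i. {- b i..b i}))"
    by (simp add: compactin_PiE)
  then have "compact (PiE UNIV (\<lambda>i. {- b i..b i}))"
    by (simp add: euclidean_product_topology)
  then have "seq_compact (PiE UNIV (\<lambda>i. {- b i..b i}))" by (simp add: compact_eq_seq_compact_metric)
  moreover have "x n \<in> PiE UNIV (\<lambda>i. {- b i..b i})" for n
    using assms by (auto simp: abs_le_iff minus_le_iff)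
  ultimately obtain l r where r: "strict_mono r" "(x \<circ> r) \<longlonglongrightarrow> l"
    unfolding seq_compact_def by blast
  have "(\<lambda>k. x (r k) i) \<longlonglongrightarrow> l i" for i
  proof -
    have "isCont (\<lambda>y::nat \<Rightarrow> real. y i) l"
      using continuous_on_product_coordinates[of i, where ?'b = real, unfolded continuous_on_eq_continuous_at[OF open_UNIV]]
      by blast
    from isCont_tendsto_compose[OF this r(2)] show ?thesis by (simp add: comp_def)
  qed
  then show ?thesis using r(1) by (auto simp: convergent_def)
qed

section \<open>Setwise limits of charges dominated by the measure\<close>

context finite_measure_subalgebra
begin

text \<open>Finite additivity and domination pass to setwise limits, and together they already imply
  countable additivity. Domination by the one measure \<open>M\<close> makes estimates of tails
  uniform over a sequence of charges.\<close>

definition dominated_charge :: "('a set \<Rightarrow> real) \<Rightarrow> bool" where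
  "dominated_charge \<nu> \<longleftrightarrow>
    (\<forall>A\<in>sets F. 0 \<le> \<nu> A \<and> \<nu> A \<le> measure M A) \<and>
    (\<forall>A\<in>sets F. \<forall>B\<in>sets F. A \<inter> B = {} \<longrightarrow> \<nu> (A \<union> B) = \<nu> A + \<nu> B)"

lemma dominated_charge_add:
  "dominated_charge \<nu> \<Longrightarrow> A \<in> sets F \<Longrightarrow> B \<in> sets F \<Longrightarrow> A \<inter> B = {} \<Longrightarrow> \<nu> (A \<union> B) = \<nu> A + \<nu> B"
  and dominated_charge_nonneg: "dominated_charge \<nu> \<Longrightarrow> A \<in> sets F \<Longrightarrow> 0 \<le> \<nu> A"
  and dominated_charge_le: "dominated_charge \<nu> \<Longrightarrow> A \<in> sets F \<Longrightarrow> \<nu> A \<le> measure M A"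
  by (auto simp: dominated_charge_def)

lemma dominated_charge_empty: "dominated_charge \<nu> \<Longrightarrow> \<nu> {} = 0"
  using dominated_charge_nonneg[of \<nu> "{}"] dominated_charge_le[of \<nu> "{}"] by simp

lemma dominated_charge_UN_lessThan:
  assumes "dominated_charge \<nu>" "disjoint_family A" "\<And>i::nat. A i \<in> sets F"
  shows "\<nu> (\<Union>i<n. A i) = (\<Sum>i<n. \<nu> (A i))"
proof (induction n)
  case (Suc n)
  have "(\<Union>i<Suc n. A i) = A n \<union> (\<Union>i<n. A i)" by (auto simp: lessThan_Suc)
  moreover have "A n \<inter> A i = {}" if "i < n" for i
    by (rule disjoint_family_onD[OF assms(2)]) (use that in auto)
  then have "A n \<inter> (\<Union>i<n. A i) = {}" by blast
  moreover have "(\<Union>i<n. A i) \<in> sets F" using assms(3) by auto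
  ultimately show ?case using Suc dominated_charge_add[OF assms(1) assms(3)] by simp
qed (simp add: dominated_charge_empty[OF assms(1)])

text \<open>Convergence spreads from the generator by Dynkin induction. For a disjoint union, all
  charges of the tail \<open>U n\<close> are at most \<open>measure M (U n)\<close>, so finite
  partial sums approximate the values uniformly along the sequence.\<close>

lemma dominated_charge_convergent:
  assumes \<mu>: "\<And>n. dominated_charge (\<mu> n)"
    and P: "Int_stable P" "P \<subseteq> sets F" "sets F = sigma_sets (space F) P"
      "space F \<in> P"
    and conv: "\<And>A. A \<in> P \<Longrightarrow> convergent (\<lambda>n. \<mu> n A)"
    and A: "A \<in> sets F"
  shows "convergent (\<lambda>n. \<mu> n A)"
proof -
  have "P \<subseteq> Pow (space F)" using P(2) sets.space_closed by blast
  from P(1) this A[unfolded P(3)] show ?thesis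
  proof (induction rule: sigma_sets_induct_disjoint)
    case (compl A)
    then have A: "A \<in> sets F" by (simp add: P(3))
    have "\<mu> n (space F - A) = \<mu> n (space F) - \<mu> n A" for n
    proof -
      have "A \<union> (space F - A) = space F" using sets.sets_into_space[OF A] by auto
      then show ?thesis using dominated_charge_add[OF \<mu>, of A "space F - A" n] A by auto
    qed
    then show ?case using compl(2) conv[OF P(4)] by (simp add: convergent_diff)
  next
    case (union A)
    then have A: "A i \<in> sets F" for i by (auto simp: P(3))
    define U where "U n = (\<Union>i. A (i + n))" for n
    have U: "U n \<in> sets F" for n using A by (auto simp: U_def)
    have split: "(\<Union>i. A i) = (\<Union>i<n. A i) \<union> U n" for n
    proof (intro equalityI subsetI)
      fix x assume "x \<in> (\<Union>i. A i)"
      then obtain i where "x \<in> A i" by blast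
      then show "x \<in> (\<Union>i<n. A i) \<union> U n"
        by (cases "i < n") (auto simp: U_def intro: exI[of _ "i - n"])
    qed (auto simp: U_def)
    have disj_A: "A i \<inter> A j = {}" if "i < j" for i j
      by (rule disjoint_family_onD[OF union(1)]) (use that in auto)
    have disj: "(\<Union>i<n. A i) \<inter> U n = {}" for n
    proof -
      have "A i \<inter> A (j + n) = {}" if "i < n" for i j using that by (intro disj_A) simp
      then show ?thesis by (auto simp: U_def)
    qed
    have "decseq U"
    proof (rule decseq_SucI)
      show "U (Suc n) \<subseteq> U n" for n
      proof
        fix x assume "x \<in> U (Suc n)"
        then obtain i where "x \<in> A (Suc i + n)" by (auto simp: U_def)
        then show "x \<in> U n" unfolding U_def by blast
      qed
    qed
    then have "(\<lambda>n. measure M (U n)) \<longlonglongrightarrow> measure M (\<Inter>n. U n)"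
      using U sets_subalg by (intro finite_Lim_measure_decseq) auto
    moreover have "(\<Inter>n. U n) = {}"
    proof -
      have "A i \<inter> A (j + Suc i) = {}" for i j by (intro disj_A) simp
      then have "x \<notin> U (Suc i)" if "x \<in> A i" for x i
        using that unfolding U_def by blast
      then have "x \<notin> (\<Inter>n. U n)" if "x \<in> A i" for x i using that by blast
      moreover have "(\<Inter>n. U n) \<subseteq> (\<Union>i. A i)"
        using INT_lower[of 0 UNIV U] by (simp add: U_def)
      ultimately show ?thesis by (metis UN_iff equals0I subsetD)
    qed
    ultimately have lim: "(\<lambda>n. measure M (U n)) \<longlonglongrightarrow> 0" by simp
    show ?case
    proof (rule convergent_uniform_approx)
      fix e :: real assume "0 < e"
      then obtain n where n: "measure M (U n) < e"
        using order_tendstoD(2)[OF lim, of e] by (auto simp: eventually_sequentially)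
      have "\<bar>\<mu> k (\<Union>i. A i) - (\<Sum>i<n. \<mu> k (A i))\<bar> \<le> e" for k
      proof -
        have "\<mu> k (\<Union>i. A i) = (\<Sum>i<n. \<mu> k (A i)) + \<mu> k (U n)"
          using dominated_charge_add[OF \<mu>, of "\<Union>i<n. A i" "U n" k] A U disj[of n]
            dominated_charge_UN_lessThan[OF \<mu> union(1) A] by (simp add: split[of n] sets.finite_UN)
        then show ?thesis
          using dominated_charge_nonneg[OF \<mu> U[of n], of k] dominated_charge_le[OF \<mu> U[of n], of k] n by simp
      qed
      moreover have "convergent (\<lambda>k. \<Sum>i<n. \<mu> k (A i))"
        using union(3) by (intro convergent_sum) auto
      ultimately show "\<exists>y. convergent y \<and> (\<forall>k. \<bar>\<mu> k (\<Union>i. A i) - y k\<bar> \<le> e)" by blast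
    qed
  qed (use conv \<mu> in \<open>auto simp: dominated_charge_empty convergent_const\<close>)
qed

lemma dominated_charge_lim:
  assumes \<mu>: "\<And>n. dominated_charge (\<mu> n)" and lim: "\<And>A. A \<in> sets F \<Longrightarrow> (\<lambda>n. \<mu> n A) \<longlonglongrightarrow> \<nu> A"
  shows "dominated_charge \<nu>"
  unfolding dominated_charge_def
proof (intro conjI ballI impI)
  fix A assume A: "A \<in> sets F"
  show "0 \<le> \<nu> A" using dominated_charge_nonneg[OF \<mu> A] by (intro LIMSEQ_le_const[OF lim[OF A]]) auto
  show "\<nu> A \<le> measure M A" using dominated_charge_le[OF \<mu> A] by (intro LIMSEQ_le_const2[OF lim[OF A]]) auto
  fix B assume B: "B \<in> sets F" "A \<inter> B = {}"
  have "(\<lambda>n. \<mu> n (A \<union> B)) \<longlonglongrightarrow> \<nu> A + \<nu> B"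
    using tendsto_add[OF lim[OF A] lim[OF B(1)]] dominated_charge_add[OF \<mu> A B] by simp
  then show "\<nu> (A \<union> B) = \<nu> A + \<nu> B" using lim[of "A \<union> B"] A B(1) LIMSEQ_unique by blast
qed

text \<open>The values at pairs of an index \<open>k\<close> and a member of the countable generator
  form a bounded sequence in each coordinate, so a single subsequence serves all \<open>k\<close>
  and then all sets of \<open>F\<close>.\<close>

lemma ex_convergent_subseq_charges:
  fixes \<mu> :: "nat \<Rightarrow> 'k::countable \<Rightarrow> 'a set \<Rightarrow> real"
  assumes cg: "countably_generated F" and \<mu>: "\<And>n k. dominated_charge (\<mu> n k)"
  shows "\<exists>r. strict_mono r \<and> (\<forall>k. \<forall>A\<in>sets F. convergent (\<lambda>j. \<mu> (r j) k A))"
proof -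
  obtain P :: "nat \<Rightarrow> 'a set" where P: "Int_stable (range P)" "range P \<subseteq> sets F"
      "sets F = sigma_sets (space F) (range P)" "space F \<in> range P"
    using countably_generated_Int_stable[OF cg] by blast
  have PF: "P i \<in> sets F" for i using P(2) by auto
  define x where "x n i = (case from_nat i of (k, l) \<Rightarrow> \<mu> n k (P l))" for n i
  have "\<bar>x n i\<bar> \<le> measure M (space M)" for n i
  proof -
    obtain k l where kl: "from_nat i = (k :: 'k, l :: nat)" by (cases "from_nat i :: 'k \<times> nat")
    have "\<bar>\<mu> n k (P l)\<bar> \<le> measure M (P l)"
      using dominated_charge_nonneg[OF \<mu> PF] dominated_charge_le[OF \<mu> PF] by (simp add: abs_le_iff)
    also have "\<dots> \<le> measure M (space M)" by (rule bounded_measure)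
    finally show ?thesis by (simp add: x_def kl)
  qed
  then obtain r where r: "strict_mono r" "\<And>i. convergent (\<lambda>j. x (r j) i)"
    using ex_pointwise_convergent_subseq[of x "\<lambda>_. measure M (space M)"] by blast
  have conv: "convergent (\<lambda>j. \<mu> (r j) k (P l))" for k l
    using r(2)[of "to_nat (k, l)"] by (simp add: x_def)
  have "convergent (\<lambda>j. \<mu> (r j) k A)" if "A \<in> sets F" for k A
    by (rule dominated_charge_convergent[OF \<mu> P _ that]) (use conv in auto)
  then show ?thesis using r(1) by blast
qed

end


section \<open>Realising a tree of charges by a tree of sets\<close>

context nowhere_equivalent_subalgebra
begin

text \<open>Words grow at the head, so \<open>True # w\<close> and \<open>False # w\<close> are the
  children of \<open>w\<close>. Their charges add up to that of \<open>w\<close>, which dominates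
  the charge of the \<open>True\<close> child by the set already realised at \<open>w\<close>; the
  \<open>False\<close> child is what remains.\<close>

lemma ex_tree:
  fixes \<nu> :: "bool list \<Rightarrow> 'a set \<Rightarrow> real"
  assumes \<nu>: "\<And>w. dominated_charge (\<nu> w)" and root: "\<And>A. A \<in> sets F \<Longrightarrow> \<nu> [] A = measure M A"
    and split: "\<And>w A. A \<in> sets F \<Longrightarrow> \<nu> (True # w) A + \<nu> (False # w) A = \<nu> w A"
  shows "\<exists>C. C [] = space M \<and> (\<forall>w. C (True # w) \<subseteq> C w \<and> C (False # w) = C w - C (True # w)) \<and>
    (\<forall>w. C w \<in> sets M \<and> (\<forall>A\<in>sets F. measure M (A \<inter> C w) = \<nu> w A))"
proof -
  define sub where "sub S w = (SOME S'. S' \<in> sets M \<and> S' \<subseteq> S \<and>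
    (\<forall>A\<in>sets F. measure M (A \<inter> S') = \<nu> (True # w) A))" for S w
  define C where "C = rec_list (space M) (\<lambda>b w S. if b then sub S w else S - sub S w)"
  have C0: "C [] = space M" and CS: "C (b # w) = (if b then sub (C w) w else C w - sub (C w) w)" for b w
    by (simp_all add: C_def)
  have sub: "sub S w \<in> sets M \<and> sub S w \<subseteq> S \<and> (\<forall>A\<in>sets F. measure M (A \<inter> sub S w) = \<nu> (True # w) A)"
    if S: "S \<in> sets M" "\<And>A. A \<in> sets F \<Longrightarrow> measure M (A \<inter> S) = \<nu> w A" for S w
  proof -
    have "\<exists>S'\<in>sets M. S' \<subseteq> S \<and> (\<forall>A\<in>sets F. measure M (A \<inter> S') = \<nu> (True # w) A)"
    proof (rule split_measure[OF S(1)])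
      fix A assume A: "A \<in> sets F"
      show "0 \<le> \<nu> (True # w) A" by (rule dominated_charge_nonneg[OF \<nu> A])
      show "\<nu> (True # w) A \<le> measure M (A \<inter> S)"
        using split[OF A, of w] dominated_charge_nonneg[OF \<nu> A, of "False # w"] S(2)[OF A] by simp
    qed (rule dominated_charge_add[OF \<nu>])
    then show ?thesis unfolding sub_def by (rule someI_ex[OF bexE]) (auto simp: Bex_def)
  qed
  have main: "C w \<in> sets M \<and> (\<forall>A\<in>sets F. measure M (A \<inter> C w) = \<nu> w A)" for w
  proof (induction w)
    case Nil
    have "A \<inter> space M = A" if "A \<in> sets F" for A
      using sets.sets_into_space[OF sets_subalg[OF that]] by auto
    then show ?case using root by (simp add: C0)
  next
    case (Cons b w)
    note s = sub[of "C w" w]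
    show ?case
    proof (cases b)
      case True
      then show ?thesis using s Cons by (simp add: CS)
    next
      case False
      have "measure M (A \<inter> (C w - sub (C w) w)) = \<nu> (False # w) A" if A: "A \<in> sets F" for A
      proof -
        have "A \<inter> (C w - sub (C w) w) = (A \<inter> C w) - (A \<inter> sub (C w) w)" by auto
        then have "measure M (A \<inter> (C w - sub (C w) w)) = measure M (A \<inter> C w) - measure M (A \<inter> sub (C w) w)"
          using s Cons sets_subalg[OF A] by (subst finite_measure_Diff[symmetric]) auto
        then show ?thesis using s Cons A split[OF A, of w] by simp
      qed
      then show ?thesis using False s Cons by (auto simp: CS)
    qed
  qed
  have "C (True # w) \<subseteq> C w" "C (False # w) = C w - C (True # w)" for w
    using sub[of "C w" w] main[of w] by (simp_all add: CS)
  then show ?thesis using C0 main by blast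
qed

end

text \<open>The path of \<open>t\<close> through the tree with the latest bit in front. Membership
  in the \<open>True\<close> child alone decides each bit, so the path is defined for every
  \<open>t\<close>.\<close>

primrec tree_code :: "(bool list \<Rightarrow> 'a set) \<Rightarrow> 'a \<Rightarrow> nat \<Rightarrow> bool list" where
  "tree_code C t 0 = []"
| "tree_code C t (Suc n) = (t \<in> C (True # tree_code C t n)) # tree_code C t n"

lemma length_tree_code [simp]: "length (tree_code C t n) = n"
  by (induction n) auto

lemma tree_code_mem:
  assumes "t \<in> C []" "\<And>w. C (False # w) = C w - C (True # w)"
  shows "t \<in> C (tree_code C t n)"
proof (induction n)
  case (Suc n)
  then show ?case using assms(2) by (cases "t \<in> C (True # tree_code C t n)") simp_all
qed (simp add: assms(1))

lemma tree_code_unique: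
  assumes "\<And>w. C (True # w) \<subseteq> C w" "\<And>w. C (False # w) = C w - C (True # w)" "t \<in> C w"
  shows "tree_code C t (length w) = w"
  using assms(3)
proof (induction w)
  case (Cons b w)
  have "t \<in> C w" using Cons.prems assms(1,2) by (cases b) auto
  then have "tree_code C t (length w) = w" by (rule Cons.IH)
  moreover have "t \<in> C (True # w) \<longleftrightarrow> b" using Cons.prems assms(2) by (cases b) auto
  ultimately show ?case by simp
qed simp

section \<open>Mixtures of selections and their limits\<close>

text \<open>A finite random mixture \<open>(m, c, z)\<close> stands for the random measure
  \<open>\<Sum>i<m. c i t \<cdot> \<delta>(z i t)\<close> on the target space.\<close>

type_synonym ('a, 'x) mix = "nat \<times> (nat \<Rightarrow> 'a \<Rightarrow> real) \<times> (nat \<Rightarrow> 'a \<Rightarrow> 'x)"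

text \<open>The integral of \<open>u\<close> against the random measure at \<open>t\<close>.\<close>

definition mexp :: "('a, 'x) mix \<Rightarrow> ('x \<Rightarrow> real) \<Rightarrow> 'a \<Rightarrow> real" where
  "mexp \<kappa> u t = (case \<kappa> of (m, c, z) \<Rightarrow> \<Sum>i<m. c i t * u (z i t))"

text \<open>The weights form a probability vector at every \<open>t\<close>, while a point has to
  lie in \<open>\<Phi> t\<close> only where its weight is nonzero. So one length \<open>m\<close>
  can serve for weights that are supported on an index set varying with \<open>t\<close>.\<close>

definition mixture :: "'a measure \<Rightarrow> ('a \<Rightarrow> 'x::topological_space set) \<Rightarrow> ('a, 'x) mix \<Rightarrow> bool" where
  "mixture M \<Phi> \<kappa> \<longleftrightarrow> (case \<kappa> of (m, c, z) \<Rightarrow>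
    (\<forall>i. c i \<in> borel_measurable M \<and> z i \<in> borel_measurable M) \<and>
    (\<forall>i t. 0 \<le> c i t) \<and> (\<forall>t. (\<Sum>i<m. c i t) = 1) \<and>
    (AE t in M. \<forall>i<m. c i t \<noteq> 0 \<longrightarrow> z i t \<in> \<Phi> t))"

lemma mexp_measurable:
  assumes "mixture M \<Phi> \<kappa>" "u \<in> borel_measurable borel"
  shows "mexp \<kappa> u \<in> borel_measurable M"
proof -
  obtain m c z where \<kappa>: "\<kappa> = (m, c, z)" by (cases \<kappa>)
  have "(\<lambda>t. u (z i t)) \<in> borel_measurable M" "c i \<in> borel_measurable M" for i
    using assms measurable_compose[of "z i" M borel u borel] by (auto simp: mixture_def \<kappa>)
  then have "(\<lambda>t. \<Sum>i<m. c i t * u (z i t)) \<in> borel_measurable M"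
    by (intro borel_measurable_sum borel_measurable_times) auto
  then show ?thesis unfolding mexp_def[abs_def] by (simp add: \<kappa>)
qed

lemma mexp_mono:
  assumes "mixture M \<Phi> \<kappa>" "\<And>x. u x \<le> v x"
  shows "mexp \<kappa> u t \<le> mexp \<kappa> v t"
  using assms unfolding mexp_def mixture_def by (auto split: prod.splits intro!: sum_mono mult_left_mono)

text \<open>Points outside of \<open>\<Phi> t\<close> have weight zero, so test functions, even ones
  depending on \<open>t\<close>, need to be compared on \<open>\<Phi> t\<close> only.\<close>

lemma mexp_mono_support:
  assumes "mixture M \<Phi> \<kappa>" "AE t in M. \<forall>x\<in>\<Phi> t. u t x \<le> v t x"
  shows "AE t in M. mexp \<kappa> (u t) t \<le> mexp \<kappa> (v t) t"
proof -
  obtain m c z where \<kappa>: "\<kappa> = (m, c, z)" by (cases \<kappa>)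
  have "AE t in M. \<forall>i<m. c i t \<noteq> 0 \<longrightarrow> z i t \<in> \<Phi> t" and nonneg: "\<And>i t. 0 \<le> c i t"
    using assms(1) by (auto simp: mixture_def \<kappa>)
  from this(1) assms(2) show ?thesis
  proof eventually_elim
    case (elim t)
    have "c i t * u t (z i t) \<le> c i t * v t (z i t)" if "i < m" for i
      using elim that nonneg[of i t] by (cases "c i t = 0") (auto intro!: mult_left_mono)
    then show ?case by (auto simp: mexp_def \<kappa> intro!: sum_mono)
  qed
qed

lemma mexp_const: "mixture M \<Phi> \<kappa> \<Longrightarrow> mexp \<kappa> (\<lambda>_. a) t = a"
  by (auto simp: mixture_def mexp_def sum_distrib_right[symmetric] split: prod.splits)

lemma mexp_add: "mexp \<kappa> (\<lambda>x. u x + v x) t = mexp \<kappa> u t + mexp \<kappa> v t"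
  by (auto simp: mexp_def algebra_simps sum.distrib split: prod.splits)

lemma mexp_cmult: "mexp \<kappa> (\<lambda>x. a * u x) t = a * mexp \<kappa> u t"
  by (auto simp: mexp_def sum_distrib_left algebra_simps split: prod.splits)

lemma mexp_sum: "finite I \<Longrightarrow> mexp \<kappa> (\<lambda>x. \<Sum>j\<in>I. u j x) t = (\<Sum>j\<in>I. mexp \<kappa> (u j) t)"
  by (induction I rule: finite_induct) (auto simp: mexp_add mexp_def split: prod.splits)

lemma mexp_abs_le:
  assumes "mixture M \<Phi> \<kappa>" "\<And>x. \<bar>u x\<bar> \<le> a"
  shows "\<bar>mexp \<kappa> u t\<bar> \<le> a"
proof -
  have "u x \<le> a" "- a \<le> u x" for x using assms(2)[of x] by (auto simp: abs_le_iff)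
  then have "mexp \<kappa> u t \<le> mexp \<kappa> (\<lambda>_. a) t" "mexp \<kappa> (\<lambda>_. - a) t \<le> mexp \<kappa> u t"
    by (auto intro!: mexp_mono[OF assms(1)])
  then show ?thesis by (simp add: mexp_const[OF assms(1)] abs_le_iff)
qed

lemma (in finite_measure) set_integrable_bounded:
  fixes g :: "'a \<Rightarrow> real"
  assumes "g \<in> borel_measurable M" "\<And>t. \<bar>g t\<bar> \<le> a" "A \<in> sets M"
  shows "set_integrable M A g"
  unfolding set_integrable_def
  by (rule integrable_mult_indicator[OF assms(3)]) (use assms in \<open>auto intro!: integrable_const_bound[where B = a]\<close>)

lemma (in finite_measure) set_integral_const_real:
  "A \<in> sets M \<Longrightarrow> (LINT t:A|M. (a::real)) = a * measure M A"
  by (simp add: set_lebesgue_integral_def mult.commute)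

text \<open>Dominated charges enter here: for fixed \<open>E\<close> this one describes the
  conditional probability, given \<open>F\<close>, that the mixture falls into
  \<open>E\<close>.\<close>

lemma (in finite_measure_subalgebra) dominated_charge_mexp:
  assumes \<kappa>: "mixture M \<Phi> \<kappa>" and E: "E \<in> sets borel"
  shows "dominated_charge (\<lambda>A. LINT t:A|M. mexp \<kappa> (indicator E) t)"
proof -
  have bd: "\<bar>mexp \<kappa> (indicator E) t\<bar> \<le> 1" for t
    by (rule mexp_abs_le[OF \<kappa>]) (auto simp: indicator_def)
  have int: "set_integrable M A (mexp \<kappa> (indicator E))" if "A \<in> sets M" for A
    using E by (intro set_integrable_bounded[OF _ bd that] mexp_measurable[OF \<kappa>]) auto
  have nonneg: "0 \<le> mexp \<kappa> (indicator E) t" for t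
    using mexp_mono[OF \<kappa>, of "\<lambda>_. 0" "indicator E" t] by (simp add: mexp_const[OF \<kappa>])
  have "(LINT t:A|M. mexp \<kappa> (indicator E) t) \<le> (LINT t:A|M. 1)" if "A \<in> sets M" for A
    using bd that by (intro set_integral_mono int set_integrable_bounded[where a = 1]) (auto simp: abs_le_iff)
  then show ?thesis unfolding dominated_charge_def
    using nonneg by (auto simp: set_integral_const_real sets_subalg intro!: set_integral_Un int)
      (auto simp: set_lebesgue_integral_def intro!: Bochner_Integration.integral_nonneg)
qed

lemma fsigma_in_borel:
  assumes "fsigma_in euclidean (E::'x::topological_space set)"
  shows "E \<in> sets borel"
proof -
  have "closedin euclidean = (closed :: 'x set \<Rightarrow> bool)" by (simp add: fun_eq_iff)
  then obtain \<E> where "countable \<E>" "\<E> \<subseteq> Collect closed" "\<Union>\<E> = E"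
    using assms by (auto simp only: fsigma_in_def union_of_def)
  then show ?thesis by (auto intro!: sets.countable_Union)
qed

text \<open>The head of a word is its latest bit, and its level is the length of the remaining word.
  \<open>V1\<close> and \<open>V0\<close> need not be complementary, so cells of equal level may
  overlap; for the complementary pair of \<open>bcell\<close> they partition the space.\<close>

primrec cell :: "(nat \<Rightarrow> 'x set) \<Rightarrow> (nat \<Rightarrow> 'x set) \<Rightarrow> bool list \<Rightarrow> 'x set" where
  "cell V1 V0 [] = UNIV"
| "cell V1 V0 (b # w) = cell V1 V0 w \<inter> (if b then V1 (length w) else V0 (length w))"

abbreviation bcell :: "(nat \<Rightarrow> 'x set) \<Rightarrow> bool list \<Rightarrow> 'x set" where
  "bcell W \<equiv> cell W (\<lambda>j. - W j)"

primrec bcode :: "(nat \<Rightarrow> 'x set) \<Rightarrow> 'x \<Rightarrow> nat \<Rightarrow> bool list" where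
  "bcode W x 0 = []"
| "bcode W x (Suc n) = (x \<in> W n) # bcode W x n"

lemma mem_bcell_iff: "x \<in> bcell W w \<longleftrightarrow> w = bcode W x (length w)"
  by (induction w) auto

lemma cell_mono:
  assumes "\<And>j. W1 j \<subseteq> V1 j" "\<And>j. W0 j \<subseteq> V0 j"
  shows "cell W1 W0 w \<subseteq> cell V1 V0 w"
proof (induction w)
  case (Cons b w)
  then show ?case using assms[of "length w"] by (cases b) auto
qed simp

lemma finite_words: "finite {w::bool list. length w = j}"
  using finite_lists_length_eq[of "UNIV :: bool set" j] by simp

lemma length_bcode [simp]: "length (bcode W x n) = n"
  by (induction n) auto

text \<open>The set \<open>W j\<close> is the disjoint union of the cells of level
  \<open>j + 1\<close> whose latest bit is \<open>True\<close>; this turns cell charges into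
  probabilities of single bits.\<close>

lemma indicator_eq_sum_bcell:
  "(indicator (W j) x :: real) = (\<Sum>w\<in>{w. length w = j}. indicator (bcell W (True # w)) x)"
proof -
  have "(\<Sum>w\<in>{w. length w = j}. indicator (bcell W (True # w)) x :: real)
      = (\<Sum>w\<in>{w. length w = j}. if w = bcode W x j then indicator (W j) x else 0)"
    by (rule sum.cong) (auto simp: mem_bcell_iff indicator_def)
  also have "\<dots> = indicator (W j) x" using finite_words[of j] by simp
  finally show ?thesis by simp
qed

lemma closedin_cell:
  assumes "\<And>j. closedin X (V1 j)" "\<And>j. closedin X (V0 j)" "topspace X = UNIV"
  shows "closedin X (cell V1 V0 w)"
proof (induction w)
  case Nil
  then show ?case using closedin_topspace[of X] assms(3) by simp
qed (use assms in \<open>auto intro!: closedin_Int\<close>)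

lemma fsigma_cell:
  assumes "\<And>j. fsigma_in euclidean (V1 j)" "\<And>j. fsigma_in euclidean (V0 j)"
  shows "fsigma_in euclidean (cell V1 V0 w)"
proof (induction w)
  case Nil
  then show ?case using fsigma_in_topspace[of euclidean] by simp
qed (use assms in \<open>auto intro!: fsigma_in_Int\<close>)

text \<open>The bits \<open>x \<in> W j\<close> code the points of the target space; \<open>V1 j\<close> and \<open>V0 j\<close> are weakly
  closed sets containing \<open>W j\<close> and its complement.  The conditional laws of the codes converge
  along a subsequence, the limit law is realised by a code on the underlying space, and by weak
  compactness almost every realised code is the code of a point of the limit correspondence.\<close>

lemma (in nowhere_equivalent_subalgebra) ex_limit_selection_bits:
  fixes \<kappa> :: "nat \<Rightarrow> ('a, 'x::{banach, second_countable_topology}) mix"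
  assumes cg: "countably_generated F"
    and \<kappa>: "\<And>n. mixture M (\<Phi> n) (\<kappa> n)" and meas: "\<And>n. measurable_correspondence F (\<Phi> n)"
    and W: "\<And>j. fsigma_in euclidean (W j)" "\<And>j. fsigma_in euclidean (- W j)"
    and V: "\<And>j. closedin weak_topology (V1 j)" "\<And>j. closedin weak_topology (V0 j)"
      "\<And>j. W j \<subseteq> V1 j" "\<And>j. - W j \<subseteq> V0 j"
    and comp: "AE t in M. compactin weak_topology (\<Phi>' t)"
    and uhc: "AE t in M. \<forall>V. openin weak_topology V \<and> \<Phi>' t \<subseteq> V \<longrightarrow> (\<forall>\<^sub>F n in sequentially. \<Phi> n t \<subseteq> V)"
  shows "\<exists>r f B. strict_mono r \<and> (\<forall>j::nat. B j \<in> sets M) \<and>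
    (AE t in M. f t \<in> \<Phi>' t \<and> (\<forall>j. f t \<in> (if t \<in> B j then V1 j else V0 j))) \<and>
    (\<forall>j. \<forall>A\<in>sets F. (\<lambda>k. LINT t:A|M. mexp (\<kappa> (r k)) (indicator (W j)) t) \<longlonglongrightarrow> measure M (A \<inter> B j))"
proof -
  have cellF: "fsigma_in euclidean (bcell W w)" for w by (intro fsigma_cell W)
  have cellB: "bcell W w \<in> sets borel" for w by (rule fsigma_in_borel[OF cellF])
  have WB: "W j \<in> sets borel" for j by (rule fsigma_in_borel[OF W(1)])
  have bd: "\<bar>mexp (\<kappa> n) (indicator E) t\<bar> \<le> 1" for n E t
    by (rule mexp_abs_le[OF \<kappa>]) (auto simp: indicator_def)
  have int: "set_integrable M A (mexp (\<kappa> n) (indicator E))" if "A \<in> sets M" "E \<in> sets borel" for A n E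
    using that(2) by (intro set_integrable_bounded[OF _ bd that(1)] mexp_measurable[OF \<kappa>]) auto
  define \<mu> where "\<mu> n w A = (LINT t:A|M. mexp (\<kappa> n) (indicator (bcell W w)) t)" for n w A
  have \<mu>: "dominated_charge (\<mu> n w)" for n w
    unfolding \<mu>_def[abs_def] by (rule dominated_charge_mexp[OF \<kappa> cellB])
  obtain r where r: "strict_mono r" and conv: "\<And>w A. A \<in> sets F \<Longrightarrow> convergent (\<lambda>k. \<mu> (r k) w A)"
    using ex_convergent_subseq_charges[of \<mu>, OF cg \<mu>] by blast
  define \<nu> where "\<nu> w A = lim (\<lambda>k. \<mu> (r k) w A)" for w A
  have lim: "(\<lambda>k. \<mu> (r k) w A) \<longlonglongrightarrow> \<nu> w A" if "A \<in> sets F" for w A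
    unfolding \<nu>_def using conv[OF that] by (simp add: convergent_LIMSEQ_iff)
  have "\<exists>C. C [] = space M \<and> (\<forall>w. C (True # w) \<subseteq> C w \<and> C (False # w) = C w - C (True # w)) \<and>
    (\<forall>w. C w \<in> sets M \<and> (\<forall>A\<in>sets F. measure M (A \<inter> C w) = \<nu> w A))"
  proof (rule ex_tree)
    show "dominated_charge (\<nu> w)" for w by (rule dominated_charge_lim[OF \<mu> lim])
    fix A assume A: "A \<in> sets F"
    have "\<mu> n [] A = measure M A" for n
    proof -
      have "indicator (bcell W []) = (\<lambda>_. 1::real)" by auto
      then show ?thesis using sets_subalg[OF A] by (simp add: \<mu>_def mexp_const[OF \<kappa>] set_integral_const_real)
    qed
    then show "\<nu> [] A = measure M A" using LIMSEQ_unique[OF lim[OF A, of "[]"]] by simp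
    fix w
    have "\<mu> n (True # w) A + \<mu> n (False # w) A = \<mu> n w A" for n
    proof -
      have "(\<lambda>x. indicator (bcell W (True # w)) x + indicator (bcell W (False # w)) x)
          = (indicator (bcell W w) :: _ \<Rightarrow> real)"
        by (auto simp: indicator_def fun_eq_iff)
      then have "mexp (\<kappa> n) (indicator (bcell W w)) t = mexp (\<kappa> n) (indicator (bcell W (True # w))) t
          + mexp (\<kappa> n) (indicator (bcell W (False # w))) t" for t
        by (simp only: mexp_add[symmetric])
      then have "\<mu> n w A = (LINT t:A|M. mexp (\<kappa> n) (indicator (bcell W (True # w))) t
          + mexp (\<kappa> n) (indicator (bcell W (False # w))) t)"
        by (simp only: \<mu>_def)
      then show ?thesis unfolding \<mu>_def
        by (simp only: set_integral_add(2)[OF int[OF sets_subalg[OF A] cellB] int[OF sets_subalg[OF A] cellB]])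
    qed
    then have "(\<lambda>k. \<mu> (r k) w A) \<longlonglongrightarrow> \<nu> (True # w) A + \<nu> (False # w) A"
      using tendsto_add[OF lim[OF A, of "True # w"] lim[OF A, of "False # w"]] by simp
    then show "\<nu> (True # w) A + \<nu> (False # w) A = \<nu> w A" using lim[OF A] LIMSEQ_unique by blast
  qed
  then obtain C where C0: "C [] = space M" and CT: "\<And>w. C (True # w) \<subseteq> C w"
    and CF: "\<And>w. C (False # w) = C w - C (True # w)" and CM: "\<And>w. C w \<in> sets M"
    and C\<nu>: "\<And>w A. A \<in> sets F \<Longrightarrow> measure M (A \<inter> C w) = \<nu> w A" by blast
  define code where "code = tree_code C"
  have code_S: "code t (Suc n) = (t \<in> C (True # code t n)) # code t n" for t n by (simp add: code_def)
  have code_mem: "t \<in> C (code t n)" if "t \<in> space M" for t n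
    unfolding code_def by (rule tree_code_mem) (use that C0 CF in auto)
  have code_unique: "code t (length w) = w" if "t \<in> C w" for t w
    unfolding code_def by (rule tree_code_unique[where C = C]) (use that CT CF in auto)
  have len: "length (code t n) = n" for t n by (simp add: code_def)
  \<comment> \<open>The event that bit \<open>j\<close> of the realised code is
    \<open>True\<close>.\<close>
  define B where "B j = (\<Union>w\<in>{w. length w = j}. C (True # w))" for j
  have BM: "B j \<in> sets M" for j unfolding B_def using CM finite_words by (intro sets.finite_UN) auto
  have B_iff: "t \<in> B j \<longleftrightarrow> t \<in> C (True # code t j)" for t j
  proof
    assume "t \<in> B j"
    then obtain w where w: "length w = j" "t \<in> C (True # w)" by (auto simp: B_def)
    then have "code t j = w" using code_unique CT by blast
    then show "t \<in> C (True # code t j)" using w(2) by simp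
  next
    assume "t \<in> C (True # code t j)"
    then show "t \<in> B j" using len unfolding B_def by blast
  qed
  have Blim: "(\<lambda>k. LINT t:A|M. mexp (\<kappa> (r k)) (indicator (W j)) t) \<longlonglongrightarrow> measure M (A \<inter> B j)"
    if A: "A \<in> sets F" for A j
  proof -
    have "(LINT t:A|M. mexp (\<kappa> n) (indicator (W j)) t) = (\<Sum>w\<in>{w. length w = j}. \<mu> n (True # w) A)" for n
    proof -
      have "indicator (W j) = (\<lambda>x. \<Sum>w\<in>{w. length w = j}. indicator (bcell W (True # w)) x :: real)"
        by (rule ext) (rule indicator_eq_sum_bcell)
      then have "mexp (\<kappa> n) (indicator (W j)) t =
          (\<Sum>w\<in>{w. length w = j}. mexp (\<kappa> n) (indicator (bcell W (True # w))) t)" for t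
        using mexp_sum[OF finite_words[of j], of "\<kappa> n" "\<lambda>w. indicator (bcell W (True # w))" t] by presburger
      then show ?thesis unfolding \<mu>_def set_lebesgue_integral_def
        using int[OF sets_subalg[OF A] cellB] unfolding set_integrable_def
        by (simp only: sum_distrib_left real_scaleR_def) (rule Bochner_Integration.integral_sum, simp del: cell.simps)
    qed
    moreover have "measure M (A \<inter> B j) = (\<Sum>w\<in>{w. length w = j}. \<nu> (True # w) A)"
    proof -
      have "A \<inter> B j = (\<Union>w\<in>{w. length w = j}. A \<inter> C (True # w))" by (auto simp: B_def)
      moreover have "disjoint_family_on (\<lambda>w. A \<inter> C (True # w)) {w. length w = j}"
        unfolding disjoint_family_on_def
      proof (intro ballI impI)
        fix v w :: "bool list" assume vw: "v \<in> {w. length w = j}" "w \<in> {w. length w = j}" "v \<noteq> w"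
        have "v = w" if "t \<in> C (True # v)" "t \<in> C (True # w)" for t
          using code_unique[OF subsetD[OF CT that(1)]] code_unique[OF subsetD[OF CT that(2)]] vw by simp
        then show "(A \<inter> C (True # v)) \<inter> (A \<inter> C (True # w)) = {}" using vw(3) by blast
      qed
      ultimately show ?thesis
        using finite_measure_finite_Union[OF finite_words[of j], of "\<lambda>w. A \<inter> C (True # w)"] CM
          sets_subalg[OF A] C\<nu>[OF A] by (simp add: image_subset_iff)
    qed
    ultimately show ?thesis using lim[OF A] by (simp add: tendsto_sum)
  qed
  define S where "S n w = {t \<in> space F. \<Phi> n t \<inter> bcell W w \<noteq> {}}" for n w
  have SF: "S n w \<in> sets F" for n w
    unfolding S_def by (rule measurable_correspondence_fsigma[OF meas cellF])
  \<comment> \<open>The points at which every correspondence from the \<open>n\<close>-th of the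
    subsequence on misses the cell of \<open>w\<close>. The late mixtures put no mass on that cell
    there, so in the limit almost no point of \<open>Z n w\<close> receives a code starting with
    \<open>w\<close>.\<close>
  define Z where "Z n w = space F - (\<Union>k\<in>{n..}. S (r k) w)" for n w
  have ZF: "Z n w \<in> sets F" for n w unfolding Z_def using SF by auto
  have "AE t in M. \<not> (t \<in> Z n w \<and> t \<in> C w)" for n w
  proof -
    have "\<mu> (r k) w (Z n w) = 0" if k: "n \<le> k" for k
    proof -
      define b where "b t = (indicator (space F - Z n w) t :: real)" for t
      have "AE t in M. \<forall>x\<in>\<Phi> (r k) t. indicator (bcell W w) x \<le> (b t :: real)"
      proof (rule AE_I2)
        fix t assume t: "t \<in> space M"
        show "\<forall>x\<in>\<Phi> (r k) t. indicator (bcell W w) x \<le> (b t :: real)"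
        proof
          fix x assume "x \<in> \<Phi> (r k) t"
          then have "x \<in> bcell W w \<Longrightarrow> t \<in> S (r k) w" using t by (auto simp: S_def space_subalg)
          then have "x \<in> bcell W w \<Longrightarrow> t \<notin> Z n w" using k by (auto simp: Z_def)
          then show "indicator (bcell W w) x \<le> (b t :: real)"
            using t by (auto simp: indicator_def b_def space_subalg)
        qed
      qed
      from mexp_mono_support[OF \<kappa> this]
      have le: "AE t in M. mexp (\<kappa> (r k)) (indicator (bcell W w)) t \<le> b t"
        by (simp add: mexp_const[OF \<kappa>])
      have nn: "0 \<le> mexp (\<kappa> (r k)) (indicator (bcell W w)) t" for t
        using mexp_mono[OF \<kappa>, of "\<lambda>_. 0" "indicator (bcell W w)"] by (simp add: mexp_const[OF \<kappa>])
      from le have "AE t in M. indicator (Z n w) t *\<^sub>R mexp (\<kappa> (r k)) (indicator (bcell W w)) t = 0"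
      proof eventually_elim
        case (elim t)
        then show ?case using nn[of t] by (cases "t \<in> Z n w") (auto simp: b_def)
      qed
      then show ?thesis unfolding \<mu>_def set_lebesgue_integral_def by (rule integral_eq_zero_AE)
    qed
    then have "(\<lambda>k. \<mu> (r k) w (Z n w)) \<longlonglongrightarrow> 0"
      by (intro tendsto_eventually) (auto simp: eventually_sequentially)
    then have "measure M (Z n w \<inter> C w) = 0"
      using C\<nu>[OF ZF] LIMSEQ_unique[OF lim[OF ZF]] by simp
    then have "Z n w \<inter> C w \<in> null_sets M"
      using sets_subalg[OF ZF] CM by (intro null_setsI) (auto simp: emeasure_eq_measure)
    then show ?thesis by (rule AE_I'[where N = "Z n w \<inter> C w"]) auto
  qed
  then have "AE t in M. \<forall>n w. \<not> (t \<in> Z n w \<and> t \<in> C w)" by (simp add: AE_all_countable)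
  then have good: "AE t in M. \<exists>x\<in>\<Phi>' t. \<forall>j. x \<in> (if t \<in> B j then V1 j else V0 j)"
    using comp uhc AE_space
  proof eventually_elim
    case (elim t)
    \<comment> \<open>The weakly closed cells along the code of \<open>t\<close> decrease, so by
      weak compactness they have a common point in \<open>\<Phi>' t\<close> once each of them meets
      \<open>\<Phi>' t\<close>.\<close>
    define K where "K j = cell V1 V0 (code t j)" for j
    have Kcl: "closedin weak_topology (K j)" for j
      unfolding K_def by (intro closedin_cell V topspace_weak_topology)
    have "\<Phi>' t \<inter> (\<Inter>j. K j) \<noteq> {}"
    proof (rule compactin_Inter_nonempty[OF elim(2) Kcl])
      show "decseq K" by (rule decseq_SucI) (auto simp: K_def code_S)
      fix j
      \<comment> \<open>Otherwise upper hemicontinuity would push \<open>\<Phi> (r k) t\<close> out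
        of \<open>K j\<close> for all late \<open>k\<close>, whereas \<open>t\<close> outside of the
        sets \<open>Z\<close> makes it meet the smaller cell \<open>bcell W (code t j)\<close> for
        arbitrarily late \<open>k\<close>.\<close>
      show "\<Phi>' t \<inter> K j \<noteq> {}"
      proof
        assume "\<Phi>' t \<inter> K j = {}"
        then have "\<Phi>' t \<subseteq> - K j" by blast
        moreover have "openin weak_topology (- K j)"
          using Kcl[of j] by (simp add: closedin_def topspace_weak_topology Compl_eq_Diff_UNIV)
        ultimately have "\<forall>\<^sub>F n in sequentially. \<Phi> n t \<subseteq> - K j" using elim(3) by blast
        then have "\<forall>\<^sub>F k in sequentially. \<Phi> (r k) t \<subseteq> - K j" by (rule eventually_subseq[OF r])
        then obtain n where n: "\<And>k. n \<le> k \<Longrightarrow> \<Phi> (r k) t \<subseteq> - K j" by (auto simp: eventually_sequentially)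
        have "t \<notin> Z n (code t j)" using elim(1) code_mem[OF elim(4)] by blast
        then obtain k where "n \<le> k" "\<Phi> (r k) t \<inter> bcell W (code t j) \<noteq> {}"
          using elim(4) by (auto simp: Z_def S_def space_subalg)
        moreover have "bcell W (code t j) \<subseteq> K j" unfolding K_def by (rule cell_mono[OF V(3,4)])
        ultimately show False using n by blast
      qed
    qed
    then obtain x where x: "x \<in> \<Phi>' t" "\<And>j. x \<in> K j" by blast
    \<comment> \<open>Bit \<open>j\<close> is the head of the code of length
      \<open>Suc j\<close>.\<close>
    have "x \<in> (if t \<in> B j then V1 j else V0 j)" for j
      using x(2)[of "Suc j"] B_iff[of t j] by (simp add: K_def code_S len split: if_splits)
    then show ?case using x(1) by blast
  qed
  \<comment> \<open>A bare pointwise choice; its measurability has to be recovered from the sets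
    \<open>B j\<close>.\<close>
  define f where "f t = (SOME x. x \<in> \<Phi>' t \<and> (\<forall>j. x \<in> (if t \<in> B j then V1 j else V0 j)))" for t
  have "AE t in M. f t \<in> \<Phi>' t \<and> (\<forall>j. f t \<in> (if t \<in> B j then V1 j else V0 j))"
    using good
  proof eventually_elim
    case (elim t)
    then have "\<exists>x. x \<in> \<Phi>' t \<and> (\<forall>j. x \<in> (if t \<in> B j then V1 j else V0 j))" by blast
    from someI_ex[OF this] show ?case unfolding f_def .
  qed
  then show ?thesis using r BM Blim by blast
qed

section \<open>Limits of mixtures tested against functionals\<close>

text \<open>Clamped functionals are bounded, so they can be integrated against mixtures that have no
  integrable bound.\<close>

definition trunc :: "nat \<Rightarrow> real \<Rightarrow> real" where
  "trunc R y = max (- real R) (min (real R) y)"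

lemma abs_trunc_le: "\<bar>trunc R y\<bar> \<le> real R"
  by (auto simp: trunc_def)

lemma trunc_minus: "trunc R (- y) = - trunc R y"
  by (auto simp: trunc_def)

lemma trunc_measurable [measurable]: "trunc R \<in> borel_measurable borel"
  unfolding trunc_def[abs_def] by measurable

lemma trunc_error: "\<bar>y - trunc R y\<bar> \<le> max (\<bar>y\<bar> - real R) 0"
  by (auto simp: trunc_def)

text \<open>A discrete layer-cake formula on \<open>[-R, R]\<close> with mesh \<open>1 / m\<close>
  and hence \<open>2 * R * m\<close> levels. Counting only the levels strictly below
  \<open>y\<close> loses at most one mesh, which the summand 1 pays for.\<close>

lemma trunc_le_grid:
  assumes "0 < m"
  shows "trunc R y \<le> - real R + (1 + (\<Sum>j=1..2 * R * m. of_bool (- real R + real j / real m < y))) / real m"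
proof -
  define x where "x = real m * (trunc R y + real R)"
  have x0: "0 \<le> x" using abs_trunc_le[of R y] by (simp add: x_def abs_le_iff)
  have x1: "x \<le> real (2 * R * m)"
  proof -
    have "x \<le> real m * (2 * real R)" unfolding x_def using abs_trunc_le[of R y] by (intro mult_left_mono) (auto simp: abs_le_iff)
    then show ?thesis by (simp add: mult_ac)
  qed
  \<comment> \<open>The number of positive integers strictly below \<open>x\<close>.\<close>
  define k where "k = nat (\<lceil>x\<rceil> - 1)"
  have "{1..k} \<subseteq> {j \<in> {1..2 * R * m}. - real R + real j / real m < y}"
  proof
    fix j assume j: "j \<in> {1..k}"
    then have "1 \<le> j" "j \<le> nat (\<lceil>x\<rceil> - 1)" by (simp_all add: k_def)
    then have "int j \<le> \<lceil>x\<rceil> - 1" by linarith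
    then have jx: "real j < x" by linarith
    have "real j / real m < trunc R y + real R" using jx assms by (simp add: x_def field_simps)
    moreover have "0 < real j / real m" using j assms by simp
    ultimately have "- real R + real j / real m < y" by (auto simp: trunc_def)
    moreover have "j \<le> 2 * R * m" using jx x1 by linarith
    ultimately show "j \<in> {j \<in> {1..2 * R * m}. - real R + real j / real m < y}" using j by simp
  qed
  then have "card {1..k} \<le> card {j \<in> {1..2 * R * m}. - real R + real j / real m < y}"
    by (intro card_mono) auto
  then have "real k \<le> (\<Sum>j=1..2 * R * m. of_bool (- real R + real j / real m < y))"
    by (simp add: sum_of_bool_eq Int_def conj_commute)
  moreover have "x - 1 \<le> real k" unfolding k_def by linarith
  ultimately have "x \<le> 1 + (\<Sum>j=1..2 * R * m. of_bool (- real R + real j / real m < y))" by simp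
  then have "x / real m \<le> (1 + (\<Sum>j=1..2 * R * m. of_bool (- real R + real j / real m < y))) / real m"
    by (rule divide_right_mono) simp
  moreover have "x / real m = trunc R y + real R" using assms by (simp add: x_def)
  ultimately show ?thesis by linarith
qed

text \<open>Counting the levels at or below \<open>y\<close> is a rounding down, so no correction
  appears.\<close>

lemma grid_le_trunc:
  assumes "0 < m"
  shows "- real R + (\<Sum>j=1..2 * R * m. of_bool (- real R + real j / real m \<le> y)) / real m \<le> trunc R y"
proof -
  define x where "x = real m * (trunc R y + real R)"
  have x0: "0 \<le> x" using abs_trunc_le[of R y] by (simp add: x_def abs_le_iff)
  have "{j \<in> {1..2 * R * m}. - real R + real j / real m \<le> y} \<subseteq> {1..nat \<lfloor>x\<rfloor>}"
  proof
    fix j assume j: "j \<in> {j \<in> {1..2 * R * m}. - real R + real j / real m \<le> y}"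
    have "real j \<le> real (2 * R * m)" using j by (simp only: of_nat_le_iff) auto
    then have "real j / real m \<le> 2 * real R" using assms by (simp add: divide_le_eq mult_ac)
    then have "real j / real m \<le> trunc R y + real R" using j by (auto simp: trunc_def)
    then have "real j \<le> x" using assms by (simp add: x_def field_simps)
    then show "j \<in> {1..nat \<lfloor>x\<rfloor>}" using j by (auto simp: le_nat_floor)
  qed
  then have "card {j \<in> {1..2 * R * m}. - real R + real j / real m \<le> y} \<le> card {1..nat \<lfloor>x\<rfloor>}"
    by (intro card_mono) auto
  then have "(\<Sum>j=1..2 * R * m. of_bool (- real R + real j / real m \<le> y)) \<le> real (nat \<lfloor>x\<rfloor>)"
    by (simp add: sum_of_bool_eq Int_def conj_commute)
  also have "\<dots> \<le> x" using x0 by simp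
  finally have "(\<Sum>j=1..2 * R * m. of_bool (- real R + real j / real m \<le> y)) / real m \<le> x / real m"
    by (rule divide_right_mono) simp
  moreover have "x / real m = trunc R y + real R" using assms by (simp add: x_def)
  ultimately show ?thesis by linarith
qed

text \<open>Only inclusions link the level sets to the sets with convergent mass, because a realised
  code does not decide boundary values. On the side of the mixtures \<open>E q\<close> lies inside
  the weak level set, on the side of the limit \<open>b q\<close> contains the strict one; the two
  grid estimates are matched to this and give one inequality.\<close>

lemma (in finite_measure) limit_trunc_le:
  fixes g :: "'x::topological_space \<Rightarrow> real"
  assumes \<kappa>: "\<And>n. mixture M (\<Phi> n) (\<kappa> n)"
    and g: "g \<in> borel_measurable borel" "(\<lambda>t. g (f t)) \<in> borel_measurable M"
    and E: "\<And>q. q \<in> \<rat> \<Longrightarrow> E q \<in> sets borel" "\<And>q x. q \<in> \<rat> \<Longrightarrow> x \<in> E q \<Longrightarrow> q \<le> g x"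
    and b: "\<And>q. q \<in> \<rat> \<Longrightarrow> b q \<in> sets M" "\<And>q. q \<in> \<rat> \<Longrightarrow> AE t in M. q < g (f t) \<longrightarrow> t \<in> b q"
    and lim: "\<And>q. q \<in> \<rat> \<Longrightarrow>
      (\<lambda>k. LINT t:A|M. mexp (\<kappa> k) (indicator (E q)) t) \<longlonglongrightarrow> measure M (A \<inter> b q)"
    and A: "A \<in> sets M" and e: "0 < e"
  shows "\<forall>\<^sub>F k in sequentially. (LINT t:A|M. trunc R (g (f t))) \<le> (LINT t:A|M. mexp (\<kappa> k) (\<lambda>x. trunc R (g x)) t) + e"
proof -
  \<comment> \<open>The mesh is so fine that rounding costs at most \<open>e / 2\<close> on
    \<open>A\<close>; the other half is spent on the convergence of finitely many masses.\<close>
  obtain m :: nat where m: "measure M A / (e / 2) < real m" using reals_Archimedean2 by blast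
  have m0: "0 < m" using m e by (metis divide_nonneg_pos half_gt_zero measure_nonneg not_gr_zero not_less of_nat_0)
  have me: "measure M A / real m < e / 2" using m m0 e by (simp add: field_simps)
  define q where "q j = - real R + real j / real m" for j
  have qQ: "q j \<in> \<rat>" for j by (simp add: q_def)
  define J where "J = {1..2 * R * m}"
  define u where "u = (\<lambda>x. - real R + (\<Sum>j\<in>J. indicator (E (q j)) x) / real m)"
  define v where "v = (\<lambda>t. - real R + (1 + (\<Sum>j\<in>J. indicator (b (q j)) t)) / real m)"
  have intc: "set_integrable M A (\<lambda>t. a)" for a :: real
    using A by (intro set_integrable_bounded[where a = "\<bar>a\<bar>"]) auto
  have intb: "set_integrable M A (indicator (b (q j)) :: _ \<Rightarrow> real)" for j
    using A b(1)[OF qQ] by (intro set_integrable_bounded[where a = 1]) (auto simp: indicator_def)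
  have intE: "set_integrable M A (mexp (\<kappa> k) (indicator (E (q j))))" for k j
    by (rule set_integrable_bounded[where a = 1])
      (use A E(1)[OF qQ] in \<open>auto intro!: mexp_measurable[OF \<kappa>] mexp_abs_le[OF \<kappa>] simp: indicator_def\<close>)
  have set_sum: "(LINT t:A|M. \<Sum>j\<in>J. h j t) = (\<Sum>j\<in>J. LINT t:A|M. h j t)"
    if "\<And>j. set_integrable M A (h j)" for h :: "nat \<Rightarrow> 'a \<Rightarrow> real"
    using that unfolding set_lebesgue_integral_def set_integrable_def
    by (simp add: sum_distrib_left Bochner_Integration.integral_sum)
  have sum_int: "set_integrable M A (\<lambda>t. \<Sum>j\<in>J. h j t)"
    if "\<And>j. set_integrable M A (h j)" for h :: "nat \<Rightarrow> 'a \<Rightarrow> real"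
    using that unfolding set_integrable_def by (simp add: sum_distrib_left)
  have affine: "(LINT t:A|M. a + (d + h t) / real m) = (a + d / real m) * measure M A + (LINT t:A|M. h t) / real m"
    if h: "set_integrable M A h" for a d and h :: "'a \<Rightarrow> real"
  proof -
    have "(LINT t:A|M. a + (d + h t) / real m) = (LINT t:A|M. (a + d / real m) + h t / real m)"
      by (simp add: add_divide_distrib add.assoc)
    also have "\<dots> = (LINT t:A|M. a + d / real m) + (LINT t:A|M. h t / real m)"
      by (intro set_integral_add intc set_integrable_divide) (use h in auto)
    finally show ?thesis by (simp only: set_integral_const_real[OF A] set_integral_divide_zero)
  qed
  have affine_int: "set_integrable M A (\<lambda>t. a + (d + h t) / real m)"
    if h: "set_integrable M A h" for a d and h :: "'a \<Rightarrow> real"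
  proof -
    have "set_integrable M A (\<lambda>t. (a + d / real m) + h t / real m)"
      by (intro set_integral_add intc set_integrable_divide) (use h in auto)
    then show ?thesis by (simp add: add_divide_distrib add.assoc)
  qed
  have "AE t in M. \<forall>j\<in>J. q j < g (f t) \<longrightarrow> t \<in> b (q j)"
    using b(2)[OF qQ] by (simp add: AE_ball_countable countable_finite J_def)
  then have "AE t in M. trunc R (g (f t)) \<le> v t"
  proof eventually_elim
    case (elim t)
    have "(\<Sum>j\<in>J. of_bool (q j < g (f t)) :: real) \<le> (\<Sum>j\<in>J. indicator (b (q j)) t)"
      using elim by (intro sum_mono) (auto simp: indicator_def)
    then have "(1 + (\<Sum>j\<in>J. of_bool (q j < g (f t)))) / real m \<le> (1 + (\<Sum>j\<in>J. indicator (b (q j)) t)) / real m"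
      by (intro divide_right_mono) auto
    then show ?case using trunc_le_grid[OF m0, of R "g (f t)"] by (simp add: v_def q_def J_def)
  qed
  then have "(LINT t:A|M. trunc R (g (f t))) \<le> (LINT t:A|M. v t)"
  proof (intro set_integral_mono_AE)
    show "set_integrable M A (\<lambda>t. trunc R (g (f t)))"
      using g(2) A by (intro set_integrable_bounded[where a = "real R"] abs_trunc_le) measurable
    show "set_integrable M A v" unfolding v_def by (intro affine_int sum_int intb)
  qed auto
  also have "\<dots> = (- real R + 1 / real m) * measure M A + (\<Sum>j\<in>J. measure M (A \<inter> b (q j))) / real m"
  proof -
    have "(LINT t:A|M. indicator (b (q j)) t) = measure M (A \<inter> b (q j))" for j
      unfolding set_lebesgue_integral_def using A b(1)[OF qQ]
      by (simp add: indicator_inter_arith[symmetric])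
    then show ?thesis unfolding v_def
      using affine[OF sum_int[of "\<lambda>j. indicator (b (q j))", OF intb], of "- real R" 1] set_sum[of "\<lambda>j. indicator (b (q j))", OF intb]
      by simp
  qed
  also have "\<dots> \<le> (- real R * measure M A + (\<Sum>j\<in>J. measure M (A \<inter> b (q j))) / real m) + e / 2"
    using me by (simp add: algebra_simps)
  finally have upper: "(LINT t:A|M. trunc R (g (f t))) \<le>
    (- real R * measure M A + (\<Sum>j\<in>J. measure M (A \<inter> b (q j))) / real m) + e / 2" .
  have lower: "- real R * measure M A + (\<Sum>j\<in>J. LINT t:A|M. mexp (\<kappa> k) (indicator (E (q j))) t) / real m
      \<le> (LINT t:A|M. mexp (\<kappa> k) (\<lambda>x. trunc R (g x)) t)" for k
  proof -
    have u_le: "u x \<le> trunc R (g x)" for x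
    proof -
      have "(\<Sum>j\<in>J. indicator (E (q j)) x :: real) \<le> (\<Sum>j\<in>J. of_bool (q j \<le> g x))"
        using E(2)[OF qQ] by (intro sum_mono) (auto simp: indicator_def)
      then have "(\<Sum>j\<in>J. indicator (E (q j)) x) / real m \<le> (\<Sum>j\<in>J. of_bool (q j \<le> g x)) / real m"
        by (intro divide_right_mono) auto
      then show ?thesis using grid_le_trunc[OF m0, of R "g x"] by (simp add: u_def q_def J_def)
    qed
    have mu: "mexp (\<kappa> k) u t = - real R + (0 + (\<Sum>j\<in>J. mexp (\<kappa> k) (indicator (E (q j))) t)) / real m" for t
    proof -
      have "mexp (\<kappa> k) u t = mexp (\<kappa> k) (\<lambda>x. - real R + (1 / real m) * (\<Sum>j\<in>J. indicator (E (q j)) x)) t"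
        by (simp add: u_def)
      also have "\<dots> = - real R + (1 / real m) * (\<Sum>j\<in>J. mexp (\<kappa> k) (indicator (E (q j))) t)"
        unfolding mexp_add mexp_cmult mexp_const[OF \<kappa>]
        using mexp_sum[of J "\<kappa> k" "\<lambda>j. indicator (E (q j))" t] by (simp add: J_def)
      finally show ?thesis by simp
    qed
    have "- real R * measure M A + (\<Sum>j\<in>J. LINT t:A|M. mexp (\<kappa> k) (indicator (E (q j))) t) / real m
      = (LINT t:A|M. mexp (\<kappa> k) u t)"
      unfolding mu
      using affine[OF sum_int[of "\<lambda>j. mexp (\<kappa> k) (indicator (E (q j)))", OF intE], of "- real R" 0]
        set_sum[of "\<lambda>j. mexp (\<kappa> k) (indicator (E (q j)))", OF intE] by simp
    also have "\<dots> \<le> (LINT t:A|M. mexp (\<kappa> k) (\<lambda>x. trunc R (g x)) t)"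
    proof (rule set_integral_mono)
      show "set_integrable M A (mexp (\<kappa> k) u)"
        unfolding mu by (intro affine_int sum_int intE)
      have "(\<lambda>x. trunc R (g x)) \<in> borel_measurable borel" using g(1) by measurable
      then show "set_integrable M A (mexp (\<kappa> k) (\<lambda>x. trunc R (g x)))"
        using A by (intro set_integrable_bounded[where a = "real R"] mexp_abs_le[OF \<kappa>] abs_trunc_le mexp_measurable[OF \<kappa>])
    qed (rule mexp_mono[OF \<kappa> u_le])
    finally show ?thesis .
  qed
  have "(\<lambda>k. - real R * measure M A + (\<Sum>j\<in>J. LINT t:A|M. mexp (\<kappa> k) (indicator (E (q j))) t) / real m)
    \<longlonglongrightarrow> - real R * measure M A + (\<Sum>j\<in>J. measure M (A \<inter> b (q j))) / real m"
    using m0 by (intro tendsto_intros lim qQ) auto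
  then have "\<forall>\<^sub>F k in sequentially. - real R * measure M A + (\<Sum>j\<in>J. measure M (A \<inter> b (q j))) / real m - e / 2
    < - real R * measure M A + (\<Sum>j\<in>J. LINT t:A|M. mexp (\<kappa> k) (indicator (E (q j))) t) / real m"
    by (rule order_tendstoD(1)) (use e in simp)
  then show ?thesis
  proof eventually_elim
    case (elim k)
    then show ?case using upper lower[of k] by linarith
  qed
qed

locale complete_nowhere_equivalent = nowhere_equivalent_subalgebra + complete_measure M +
  assumes cg: "countably_generated F"
begin

text \<open>The bits are the conditions \<open>\<psi> i x < q\<close> and
  \<open>norm x \<le> q\<close> with rational \<open>q\<close>, enumerated through pairs of an
  optional index and a rational. Halfspaces have weakly closed covers on both sides and give limits;
  balls have one on the inner side only and give the semicontinuity of the norm.\<close>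

lemma ex_limit_selection_trunc:
  fixes \<kappa> :: "nat \<Rightarrow> ('a, 'x::{banach, second_countable_topology}) mix"
  assumes \<psi>: "norming \<psi>"
    and \<kappa>: "\<And>n. mixture M (\<Phi> n) (\<kappa> n)" and meas: "\<And>n. measurable_correspondence F (\<Phi> n)"
    and comp: "AE t in M. compactin weak_topology (\<Phi>' t)"
    and uhc: "AE t in M. \<forall>V. openin weak_topology V \<and> \<Phi>' t \<subseteq> V \<longrightarrow> (\<forall>\<^sub>F n in sequentially. \<Phi> n t \<subseteq> V)"
  shows "\<exists>r f. strict_mono r \<and> f \<in> borel_measurable M \<and> (AE t in M. f t \<in> \<Phi>' t) \<and>
    (\<forall>i R. \<forall>A\<in>sets F. (\<lambda>k. LINT t:A|M. mexp (\<kappa> (r k)) (\<lambda>x. trunc R (\<psi> i x)) t)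
      \<longlonglongrightarrow> (LINT t:A|M. trunc R (\<psi> i (f t)))) \<and>
    (\<forall>R e. \<forall>A\<in>sets F. 0 < e \<longrightarrow> (\<forall>\<^sub>F k in sequentially.
      (LINT t:A|M. trunc R (norm (f t))) \<le> (LINT t:A|M. mexp (\<kappa> (r k)) (\<lambda>x. trunc R (norm x)) t) + e))"
proof -
  define W where "W j = (case from_nat j of (Some i, q) \<Rightarrow> {x. \<psi> i x < of_rat q}
    | (None, q) \<Rightarrow> {x. norm x \<le> of_rat q})" for j
  define V1 where "V1 j = (case from_nat j of (Some i, q) \<Rightarrow> {x. \<psi> i x \<le> of_rat q}
    | (None, q) \<Rightarrow> {x. norm x \<le> of_rat q})" for j
  \<comment> \<open>The complement of a ball can be weakly dense, so nothing better than the whole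
    space is claimed for it.\<close>
  define V0 where "V0 j = (case from_nat j of (Some i, q) \<Rightarrow> {x. of_rat q \<le> \<psi> i x} | (None, q) \<Rightarrow> UNIV)" for j
  have opn: "open {x. \<psi> i x < q}" for i q
    by (intro open_Collect_less continuous_intros linear_continuous_on blinfun.bounded_linear_right)
  have cl: "closed {x::'x. norm x \<le> q}" "closed {x. q \<le> \<psi> i x}" for i q
    by (intro closed_Collect_le continuous_intros linear_continuous_on blinfun.bounded_linear_right)+
  have neg: "- {x. \<psi> i x < q} = {x. q \<le> \<psi> i x}" for i q by auto
  have fs: "fsigma_in euclidean {x. \<psi> i x < q}" "fsigma_in euclidean {x. q \<le> \<psi> i x}"
    "fsigma_in euclidean {x::'x. norm x \<le> q}" "fsigma_in euclidean (- {x::'x. norm x \<le> q})" for i q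
    by (rule open_fsigma[OF opn])
      (use cl in \<open>auto intro: open_fsigma closed_imp_fsigma_in\<close>)
  have "\<exists>r f B. strict_mono r \<and> (\<forall>j::nat. B j \<in> sets M) \<and>
    (AE t in M. f t \<in> \<Phi>' t \<and> (\<forall>j. f t \<in> (if t \<in> B j then V1 j else V0 j))) \<and>
    (\<forall>j. \<forall>A\<in>sets F. (\<lambda>k. LINT t:A|M. mexp (\<kappa> (r k)) (indicator (W j)) t) \<longlonglongrightarrow> measure M (A \<inter> B j))"
  proof (rule ex_limit_selection_bits[OF cg \<kappa> meas _ _ _ _ _ _ comp uhc])
    fix j
    show "fsigma_in euclidean (W j)" "fsigma_in euclidean (- W j)"
      using fs by (auto simp: W_def neg split: prod.split option.split)
    show "closedin weak_topology (V1 j)" "closedin weak_topology (V0 j)"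
      using closedin_topspace[of "weak_topology :: 'x topology"]
      by (auto simp: V1_def V0_def closedin_weak_halfspace closedin_weak_cball topspace_weak_topology
          split: prod.split option.split)
    show "W j \<subseteq> V1 j" "- W j \<subseteq> V0 j"
      by (auto simp: W_def V1_def V0_def split: prod.split option.split)
  qed
  then obtain r f B where r: "strict_mono r" and BM: "\<And>j::nat. B j \<in> sets M"
    and f: "AE t in M. f t \<in> \<Phi>' t \<and> (\<forall>j. f t \<in> (if t \<in> B j then V1 j else V0 j))"
    and lim: "\<And>j A. A \<in> sets F \<Longrightarrow>
      (\<lambda>k. LINT t:A|M. mexp (\<kappa> (r k)) (indicator (W j)) t) \<longlonglongrightarrow> measure M (A \<inter> B j)"
    by blast
  define H where "H i q = B (to_nat (Some i :: nat option, q :: rat))" for i q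
  define N where "N q = B (to_nat (None :: nat option, q :: rat))" for q
  have HM: "H i q \<in> sets M" "N q \<in> sets M" for i q using BM by (auto simp: H_def N_def)
  have fH: "AE t in M. \<forall>i q. if t \<in> H i q then \<psi> i (f t) \<le> of_rat q else of_rat q \<le> \<psi> i (f t)"
    using f
  proof eventually_elim
    case (elim t)
    have "f t \<in> (if t \<in> H i q then V1 (to_nat (Some i, q)) else V0 (to_nat (Some i, q)))" for i q
      using elim unfolding H_def by blast
    moreover have "V1 (to_nat (Some i, q)) = {x. \<psi> i x \<le> of_rat q}"
      "V0 (to_nat (Some i, q)) = {x. of_rat q \<le> \<psi> i x}" for i q
      by (simp_all add: V1_def V0_def)
    ultimately have "f t \<in> (if t \<in> H i q then {x. \<psi> i x \<le> of_rat q} else {x. of_rat q \<le> \<psi> i x})" for i q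
      by metis
    then show ?case by (metis mem_Collect_eq)
  qed
  have fN: "AE t in M. \<forall>q. t \<in> N q \<longrightarrow> norm (f t) \<le> of_rat q"
    using f
  proof eventually_elim
    case (elim t)
    have "f t \<in> (if t \<in> N q then V1 (to_nat (None :: nat option, q)) else V0 (to_nat (None :: nat option, q)))" for q
      using elim unfolding N_def by blast
    moreover have "V1 (to_nat (None :: nat option, q)) = {x. norm x \<le> of_rat q}" for q
      by (simp add: V1_def)
    ultimately show ?case by (metis mem_Collect_eq)
  qed
  have limH: "(\<lambda>k. LINT t:A|M. mexp (\<kappa> (r k)) (indicator {x. \<psi> i x < of_rat q}) t) \<longlonglongrightarrow> measure M (A \<inter> H i q)"
    if "A \<in> sets F" for A i q
    using lim[OF that, of "to_nat (Some i, q)"] by (simp add: W_def H_def)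
  have limN: "(\<lambda>k. LINT t:A|M. mexp (\<kappa> (r k)) (indicator {x. norm x \<le> of_rat q}) t) \<longlonglongrightarrow> measure M (A \<inter> N q)"
    if "A \<in> sets F" for A q
    using lim[OF that, of "to_nat (None :: nat option, q)"] by (simp add: W_def N_def)
  have bd: "\<bar>mexp (\<kappa> n) (indicator E) t\<bar> \<le> 1" for n E t
    by (rule mexp_abs_le[OF \<kappa>]) (auto simp: indicator_def)
  have int: "set_integrable M A (mexp (\<kappa> n) (indicator E))" if "A \<in> sets M" "E \<in> sets borel" for A n E
    using that(2) by (intro set_integrable_bounded[OF _ bd that(1)] mexp_measurable[OF \<kappa>]) auto
  have lim_compl: "(\<lambda>k. LINT t:A|M. mexp (\<kappa> (r k)) (indicator (- E)) t) \<longlonglongrightarrow> measure M (A \<inter> (space M - D))"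
    if A: "A \<in> sets F" and D: "D \<in> sets M" and E: "E \<in> sets borel"
      and l: "(\<lambda>k. LINT t:A|M. mexp (\<kappa> (r k)) (indicator E) t) \<longlonglongrightarrow> measure M (A \<inter> D)" for A D E
  proof -
    have AM: "A \<in> sets M" using A by (rule sets_subalg)
    have "(LINT t:A|M. mexp (\<kappa> n) (indicator (- E)) t) = measure M A - (LINT t:A|M. mexp (\<kappa> n) (indicator E) t)" for n
    proof -
      have "(\<lambda>x. indicator E x + indicator (- E) x) = (\<lambda>_. 1 :: real)" by (auto simp: indicator_def)
      then have "mexp (\<kappa> n) (indicator E) t + mexp (\<kappa> n) (indicator (- E)) t = 1" for t
        using mexp_add[of "\<kappa> n" "indicator E" "indicator (- E)" t] mexp_const[OF \<kappa>] by simp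
      then have "(LINT t:A|M. mexp (\<kappa> n) (indicator E) t + mexp (\<kappa> n) (indicator (- E)) t) = measure M A"
        using set_integral_const_real[OF AM, of 1] by simp
      then show ?thesis using set_integral_add(2)[OF int[OF AM E] int[OF AM, of "- E"]] E by simp
    qed
    moreover have "measure M (A \<inter> (space M - D)) = measure M A - measure M (A \<inter> D)"
    proof -
      have "A \<inter> (space M - D) = A - (A \<inter> D)" using sets.sets_into_space[OF AM] by auto
      then show ?thesis using AM D by (simp add: finite_measure_Diff)
    qed
    ultimately show ?thesis using l by (auto intro!: tendsto_intros)
  qed
  have fm: "f \<in> borel_measurable M"
  proof (rule borel_measurable_norming[OF \<psi>])
    fix i
    show "(\<lambda>t. \<psi> i (f t)) \<in> borel_measurable M"
      unfolding borel_measurable_iff_less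
    proof (intro allI)
      fix a :: real
      \<comment> \<open>If \<open>\<psi> i (f t) < a\<close>, a rational \<open>q\<close> strictly
        between the two values forces the bit of \<open>q\<close> to be \<open>True\<close>. So the
        level set equals a countable union of realised bits up to a null set, and completeness makes
        it measurable.\<close>
      have "AE t in M. t \<in> space M \<inter> (\<Union>q\<in>{q. of_rat q < a}. H i q) \<longleftrightarrow> t \<in> {t \<in> space M. \<psi> i (f t) < a}"
        using fH AE_space
      proof eventually_elim
        case (elim t)
        note q = elim(1)[rule_format, of i]
        have "\<exists>q. of_rat q < a \<and> t \<in> H i q" if l: "\<psi> i (f t) < a"
        proof -
          obtain q where "\<psi> i (f t) < of_rat q" "of_rat q < a" using of_rat_dense[OF l] by blast
          then show ?thesis using q[of q] by (metis not_le)
        qed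
        moreover have "\<psi> i (f t) < a" if "of_rat q < a" "t \<in> H i q" for q
          using that q[of q] by simp
        ultimately show ?case using elim(2) by blast
      qed
      then show "{t \<in> space M. \<psi> i (f t) < a} \<in> sets M"
        by (rule in_sets_AE) (use HM in \<open>auto intro!: sets.countable_UN'\<close>)
    qed
  qed
  have bl: "(\<lambda>x. \<psi> i x) \<in> borel_measurable borel" for i
    by (intro borel_measurable_continuous_onI linear_continuous_on blinfun.bounded_linear_right)
  have \<psi>f: "(\<lambda>t. \<psi> i (f t)) \<in> borel_measurable M" for i
    by (rule measurable_compose[OF fm bl])
  have nf: "(\<lambda>t. norm (f t)) \<in> borel_measurable M" using fm by measurable
  have \<kappa>r: "mixture M (\<Phi> (r k)) (\<kappa> (r k))" for k by (rule \<kappa>)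
  have upper: "\<forall>\<^sub>F k in sequentially. (LINT t:A|M. trunc R (\<psi> i (f t)))
      \<le> (LINT t:A|M. mexp (\<kappa> (r k)) (\<lambda>x. trunc R (\<psi> i x)) t) + e"
    if A: "A \<in> sets F" and e: "0 < e" for A R i e
  proof (rule limit_trunc_le[OF \<kappa>r bl \<psi>f _ _ _ _ _ sets_subalg[OF A] e])
    fix q :: real assume "q \<in> \<rat>"
    then obtain q' where q: "q = of_rat q'" by (auto elim: Rats_cases)
    \<comment> \<open>The family of levels is indexed by those reals that are rational; the
      description recovers the index of the bit.\<close>
    let ?q = "\<lambda>q. THE q'. (q::real) = of_rat q'"
    have q': "?q q = q'" using q by (auto intro!: the_equality)
    show "(- {x. \<psi> i x < q}) \<in> sets borel" using opn by auto
    show "x \<in> - {x. \<psi> i x < q} \<Longrightarrow> q \<le> \<psi> i x" for x by auto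
    show "space M - H i (?q q) \<in> sets M" using HM by auto
    show "AE t in M. q < \<psi> i (f t) \<longrightarrow> t \<in> space M - H i (?q q)"
      using fH AE_space
    proof eventually_elim
      case (elim t)
      show ?case using elim(1)[rule_format, of i q'] elim(2) by (auto simp: q' q split: if_splits)
    qed
    show "(\<lambda>k. LINT t:A|M. mexp (\<kappa> (r k)) (indicator (- {x. \<psi> i x < q})) t)
      \<longlonglongrightarrow> measure M (A \<inter> (space M - H i (?q q)))"
      unfolding q' unfolding q by (intro lim_compl A HM limH) (use opn in auto)
  qed
  \<comment> \<open>The reverse inequality is the same one-sided estimate for
    \<open>- \<psi> i\<close>; now the open halfspaces are the upper level sets.\<close>
  have lower: "\<forall>\<^sub>F k in sequentially. (LINT t:A|M. trunc R (- \<psi> i (f t)))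
      \<le> (LINT t:A|M. mexp (\<kappa> (r k)) (\<lambda>x. trunc R (- \<psi> i x)) t) + e"
    if A: "A \<in> sets F" and e: "0 < e" for A R i e
  proof (rule limit_trunc_le[OF \<kappa>r _ _ _ _ _ _ _ sets_subalg[OF A] e])
    show "(\<lambda>x. - \<psi> i x) \<in> borel_measurable borel" "(\<lambda>t. - \<psi> i (f t)) \<in> borel_measurable M"
      using bl \<psi>f by auto
    fix q :: real assume "q \<in> \<rat>"
    then obtain q' where q: "q = of_rat q'" by (auto elim: Rats_cases)
    let ?q = "\<lambda>q. THE q'. (q::real) = of_rat q'"
    have q': "?q q = q'" using q by (auto intro!: the_equality)
    show "{x. \<psi> i x < - q} \<in> sets borel" using opn by auto
    show "x \<in> {x. \<psi> i x < - q} \<Longrightarrow> q \<le> - \<psi> i x" for x by auto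
    show "H i (- ?q q) \<in> sets M" using HM by auto
    show "AE t in M. q < - \<psi> i (f t) \<longrightarrow> t \<in> H i (- ?q q)"
      using fH
    proof eventually_elim
      case (elim t)
      show ?case using elim[rule_format, of i "- q'"] by (auto simp: q' q of_rat_minus split: if_splits)
    qed
    show "(\<lambda>k. LINT t:A|M. mexp (\<kappa> (r k)) (indicator {x. \<psi> i x < - q}) t) \<longlonglongrightarrow> measure M (A \<inter> H i (- ?q q))"
      unfolding q' unfolding q using limH[OF A, of i "- q'"] by (simp add: of_rat_minus)
  qed
  have norm_le: "\<forall>\<^sub>F k in sequentially. (LINT t:A|M. trunc R (norm (f t)))
      \<le> (LINT t:A|M. mexp (\<kappa> (r k)) (\<lambda>x. trunc R (norm x)) t) + e"
    if A: "A \<in> sets F" and e: "0 < e" for A R e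
  proof (rule limit_trunc_le[OF \<kappa>r _ nf _ _ _ _ _ sets_subalg[OF A] e])
    show "norm \<in> borel_measurable (borel :: 'x measure)" by measurable
    fix q :: real assume "q \<in> \<rat>"
    then obtain q' where q: "q = of_rat q'" by (auto elim: Rats_cases)
    let ?q = "\<lambda>q. THE q'. (q::real) = of_rat q'"
    have q': "?q q = q'" using q by (auto intro!: the_equality)
    show "(- {x::'x. norm x \<le> q}) \<in> sets borel" using cl by auto
    show "x \<in> - {x::'x. norm x \<le> q} \<Longrightarrow> q \<le> norm x" for x by auto
    show "space M - N (?q q) \<in> sets M" using HM by auto
    show "AE t in M. q < norm (f t) \<longrightarrow> t \<in> space M - N (?q q)"
      using fN AE_space
    proof eventually_elim
      case (elim t)
      show ?case using elim(1)[rule_format, of q'] elim(2) by (auto simp: q' q)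
    qed
    show "(\<lambda>k. LINT t:A|M. mexp (\<kappa> (r k)) (indicator (- {x. norm x \<le> q})) t)
      \<longlonglongrightarrow> measure M (A \<inter> (space M - N (?q q)))"
      unfolding q' unfolding q by (intro lim_compl A HM limN) (use cl in auto)
  qed
  have two_sided: "(\<lambda>k. LINT t:A|M. mexp (\<kappa> (r k)) (\<lambda>x. trunc R (\<psi> i x)) t) \<longlonglongrightarrow> (LINT t:A|M. trunc R (\<psi> i (f t)))"
    if A: "A \<in> sets F" for A R i
  proof (rule tendstoI)
    fix e :: real assume "0 < e"
    then have "0 < e / 2" by simp
    have neg1: "(LINT t:A|M. trunc R (- \<psi> i (f t))) = - (LINT t:A|M. trunc R (\<psi> i (f t)))"
      by (simp add: trunc_minus set_lebesgue_integral_def)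
    have neg2: "(LINT t:A|M. mexp (\<kappa> n) (\<lambda>x. trunc R (- \<psi> i x)) t) = - (LINT t:A|M. mexp (\<kappa> n) (\<lambda>x. trunc R (\<psi> i x)) t)" for n
      using mexp_cmult[of "\<kappa> n" "-1" "\<lambda>x. trunc R (\<psi> i x)"] by (simp add: trunc_minus set_lebesgue_integral_def)
    show "\<forall>\<^sub>F k in sequentially. dist (LINT t:A|M. mexp (\<kappa> (r k)) (\<lambda>x. trunc R (\<psi> i x)) t)
        (LINT t:A|M. trunc R (\<psi> i (f t))) < e"
      using upper[OF A \<open>0 < e / 2\<close>, of R i] lower[OF A \<open>0 < e / 2\<close>, of R i]
    proof eventually_elim
      case (elim k)
      then show ?case using \<open>0 < e\<close> unfolding neg1 neg2 dist_real_def by linarith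
    qed
  qed
  have "AE t in M. f t \<in> \<Phi>' t" using f by eventually_elim simp
  then show ?thesis using r fm two_sided norm_le by blast
qed

end

section \<open>Limits of dominated mixtures\<close>

lemma tendsto_subseq_criterion:
  fixes X :: "nat \<Rightarrow> 'b::metric_space"
  assumes "\<And>s. strict_mono (s :: nat \<Rightarrow> nat) \<Longrightarrow> \<exists>r. strict_mono (r :: nat \<Rightarrow> nat) \<and> (\<lambda>k. X (s (r k))) \<longlonglongrightarrow> L"
  shows "X \<longlonglongrightarrow> L"
proof (rule ccontr)
  assume "\<not> X \<longlonglongrightarrow> L"
  then obtain e where e: "0 < e" "\<not> (\<forall>\<^sub>F n in sequentially. dist (X n) L < e)"
    unfolding tendsto_iff by blast
  define I where "I = {n. \<not> dist (X n) L < e}"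
  have "infinite I"
    using e(2) unfolding eventually_cofinite[symmetric] cofinite_eq_sequentially[symmetric] I_def
    by (simp add: eventually_cofinite)
  then have s: "strict_mono (enumerate I)" "\<And>n. enumerate I n \<in> I"
    by (auto simp: strict_mono_enumerate enumerate_in_set)
  obtain r :: "nat \<Rightarrow> nat" where "(\<lambda>k. X (enumerate I (r k))) \<longlonglongrightarrow> L" using assms[OF s(1)] by blast
  from tendstoD[OF this e(1)] obtain k where "dist (X (enumerate I (r k))) L < e"
    using eventually_happens by force
  then show False using s(2)[of "r k"] by (simp add: I_def)
qed

lemma trunc_of_nonneg: "0 \<le> y \<Longrightarrow> trunc R y = min (real R) y"
  by (auto simp: trunc_def)

lemma norming_insert:
  assumes "norming \<psi>"
  shows "norming (case_nat \<xi> \<psi>)"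
  unfolding norming_def
proof (intro allI impI)
  fix x e assume "0 < (e::real)"
  then obtain i where "norm (\<psi> i) \<le> 1 \<and> norm x - e < \<psi> i x" using assms unfolding norming_def by blast
  then show "\<exists>i. norm (case_nat \<xi> \<psi> i) \<le> 1 \<and> norm x - e < case_nat \<xi> \<psi> i x" by (intro exI[of _ "Suc i"]) simp
qed

lemma borel_measurable_blinfun:
  fixes \<xi> :: "'x::real_normed_vector \<Rightarrow>\<^sub>L real"
  shows "blinfun_apply \<xi> \<in> borel_measurable borel"
  by (intro borel_measurable_continuous_onI linear_continuous_on blinfun.bounded_linear_right)

text \<open>The tail of the dominating function bounds the error of clamping at \<open>R\<close>,
  for all mixtures at once.\<close>

lemma integral_max_tail_LIMSEQ:
  fixes h :: "'a \<Rightarrow> real"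
  assumes "integrable M h"
  shows "(\<lambda>R. \<integral>t. max (h t - real R) 0 \<partial>M) \<longlonglongrightarrow> 0"
proof -
  have "(\<lambda>R. \<integral>t. max (h t - real R) 0 \<partial>M) \<longlonglongrightarrow> (\<integral>t. 0 \<partial>M)"
  proof (rule integral_dominated_convergence[where w = "\<lambda>t. \<bar>h t\<bar>"])
    show "AE t in M. (\<lambda>R. max (h t - real R) 0) \<longlonglongrightarrow> 0"
    proof (rule AE_I2, rule tendsto_eventually)
      fix t
      obtain R0 :: nat where "h t < real R0" using reals_Archimedean2 by blast
      then show "\<forall>\<^sub>F R in sequentially. max (h t - real R) 0 = 0"
        by (intro eventually_sequentiallyI[of R0]) (auto simp: max_def)
    qed
  qed (use assms in auto)
  then show ?thesis by simp
qed

context finite_measure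
begin

text \<open>Both estimates are made on the support, where \<open>\<xi> x\<close> is bounded by
  \<open>norm \<xi> * h t\<close>; they are independent of the mixture.\<close>

lemma mexp_integrable:
  fixes \<xi> :: "'x::real_normed_vector \<Rightarrow>\<^sub>L real"
  assumes \<kappa>: "mixture M \<Phi> \<kappa>" and h: "integrable M h" "AE t in M. \<forall>x\<in>\<Phi> t. norm x \<le> h t"
  shows "integrable M (mexp \<kappa> \<xi>)"
    and "AE t in M. \<bar>mexp \<kappa> \<xi> t - mexp \<kappa> (\<lambda>x. trunc R (\<xi> x)) t\<bar> \<le> max (norm \<xi> * h t - real R) 0"
proof -
  have le: "\<bar>\<xi> x\<bar> \<le> norm \<xi> * a" if "norm x \<le> a" for x a
    using norm_blinfun[of \<xi> x] mult_left_mono[OF that norm_ge_zero[of \<xi>]] by simp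
  have "AE t in M. \<forall>x\<in>\<Phi> t. \<xi> x \<le> norm \<xi> * h t" "AE t in M. \<forall>x\<in>\<Phi> t. - (norm \<xi> * h t) \<le> \<xi> x"
    using h(2) le by (auto simp: abs_le_iff minus_le_iff elim!: eventually_mono)
  from mexp_mono_support[OF \<kappa> this(1)] mexp_mono_support[OF \<kappa> this(2)]
  have "AE t in M. norm (mexp \<kappa> \<xi> t) \<le> norm \<xi> * h t"
    by eventually_elim (simp add: mexp_const[OF \<kappa>] abs_le_iff)
  then show "integrable M (mexp \<kappa> \<xi>)"
    by (intro Bochner_Integration.integrable_bound[OF integrable_mult_right[OF h(1), of "norm \<xi>"]]
        mexp_measurable[OF \<kappa>] borel_measurable_blinfun) (auto elim!: eventually_mono)
  have "AE t in M. \<forall>x\<in>\<Phi> t. \<bar>\<xi> x - trunc R (\<xi> x)\<bar> \<le> max (norm \<xi> * h t - real R) 0"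
    using h(2)
  proof eventually_elim
    case (elim t)
    show ?case
    proof
      fix x assume "x \<in> \<Phi> t"
      then have "\<bar>\<xi> x\<bar> \<le> norm \<xi> * h t" using le elim by blast
      then show "\<bar>\<xi> x - trunc R (\<xi> x)\<bar> \<le> max (norm \<xi> * h t - real R) 0"
        using trunc_error[of "\<xi> x" R] by simp
    qed
  qed
  then have "AE t in M. \<forall>x\<in>\<Phi> t. \<xi> x - trunc R (\<xi> x) \<le> max (norm \<xi> * h t - real R) 0"
    "AE t in M. \<forall>x\<in>\<Phi> t. - max (norm \<xi> * h t - real R) 0 \<le> \<xi> x - trunc R (\<xi> x)"
    by (auto simp only: abs_le_iff minus_le_iff elim!: eventually_mono)
  from mexp_mono_support[OF \<kappa> this(1)] mexp_mono_support[OF \<kappa> this(2)]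
  show "AE t in M. \<bar>mexp \<kappa> \<xi> t - mexp \<kappa> (\<lambda>x. trunc R (\<xi> x)) t\<bar> \<le> max (norm \<xi> * h t - real R) 0"
  proof eventually_elim
    case (elim t)
    have "mexp \<kappa> (\<lambda>x. \<xi> x - trunc R (\<xi> x)) t = mexp \<kappa> \<xi> t - mexp \<kappa> (\<lambda>x. trunc R (\<xi> x)) t"
      using mexp_add[of \<kappa> \<xi> "\<lambda>x. -1 * trunc R (\<xi> x)" t] mexp_cmult[of \<kappa> "-1" "\<lambda>x. trunc R (\<xi> x)" t] by simp
    then show ?case using elim by (simp add: mexp_const[OF \<kappa>] abs_le_iff)
  qed
qed

text \<open>Clamping can be removed because its error is the same tail of
  \<open>norm \<xi> * h\<close> for all mixtures and for the limit: each of the two errors and the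
  convergence itself gets a third of \<open>e\<close>.\<close>

lemma mexp_dominated_limit:
  fixes \<xi> :: "'x::{banach, second_countable_topology} \<Rightarrow>\<^sub>L real"
  assumes \<kappa>: "\<And>k. mixture M (\<Phi> k) (\<kappa> k)" and A: "A \<in> sets M"
    and h: "integrable M h" "\<And>k. AE t in M. \<forall>x\<in>\<Phi> k t. norm x \<le> h t"
    and f: "f \<in> borel_measurable M" "AE t in M. norm (f t) \<le> h t"
    and lim: "\<And>R. (\<lambda>k. LINT t:A|M. mexp (\<kappa> k) (\<lambda>x. trunc R (\<xi> x)) t) \<longlonglongrightarrow> (LINT t:A|M. trunc R (\<xi> (f t)))"
  shows "(\<lambda>k. LINT t:A|M. mexp (\<kappa> k) \<xi> t) \<longlonglongrightarrow> (LINT t:A|M. \<xi> (f t))"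
proof (rule tendstoI)
  fix e :: real assume e: "0 < e"
  define \<tau> where "\<tau> R = (\<integral>t. max (norm \<xi> * h t - real R) 0 \<partial>M)" for R
  have h\<xi>: "integrable M (\<lambda>t. norm \<xi> * h t)" using h(1) by simp
  have "\<tau> \<longlonglongrightarrow> 0" unfolding \<tau>_def by (rule integral_max_tail_LIMSEQ[OF h\<xi>])
  then obtain R where R: "\<tau> R < e / 3"
    using order_tendstoD(2)[of \<tau> 0 sequentially "e / 3"] e by (auto simp: eventually_sequentially)
  have tau_int: "integrable M (\<lambda>t. max (norm \<xi> * h t - real R) 0)"
    using h\<xi> by (intro integrable_max) auto
  have fi: "integrable M f"
    by (rule Bochner_Integration.integrable_bound[OF h(1) f(1)]) (use f(2) in \<open>auto elim!: eventually_mono\<close>)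
  have err: "\<bar>(LINT t:A|M. u t) - (LINT t:A|M. v t)\<bar> \<le> \<tau> R"
    if uv: "integrable M u" "integrable M v" "AE t in M. \<bar>u t - v t\<bar> \<le> max (norm \<xi> * h t - real R) 0"
    for u v :: "'a \<Rightarrow> real"
  proof -
    have "(LINT t:A|M. u t) - (LINT t:A|M. v t) = (LINT t:A|M. u t - v t)"
      using integrable_mult_indicator[OF A uv(1)] integrable_mult_indicator[OF A uv(2)]
      by (intro set_integral_diff(2)[symmetric]) (simp_all only: set_integrable_def)
    also have "\<bar>\<dots>\<bar> \<le> (\<integral>t. \<bar>indicator A t *\<^sub>R (u t - v t)\<bar> \<partial>M)"
      unfolding set_lebesgue_integral_def by (rule integral_abs_bound)
    also have "\<dots> \<le> \<tau> R" unfolding \<tau>_def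
    proof (rule integral_mono_AE[OF _ tau_int])
      show "integrable M (\<lambda>t. \<bar>indicator A t *\<^sub>R (u t - v t)\<bar>)"
        using uv A by (intro integrable_abs integrable_mult_indicator) auto
      show "AE t in M. \<bar>indicator A t *\<^sub>R (u t - v t)\<bar> \<le> max (norm \<xi> * h t - real R) 0"
        using uv(3) by eventually_elim (auto simp: indicator_def)
    qed
    finally show ?thesis .
  qed
  have e1: "\<bar>(LINT t:A|M. mexp (\<kappa> k) \<xi> t) - (LINT t:A|M. mexp (\<kappa> k) (\<lambda>x. trunc R (\<xi> x)) t)\<bar> \<le> \<tau> R" for k
  proof (rule err)
    have "(\<lambda>x. trunc R (\<xi> x)) \<in> borel_measurable borel"
      by (rule measurable_compose[OF borel_measurable_blinfun trunc_measurable])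
    then show "integrable M (mexp (\<kappa> k) (\<lambda>x. trunc R (\<xi> x)))"
      by (intro integrable_const_bound[where B = "real R"] mexp_measurable[OF \<kappa>])
        (auto intro: mexp_abs_le[OF \<kappa>] abs_trunc_le)
  qed (use mexp_integrable[OF \<kappa> h(1) h(2)] in auto)
  have e2: "\<bar>(LINT t:A|M. \<xi> (f t)) - (LINT t:A|M. trunc R (\<xi> (f t)))\<bar> \<le> \<tau> R"
  proof (rule err)
    show "integrable M (\<lambda>t. \<xi> (f t))" by (rule integrable_blinfun[OF fi])
    then show "integrable M (\<lambda>t. trunc R (\<xi> (f t)))"
      by (intro integrable_const_bound[where B = "real R"]) (auto intro: abs_trunc_le)
    show "AE t in M. \<bar>\<xi> (f t) - trunc R (\<xi> (f t))\<bar> \<le> max (norm \<xi> * h t - real R) 0"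
      using f(2)
    proof eventually_elim
      case (elim t)
      then have "\<bar>\<xi> (f t)\<bar> \<le> norm \<xi> * h t"
        using norm_blinfun[of \<xi> "f t"] mult_left_mono[OF elim norm_ge_zero[of \<xi>]] by simp
      then show ?case using trunc_error[of "\<xi> (f t)" R] by simp
    qed
  qed
  have "\<forall>\<^sub>F k in sequentially. dist (LINT t:A|M. mexp (\<kappa> k) (\<lambda>x. trunc R (\<xi> x)) t) (LINT t:A|M. trunc R (\<xi> (f t))) < e / 3"
    using tendstoD[OF lim, of "e / 3"] e by simp
  then show "\<forall>\<^sub>F k in sequentially. dist (LINT t:A|M. mexp (\<kappa> k) \<xi> t) (LINT t:A|M. \<xi> (f t)) < e"
  proof eventually_elim
    case (elim k)
    then show ?case using e1[of k] e2 R unfolding dist_real_def by linarith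
  qed
qed

end

context complete_nowhere_equivalent
begin

text \<open>Convergence against a functional outside of the norming sequence: every subsequence can be
  refined after adding this functional to the sequence, and the new limit selection has the same
  integrals over the sets of \<open>F\<close> as the old one.\<close>

lemma ex_limit_selection:
  fixes \<kappa> :: "nat \<Rightarrow> ('a, 'x::{banach, second_countable_topology}) mix"
  assumes \<kappa>: "\<And>n. mixture M (\<Phi> n) (\<kappa> n)" and meas: "\<And>n. measurable_correspondence F (\<Phi> n)"
    and comp: "AE t in M. compactin weak_topology (\<Phi>' t)"
    and uhc: "AE t in M. \<forall>V. openin weak_topology V \<and> \<Phi>' t \<subseteq> V \<longrightarrow> (\<forall>\<^sub>F n in sequentially. \<Phi> n t \<subseteq> V)"
    and h: "integrable M h" "\<And>n. AE t in M. \<forall>x\<in>\<Phi> n t. norm x \<le> h t" "AE t in M. \<forall>x\<in>\<Phi>' t. norm x \<le> h t"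
  shows "\<exists>r f. strict_mono r \<and> integrable M f \<and> (AE t in M. f t \<in> \<Phi>' t) \<and>
    (\<forall>\<xi>::'x \<Rightarrow>\<^sub>L real. \<forall>A\<in>sets F. (\<lambda>k. LINT t:A|M. mexp (\<kappa> (r k)) \<xi> t) \<longlonglongrightarrow> \<xi> (LINT t:A|M. f t))"
proof -
  obtain \<psi> :: "nat \<Rightarrow> ('x \<Rightarrow>\<^sub>L real)" where \<psi>: "norming \<psi>" using ex_norming by blast
  have step: "\<exists>r f. strict_mono r \<and> integrable M f \<and> (AE t in M. f t \<in> \<Phi>' t) \<and>
    (\<forall>i. \<forall>A\<in>sets F. (\<lambda>k. LINT t:A|M. mexp (\<kappa> (s (r k))) (\<theta> i) t) \<longlonglongrightarrow> \<theta> i (LINT t:A|M. f t))"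
    if s: "strict_mono s" and \<theta>: "norming \<theta>" for s :: "nat \<Rightarrow> nat" and \<theta> :: "nat \<Rightarrow> ('x \<Rightarrow>\<^sub>L real)"
  proof -
    have uhc_s: "AE t in M. \<forall>V. openin weak_topology V \<and> \<Phi>' t \<subseteq> V \<longrightarrow> (\<forall>\<^sub>F n in sequentially. \<Phi> (s n) t \<subseteq> V)"
      using uhc eventually_subseq[OF s] by (auto elim!: eventually_mono)
    obtain r f where r: "strict_mono r" and f: "f \<in> borel_measurable M" "AE t in M. f t \<in> \<Phi>' t"
      and lim: "\<And>i R A. A \<in> sets F \<Longrightarrow> (\<lambda>k. LINT t:A|M. mexp (\<kappa> (s (r k))) (\<lambda>x. trunc R (\<theta> i x)) t)
        \<longlonglongrightarrow> (LINT t:A|M. trunc R (\<theta> i (f t)))"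
      using ex_limit_selection_trunc[OF \<theta> \<kappa> meas comp uhc_s] by blast
    have fh: "AE t in M. norm (f t) \<le> h t" using f(2) h(3) by eventually_elim blast
    have fi: "integrable M f"
      by (rule Bochner_Integration.integrable_bound[OF h(1) f(1)]) (use fh in \<open>auto elim!: eventually_mono\<close>)
    have "(\<lambda>k. LINT t:A|M. mexp (\<kappa> (s (r k))) (\<theta> i) t) \<longlonglongrightarrow> \<theta> i (LINT t:A|M. f t)" if A: "A \<in> sets F" for i A
      unfolding set_integral_blinfun[OF fi sets_subalg[OF A], symmetric]
      by (rule mexp_dominated_limit[OF \<kappa> sets_subalg[OF A] h(1,2) f(1) fh lim[OF A]])
    then show ?thesis using r fi f(2) by blast
  qed
  obtain r f where r: "strict_mono r" and f: "integrable M f" "AE t in M. f t \<in> \<Phi>' t"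
    and lim: "\<And>i A. A \<in> sets F \<Longrightarrow> (\<lambda>k. LINT t:A|M. mexp (\<kappa> (r k)) (\<psi> i) t) \<longlonglongrightarrow> \<psi> i (LINT t:A|M. f t)"
    using step[OF strict_mono_id \<psi>] by auto
  have "(\<lambda>k. LINT t:A|M. mexp (\<kappa> (r k)) \<xi> t) \<longlonglongrightarrow> \<xi> (LINT t:A|M. f t)" if A: "A \<in> sets F"
    for \<xi> :: "'x \<Rightarrow>\<^sub>L real" and A
  proof (rule tendsto_subseq_criterion)
    fix s :: "nat \<Rightarrow> nat" assume s: "strict_mono s"
    have "strict_mono (\<lambda>k. r (s k))" using strict_mono_compose[OF r s] by (simp add: comp_def)
    from step[OF this norming_insert[OF \<psi>, of \<xi>]]
    obtain r' f' where r': "strict_mono r'" and f': "integrable M f'"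
      and lim': "\<And>i. (\<lambda>k. LINT t:A|M. mexp (\<kappa> (r (s (r' k)))) (case_nat \<xi> \<psi> i) t)
        \<longlonglongrightarrow> case_nat \<xi> \<psi> i (LINT t:A|M. f' t)"
      using A by blast
    have "(LINT t:A|M. f t) = (LINT t:A|M. f' t)"
    proof (rule norming_eqI[OF \<psi>])
      fix i
      have "strict_mono (\<lambda>k. s (r' k))" using strict_mono_compose[OF s r'] by (simp add: comp_def)
      from LIMSEQ_subseq_LIMSEQ[OF lim[OF A, of i] this]
      have "(\<lambda>k. LINT t:A|M. mexp (\<kappa> (r (s (r' k)))) (\<psi> i) t) \<longlonglongrightarrow> \<psi> i (LINT t:A|M. f t)"
        by (simp add: comp_def)
      then show "\<psi> i (LINT t:A|M. f t) = \<psi> i (LINT t:A|M. f' t)"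
        using lim'[of "Suc i"] LIMSEQ_unique by auto
    qed
    then show "\<exists>r'. strict_mono r' \<and> (\<lambda>k. LINT t:A|M. mexp (\<kappa> (r (s (r' k)))) \<xi> t) \<longlonglongrightarrow> \<xi> (LINT t:A|M. f t)"
      using r' lim'[of 0] by auto
  qed
  then show ?thesis using r f by blast
qed

section \<open>Convexity\<close>

text \<open>The constant sequence of the mixture that takes \<open>f\<close> with weight
  \<open>u\<close> and \<open>g\<close> with weight \<open>v\<close> has a limit selection with the
  same clamped integrals. As \<open>\<Phi>\<close> carries no integrable bound, the integrability of
  \<open>h\<close> comes from the norm estimate, whose bound \<open>K\<close> is independent of
  \<open>R\<close>.\<close>

lemma ex_selection_convex_combination:
  fixes f g :: "'a \<Rightarrow> 'x::{banach, second_countable_topology}"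
  assumes meas: "measurable_correspondence F \<Phi>" and comp: "AE t in M. compactin weak_topology (\<Phi> t)"
    and f: "integrable M f" "AE t in M. f t \<in> \<Phi> t" and g: "integrable M g" "AE t in M. g t \<in> \<Phi> t"
    and uv: "0 \<le> u" "0 \<le> v" "u + v = 1"
  shows "\<exists>h. integrable M h \<and> (AE t in M. h t \<in> \<Phi> t) \<and>
    (\<forall>A\<in>sets F. (LINT t:A|M. h t) = u *\<^sub>R (LINT t:A|M. f t) + v *\<^sub>R (LINT t:A|M. g t))"
proof -
  obtain \<psi> :: "nat \<Rightarrow> ('x \<Rightarrow>\<^sub>L real)" where \<psi>: "norming \<psi>" using ex_norming by blast
  define \<kappa> :: "('a, 'x) mix" where
    "\<kappa> = (2, \<lambda>i t. if i = 0 then u else v, \<lambda>i. if i = 0 then f else g)"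
  have two: "{..<2::nat} = {0, 1}" by auto
  have mexp: "mexp \<kappa> w t = u * w (f t) + v * w (g t)" for w t by (simp add: mexp_def \<kappa>_def two)
  have "AE t in M. \<forall>i<2. (if i = (0::nat) then u else v) \<noteq> 0 \<longrightarrow> (if i = 0 then f else g) t \<in> \<Phi> t"
    using f(2) g(2) by eventually_elim auto
  then have \<kappa>: "mixture M \<Phi> \<kappa>"
    using f(1) g(1) uv by (auto simp: mixture_def \<kappa>_def two)
  have "AE t in M. \<forall>V. openin weak_topology V \<and> \<Phi> t \<subseteq> V \<longrightarrow> (\<forall>\<^sub>F n in sequentially. \<Phi> t \<subseteq> V)"
    by auto
  from ex_limit_selection_trunc[OF \<psi> \<kappa> meas comp this]
  obtain h where hm: "h \<in> borel_measurable M" and h\<Phi>: "AE t in M. h t \<in> \<Phi> t"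
    and lim: "\<And>i R A. A \<in> sets F \<Longrightarrow> (\<lambda>k::nat. LINT t:A|M. mexp \<kappa> (\<lambda>x. trunc R (\<psi> i x)) t)
      \<longlonglongrightarrow> (LINT t:A|M. trunc R (\<psi> i (h t)))"
    and nle: "\<And>R e A. A \<in> sets F \<Longrightarrow> 0 < e \<Longrightarrow> \<forall>\<^sub>F k::nat in sequentially.
      (LINT t:A|M. trunc R (norm (h t))) \<le> (LINT t:A|M. mexp \<kappa> (\<lambda>x. trunc R (norm x)) t) + e"
    by blast
  have top: "space M \<in> sets F" using sets.top[of F] by (simp add: space_subalg)
  have trunc_int: "integrable M (\<lambda>t. trunc R (w t))" if "w \<in> borel_measurable M" for w R
    using that by (intro integrable_const_bound[where B = "real R"]) (auto intro: abs_trunc_le)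
  have fgm: "f \<in> borel_measurable M" "g \<in> borel_measurable M" using f g by auto
  define K where "K = u * (\<integral>t. norm (f t) \<partial>M) + v * (\<integral>t. norm (g t) \<partial>M)"
  have bound: "(\<integral>t. trunc R (norm (h t)) \<partial>M) \<le> K" for R
  proof (rule field_le_epsilon)
    fix e :: real assume "0 < e"
    have full: "(LINT t:space M|M. w t) = (\<integral>t. w t \<partial>M)" for w :: "'a \<Rightarrow> real"
      unfolding set_lebesgue_integral_def by (rule Bochner_Integration.integral_cong) auto
    have "(\<integral>t. trunc R (norm (h t)) \<partial>M) \<le> (\<integral>t. mexp \<kappa> (\<lambda>x. trunc R (norm x)) t \<partial>M) + e"
      using nle[OF top \<open>0 < e\<close>, of R] by (simp add: full)
    also have "(\<integral>t. mexp \<kappa> (\<lambda>x. trunc R (norm x)) t \<partial>M) = u * (\<integral>t. trunc R (norm (f t)) \<partial>M) + v * (\<integral>t. trunc R (norm (g t)) \<partial>M)"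
      unfolding mexp using fgm by (subst Bochner_Integration.integral_add) (auto intro!: trunc_int)
    also have "\<dots> \<le> K"
      unfolding K_def
    proof (intro add_mono mult_left_mono uv integral_mono)
      show "trunc R (norm x) \<le> norm x" for x :: 'x by (auto simp: trunc_def intro: order_trans[of _ 0])
      show "trunc R (norm x) \<le> norm x" for x :: 'x by (auto simp: trunc_def intro: order_trans[of _ 0])
    qed (use f g fgm in \<open>auto intro!: trunc_int\<close>)
    finally show "(\<integral>t. trunc R (norm (h t)) \<partial>M) \<le> K + e" by simp
  qed
  \<comment> \<open>Monotone convergence in \<open>R\<close>: the integrals of the clamped norm all
    stay below \<open>K\<close>.\<close>
  have hi: "integrable M h"
  proof (rule integrableI_bounded[OF hm])
    have "(\<integral>\<^sup>+t. ennreal (norm (h t)) \<partial>M) = (\<integral>\<^sup>+t. (SUP R. ennreal (trunc R (norm (h t)))) \<partial>M)"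
    proof (rule nn_integral_cong)
      fix t
      obtain R0 :: nat where R0: "norm (h t) \<le> real R0" using real_arch_simple by blast
      have "- real R0 \<le> norm (h t)" by (rule order_trans[of _ 0]) auto
      then have "trunc R0 (norm (h t)) = norm (h t)" using R0 by (simp add: trunc_def)
      show "ennreal (norm (h t)) = (SUP R. ennreal (trunc R (norm (h t))))"
      proof (rule antisym)
        show "ennreal (norm (h t)) \<le> (SUP R. ennreal (trunc R (norm (h t))))"
          using \<open>trunc R0 (norm (h t)) = norm (h t)\<close> by (intro SUP_upper2[of R0]) auto
        show "(SUP R. ennreal (trunc R (norm (h t)))) \<le> ennreal (norm (h t))"
          by (intro SUP_least ennreal_leI) (auto simp: trunc_def intro: order_trans[of _ 0])
      qed
    qed
    also have "\<dots> = (SUP R. \<integral>\<^sup>+t. ennreal (trunc R (norm (h t))) \<partial>M)"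
    proof (rule nn_integral_monotone_convergence_SUP)
      show "incseq (\<lambda>R t. ennreal (trunc R (norm (h t))))"
        by (intro incseq_SucI le_funI ennreal_leI) (simp add: trunc_of_nonneg)
    qed (use hm in measurable)
    also have "\<dots> \<le> ennreal K"
    proof (rule SUP_least)
      fix R
      have "(\<integral>\<^sup>+t. ennreal (trunc R (norm (h t))) \<partial>M) = ennreal (\<integral>t. trunc R (norm (h t)) \<partial>M)"
        using hm by (intro nn_integral_eq_integral trunc_int) (auto simp: trunc_of_nonneg)
      then show "(\<integral>\<^sup>+t. ennreal (trunc R (norm (h t))) \<partial>M) \<le> ennreal K" using bound by (simp add: ennreal_leI)
    qed
    finally show "(\<integral>\<^sup>+t. ennreal (norm (h t)) \<partial>M) < \<infinity>" by (simp add: order_le_less_trans)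
  qed
  have trunc_lim: "(\<lambda>R. LINT t:A|M. trunc R (w t)) \<longlonglongrightarrow> (LINT t:A|M. w t)"
    if w: "integrable M w" and A: "A \<in> sets M" for w A
    unfolding set_lebesgue_integral_def
  proof (rule integral_dominated_convergence[where w = "\<lambda>t. \<bar>w t\<bar>"])
    show "AE t in M. (\<lambda>R. indicator A t *\<^sub>R trunc R (w t)) \<longlonglongrightarrow> indicator A t *\<^sub>R w t"
    proof (rule AE_I2, rule tendsto_eventually)
      fix t
      obtain R0 :: nat where R0: "\<bar>w t\<bar> \<le> real R0" using real_arch_simple by blast
      show "\<forall>\<^sub>F R in sequentially. indicator A t *\<^sub>R trunc R (w t) = indicator A t *\<^sub>R w t"
      proof (rule eventually_sequentiallyI)
        fix R assume "R0 \<le> R"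
        then have "\<bar>w t\<bar> \<le> real R" using R0 by simp
        then have "trunc R (w t) = w t" by (auto simp: trunc_def abs_le_iff)
        then show "indicator A t *\<^sub>R trunc R (w t) = indicator A t *\<^sub>R w t" by simp
      qed
    qed
    show "AE t in M. norm (indicator A t *\<^sub>R trunc R (w t)) \<le> \<bar>w t\<bar>" for R
      by (auto simp: indicator_def trunc_def abs_le_iff)
  qed (use w A in auto)
  have "(LINT t:A|M. h t) = u *\<^sub>R (LINT t:A|M. f t) + v *\<^sub>R (LINT t:A|M. g t)" if A: "A \<in> sets F" for A
  proof (rule norming_eqI[OF \<psi>])
    fix i
    have AM: "A \<in> sets M" by (rule sets_subalg[OF A])
    have "(LINT t:A|M. trunc R (\<psi> i (h t))) = u * (LINT t:A|M. trunc R (\<psi> i (f t))) + v * (LINT t:A|M. trunc R (\<psi> i (g t)))" for R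
    proof -
      have \<psi>m: "(\<lambda>t. \<psi> i (f t)) \<in> borel_measurable M" "(\<lambda>t. \<psi> i (g t)) \<in> borel_measurable M"
        using fgm by (auto intro: measurable_compose[OF _ borel_measurable_blinfun])
      \<comment> \<open>The sequence is constant in \<open>k\<close>, so its convergence is an
        equality.\<close>
      have "(LINT t:A|M. trunc R (\<psi> i (h t))) = (LINT t:A|M. mexp \<kappa> (\<lambda>x. trunc R (\<psi> i x)) t)"
        using LIMSEQ_unique[OF lim[OF A] tendsto_const] .
      also have "\<dots> = (LINT t:A|M. u * trunc R (\<psi> i (f t))) + (LINT t:A|M. v * trunc R (\<psi> i (g t)))"
        unfolding mexp
        by (intro set_integral_add set_integrable_mult_right set_integrable_bounded[where a = "real R"] abs_trunc_le
            AM measurable_compose[OF \<psi>m(1) trunc_measurable] measurable_compose[OF \<psi>m(2) trunc_measurable])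
      finally show ?thesis by (simp only: set_integral_mult_right)
    qed
    then have "(\<lambda>R. LINT t:A|M. trunc R (\<psi> i (h t))) \<longlonglongrightarrow> u * (LINT t:A|M. \<psi> i (f t)) + v * (LINT t:A|M. \<psi> i (g t))"
      using f g AM by (auto intro!: tendsto_intros trunc_lim integrable_blinfun)
    then have "(LINT t:A|M. \<psi> i (h t)) = u * (LINT t:A|M. \<psi> i (f t)) + v * (LINT t:A|M. \<psi> i (g t))"
      using trunc_lim[OF integrable_blinfun[OF hi, of "\<psi> i"] AM] LIMSEQ_unique by blast
    then show "\<psi> i (LINT t:A|M. h t) = \<psi> i (u *\<^sub>R (LINT t:A|M. f t) + v *\<^sub>R (LINT t:A|M. g t))"
      using hi f g AM by (simp add: set_integral_blinfun blinfun.add_right blinfun.scaleR_right)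
  qed
  then show ?thesis using hi h\<Phi> by blast
qed

end


section \<open>The closed convex hull\<close>

text \<open>Among the first \<open>n\<close> coded lists a best one with respect to
  \<open>d\<close>. The start \<open>[0]\<close> and the exclusion of the empty list make the
  average a genuine convex combination.\<close>

primrec best_list :: "(nat list \<Rightarrow> real) \<Rightarrow> nat \<Rightarrow> nat list" where
  "best_list d 0 = [0]"
| "best_list d (Suc n) =
    (if from_nat n \<noteq> ([] :: nat list) \<and> d (from_nat n) < d (best_list d n) then from_nat n else best_list d n)"

lemma best_list_nonempty: "best_list d n \<noteq> []"
  by (induction n) auto

lemma best_list_le: "k < n \<Longrightarrow> from_nat k \<noteq> ([] :: nat list) \<Longrightarrow> d (best_list d n) \<le> d (from_nat k)"
  by (induction n) (auto simp: less_Suc_eq)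

text \<open>The bound does not depend on \<open>d\<close>, so a list chosen separately at each
  \<open>t\<close> still defines a mixture of one fixed length.\<close>

lemma best_list_bounded: "\<exists>m. \<forall>d. set (best_list d n) \<subseteq> {..<m}"
proof (induction n)
  case (Suc n)
  then obtain m where m: "\<And>d. set (best_list d n) \<subseteq> {..<m}" by blast
  obtain m' where m': "set (from_nat n :: nat list) \<subseteq> {..<m'}"
    using finite_nat_bounded[OF finite_set] by blast
  have "set (best_list d (Suc n)) \<subseteq> {..<max m m'}" for d
    using m[of d] m' by auto
  then show ?case by blast
qed (auto intro!: exI[of _ 1])

lemma best_list_measurable:
  assumes "\<And>l. (\<lambda>t. d t l) \<in> borel_measurable M"
  shows "(\<lambda>t. best_list (d t) n) \<in> measurable M (count_space UNIV)"
proof (induction n)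
  case (Suc n)
  have "(\<lambda>t. d t (best_list (d t) n)) \<in> borel_measurable M"
    by (rule measurable_compose_countable[where f = "\<lambda>l t. d t l", OF assms Suc])
  then have "Measurable.pred M (\<lambda>t. from_nat n \<noteq> ([] :: nat list) \<and> d t (from_nat n) < d t (best_list (d t) n))"
    using assms[of "from_nat n"] by measurable
  then have "{t \<in> space M. from_nat n \<noteq> ([] :: nat list) \<and> d t (from_nat n) < d t (best_list (d t) n)} \<in> sets M"
    by (simp add: pred_def)
  then show ?case using Suc by (simp only: best_list.simps) (intro measurable_If measurable_const, auto)
qed simp

context complete_nowhere_equivalent
begin

text \<open>Almost everywhere \<open>f\<close> is the limit of averages \<open>a n\<close> of dense
  selections, with lists chosen measurably in \<open>t\<close>. These averages are barycentres of
  mixtures supported in \<open>\<Phi>\<close>. Linear functionals do not distinguish a mixture from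
  its barycentre, so the limit selection has the integrals of \<open>f\<close>.\<close>

lemma ex_selection_closed_hull:
  fixes f :: "'a \<Rightarrow> 'x::{banach, second_countable_topology}"
  assumes ne: "\<And>t. t \<in> space M \<Longrightarrow> \<Phi> t \<noteq> {}"
    and meas: "measurable_correspondence F \<Phi>" and comp: "AE t in M. compactin weak_topology (\<Phi> t)"
    and h: "integrable M h" "AE t in M. \<forall>x\<in>\<Phi> t. norm x \<le> h t"
    and f: "integrable M f" "AE t in M. f t \<in> closure (convex hull \<Phi> t)"
  shows "\<exists>g. integrable M g \<and> (AE t in M. g t \<in> \<Phi> t) \<and> (\<forall>A\<in>sets F. (LINT t:A|M. g t) = (LINT t:A|M. f t))"
proof -
  obtain \<psi> :: "nat \<Rightarrow> ('x \<Rightarrow>\<^sub>L real)" where \<psi>: "norming \<psi>" using ex_norming by blast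
  have "\<exists>s::nat \<Rightarrow> 'a \<Rightarrow> 'x. (\<forall>i. s i \<in> borel_measurable F) \<and> (\<forall>i. \<forall>t\<in>space F. s i t \<in> closure (\<Phi> t)) \<and>
    (\<forall>t\<in>space F. \<forall>x\<in>\<Phi> t. \<forall>r>0. \<exists>i. dist (s i t) x < r)"
    by (rule ex_dense_selections[OF _ meas]) (simp add: ne space_subalg)
  then obtain s :: "nat \<Rightarrow> 'a \<Rightarrow> 'x" where sF: "\<And>i. s i \<in> borel_measurable F"
    and s_cl: "\<And>i t. t \<in> space M \<Longrightarrow> s i t \<in> closure (\<Phi> t)"
    and s_dense: "\<And>t x r. t \<in> space M \<Longrightarrow> x \<in> \<Phi> t \<Longrightarrow> 0 < r \<Longrightarrow> \<exists>i. dist (s i t) x < r"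
    unfolding space_subalg by (elim exE conjE) blast
  have sM: "s i \<in> borel_measurable M" for i by (rule measurable_from_subalg[OF subalg sF])
  have s\<Phi>: "AE t in M. \<forall>i. s i t \<in> \<Phi> t"
    using comp AE_space
  proof eventually_elim
    case (elim t)
    have "closure (\<Phi> t) = \<Phi> t" using compactin_weak_imp_closed[OF elim(1)] by simp
    then show ?case using s_cl[OF elim(2)] by auto
  qed
  define d where "d t l = dist (average (\<lambda>i. s i t) l) (f t)" for t l
  define L where "L n t = best_list (d t) n" for n t
  obtain m where m: "\<And>n t. set (L n t) \<subseteq> {..<m n}"
    using best_list_bounded unfolding L_def by metis
  have Lne: "L n t \<noteq> []" for n t by (simp add: L_def best_list_nonempty)
  have avg_m: "(\<lambda>t. average (\<lambda>i. s i t) l) \<in> borel_measurable M" for l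
  proof -
    have "average (\<lambda>i. s i t) l = (\<Sum>i\<in>set l. (real (count_list l i) / real (length l)) *\<^sub>R s i t)" for t
      by (rule average_eq_sum) auto
    then show ?thesis using sM by simp
  qed
  have "(\<lambda>t. d t l) \<in> borel_measurable M" for l
    unfolding d_def using avg_m f(1) by (intro borel_measurable_dist) auto
  then have Lm: "L n \<in> measurable M (count_space UNIV)" for n
    unfolding L_def[abs_def] by (rule best_list_measurable)
  define c where "c n i t = real (count_list (L n t) i) / real (length (L n t))" for n i t
  define \<kappa> :: "nat \<Rightarrow> ('a, 'x) mix" where "\<kappa> n = (m n, c n, s)" for n
  have \<kappa>: "mixture M \<Phi> (\<kappa> n)" for n
  proof -
    have "c n i \<in> borel_measurable M" for i
      unfolding c_def[abs_def] by (rule measurable_compose[OF Lm]) simp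
    moreover have "(\<Sum>i<m n. c n i t) = 1" for t
    proof -
      have "(\<Sum>i<m n. count_list (L n t) i) = length (L n t)" by (rule sum_count_set[OF m]) simp
      then have "(\<Sum>i<m n. real (count_list (L n t) i)) = real (length (L n t))" by (metis of_nat_sum)
      then show ?thesis using Lne[of n t] unfolding c_def sum_divide_distrib[symmetric] by simp
    qed
    moreover have "AE t in M. \<forall>i<m n. c n i t \<noteq> 0 \<longrightarrow> s i t \<in> \<Phi> t" using s\<Phi> by eventually_elim blast
    ultimately show ?thesis using sM by (auto simp: mixture_def \<kappa>_def c_def)
  qed
  define a where "a n t = average (\<lambda>i. s i t) (L n t)" for n t
  have a_sum: "a n t = (\<Sum>i<m n. c n i t *\<^sub>R s i t)" for n t
    unfolding a_def c_def by (rule average_eq_sum) (use m in auto)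
  \<comment> \<open>Only linear test functions allow the mixture to be replaced by its
    barycentre.\<close>
  have mexp_a: "mexp (\<kappa> n) \<xi> t = \<xi> (a n t)" for n t and \<xi> :: "'x \<Rightarrow>\<^sub>L real"
    by (simp add: mexp_def \<kappa>_def a_sum blinfun.sum_right blinfun.scaleR_right)
  have am: "a n \<in> borel_measurable M" for n
    unfolding a_def[abs_def] by (rule measurable_compose_countable[OF avg_m Lm])
  have alim: "AE t in M. (\<lambda>n. a n t) \<longlonglongrightarrow> f t"
    using f(2) AE_space
  proof eventually_elim
    case (elim t)
    show ?case
    proof (rule metric_LIMSEQ_I)
      fix r :: real assume "0 < r"
      then obtain l where l: "l \<noteq> []" "d t l < r"
        using closure_convex_hull_average[OF s_dense[OF elim(2)] elim(1)] unfolding d_def by blast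
      \<comment> \<open>A list with code \<open>to_nat l\<close> takes part in the competition from
        stage \<open>Suc (to_nat l)\<close> on.\<close>
      have "dist (a n t) (f t) < r" if "Suc (to_nat l) \<le> n" for n
        using best_list_le[of "to_nat l" n "d t"] l that by (simp add: a_def L_def d_def)
      then show "\<exists>n0. \<forall>n\<ge>n0. dist (a n t) (f t) < r" by blast
    qed
  qed
  have ah: "AE t in M. norm (a n t) \<le> h t" for n
    using s\<Phi> h(2)
  proof eventually_elim
    case (elim t)
    have "norm (a n t) \<le> (\<Sum>i<m n. c n i t * h t)"
      unfolding a_sum
    proof (rule sum_norm_le)
      fix i
      have "0 \<le> c n i t" by (simp add: c_def)
      then show "norm (c n i t *\<^sub>R s i t) \<le> c n i t * h t" using elim by (simp add: mult_left_mono)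
    qed
    also have "\<dots> = h t" using \<kappa>[of n] by (auto simp: mixture_def \<kappa>_def sum_distrib_right[symmetric])
    finally show ?case .
  qed
  have "AE t in M. \<forall>V. openin weak_topology V \<and> \<Phi> t \<subseteq> V \<longrightarrow> (\<forall>\<^sub>F n in sequentially. \<Phi> t \<subseteq> V)"
    by auto
  from ex_limit_selection[where \<kappa> = \<kappa>, OF \<kappa> meas comp this h h(2)]
  obtain r g where rg: "strict_mono r \<and> integrable M g \<and> (AE t in M. g t \<in> \<Phi> t) \<and>
    (\<forall>\<xi>::'x \<Rightarrow>\<^sub>L real. \<forall>A\<in>sets F. (\<lambda>k. LINT t:A|M. mexp (\<kappa> (r k)) \<xi> t) \<longlonglongrightarrow> \<xi> (LINT t:A|M. g t))"
    by (elim exE)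
  then have r: "strict_mono r" and g: "integrable M g" "AE t in M. g t \<in> \<Phi> t"
    and lim: "\<And>(\<xi>::'x \<Rightarrow>\<^sub>L real) A. A \<in> sets F \<Longrightarrow> (\<lambda>k. LINT t:A|M. mexp (\<kappa> (r k)) \<xi> t) \<longlonglongrightarrow> \<xi> (LINT t:A|M. g t)"
    by simp_all
  have "(LINT t:A|M. g t) = (LINT t:A|M. f t)" if A: "A \<in> sets F" for A
  proof (rule norming_eqI[OF \<psi>])
    fix i
    have AM: "A \<in> sets M" by (rule sets_subalg[OF A])
    have ai: "integrable M (a n)" for n
      by (rule Bochner_Integration.integrable_bound[OF h(1) am], rule eventually_mono[OF ah[of n]], simp)
    have "(\<lambda>n. LINT t:A|M. a n t) \<longlonglongrightarrow> (LINT t:A|M. f t)"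
      unfolding set_lebesgue_integral_def
    proof (rule integral_dominated_convergence[where w = h])
      show "AE t in M. (\<lambda>n. indicator A t *\<^sub>R a n t) \<longlonglongrightarrow> indicator A t *\<^sub>R f t"
        using alim by eventually_elim (intro tendsto_intros)
      show "AE t in M. norm (indicator A t *\<^sub>R a n t) \<le> h t" for n
        using ah[of n]
      proof eventually_elim
        case (elim t)
        then show ?case using order_trans[OF norm_ge_zero elim] by (auto simp: indicator_def)
      qed
    qed (use h f am AM in auto)
    then have "(\<lambda>n. \<psi> i (LINT t:A|M. a n t)) \<longlonglongrightarrow> \<psi> i (LINT t:A|M. f t)"
      by (intro tendsto_intros)
    then have "(\<lambda>k. \<psi> i (LINT t:A|M. a (r k) t)) \<longlonglongrightarrow> \<psi> i (LINT t:A|M. f t)"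
      using LIMSEQ_subseq_LIMSEQ[OF _ r] by (auto simp: comp_def)
    moreover have "(LINT t:A|M. mexp (\<kappa> n) (\<psi> i) t) = \<psi> i (LINT t:A|M. a n t)" for n
      unfolding mexp_a by (rule set_integral_blinfun[OF ai AM])
    ultimately show "\<psi> i (LINT t:A|M. g t) = \<psi> i (LINT t:A|M. f t)"
      using lim[OF A, of "\<psi> i"] LIMSEQ_unique by simp
  qed
  then show ?thesis using g by blast
qed

end

section \<open>Functionals on \<open>L\<^sub>p\<close> and the Radon--Nikodym property\<close>

text \<open>The type \<open>'z\<close> has no countable base, so differences of Borel functions are
  not measurable by general rules; here \<open>s\<close> has finitely many values and each of them
  can be treated as a constant.\<close>

lemma borel_measurable_norm_diff_simple:
  fixes g :: "'a \<Rightarrow> 'z::real_normed_vector"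
  assumes g: "g \<in> borel_measurable N" and s: "simple_function N s"
  shows "(\<lambda>t. norm (g t - s t)) \<in> borel_measurable N"
proof (rule measurable_compose_countable'[where f = "\<lambda>y t. norm (g t - y)" and g = s and I = "s ` space N"])
  show "(\<lambda>t. norm (g t - y)) \<in> borel_measurable N" for y
    by (rule measurable_compose[OF g]) (intro borel_measurable_continuous_onI continuous_intros)
  have "finite (s ` space N)" using s by (rule simple_functionD)
  then show "countable (s ` space N)" by (rule countable_finite)
  show "s \<in> N \<rightarrow>\<^sub>M count_space (s ` space N)"
    using \<open>finite (s ` space N)\<close> simple_functionD(2)[OF s]
    by (subst measurable_count_space_eq2) auto
qed

text \<open>A comparison through \<open>g\<close> that refers to integrals of simple functions only,
  since the Bochner integral for types with a countable base does not cover
  \<open>g\<close>.\<close>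

lemma simple_bochner_integral_dist_le:
  fixes g :: "'a \<Rightarrow> 'z::real_normed_vector"
  assumes g: "g \<in> borel_measurable N"
    and s: "Bochner_Integration.simple_bochner_integrable N s" "Bochner_Integration.simple_bochner_integrable N t"
  shows "ennreal (norm (Bochner_Integration.simple_bochner_integral N s - Bochner_Integration.simple_bochner_integral N t))
    \<le> (\<integral>\<^sup>+x. norm (g x - s x) \<partial>N) + (\<integral>\<^sup>+x. norm (g x - t x) \<partial>N)"
proof -
  have sf: "simple_function N s" "simple_function N t"
    using s by (auto elim: Bochner_Integration.simple_bochner_integrable.cases)
  have "ennreal (norm (Bochner_Integration.simple_bochner_integral N s - Bochner_Integration.simple_bochner_integral N t))
      = norm (Bochner_Integration.simple_bochner_integral N (\<lambda>x. s x - t x))"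
    using s by (subst Bochner_Integration.simple_bochner_integral_diff) auto
  also have "\<dots> \<le> Bochner_Integration.simple_bochner_integral N (\<lambda>x. norm (s x - t x))"
    using Bochner_Integration.simple_bochner_integrable_compose2[of "(-)" N s t] s
    by (auto intro!: Bochner_Integration.simple_bochner_integral_norm_bound)
  also have "\<dots> = (\<integral>\<^sup>+x. norm (s x - t x) \<partial>N)"
    using Bochner_Integration.simple_bochner_integrable_compose2[of "\<lambda>x y. norm (x - y)" N s t] s
    by (auto intro!: Bochner_Integration.simple_bochner_integral_eq_nn_integral)
  also have "\<dots> \<le> (\<integral>\<^sup>+x. ennreal (norm (g x - s x)) + ennreal (norm (g x - t x)) \<partial>N)"
  proof (rule nn_integral_mono)
    fix x
    have "norm (s x - t x) \<le> norm (g x - s x) + norm (g x - t x)"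
      using norm_triangle_ineq4[of "g x - t x" "g x - s x"] by simp
    then show "ennreal (norm (s x - t x)) \<le> ennreal (norm (g x - s x)) + ennreal (norm (g x - t x))"
      by (simp flip: ennreal_plus)
  qed
  also have "\<dots> = (\<integral>\<^sup>+x. norm (g x - s x) \<partial>N) + (\<integral>\<^sup>+x. norm (g x - t x) \<partial>N)"
    using borel_measurable_norm_diff_simple[OF g sf(1)] borel_measurable_norm_diff_simple[OF g sf(2)]
    by (intro nn_integral_add) auto
  finally show ?thesis .
qed

text \<open>One simple approximation \<open>s\<close> of the density serves all sets: the error on
  \<open>A\<close> is at most the integral over \<open>A\<close> of the pointwise distance
  \<open>e\<close>. As a function of \<open>A\<close> this bound is a measure of total mass below
  \<open>\<epsilon>\<close>.\<close>

lemma radon_nikodym_simple_approx: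
  fixes \<nu> :: "'a set \<Rightarrow> 'z::banach"
  assumes rnp: "radon_nikodym_property TYPE('a) TYPE('z)"
    and N: "finite_measure N" and \<nu>: "vector_measure N \<nu>" "bounded_variation N \<nu>" "\<And>A. A \<in> null_sets N \<Longrightarrow> \<nu> A = 0"
    and \<epsilon>: "0 < (\<epsilon>::ennreal)"
  shows "\<exists>s e. simple_function N s \<and> e \<in> borel_measurable N \<and> (\<integral>\<^sup>+t. e t \<partial>N) < \<epsilon> \<and>
    (\<forall>A\<in>sets N. ennreal (norm (\<nu> A - Bochner_Integration.simple_bochner_integral N (\<lambda>t. indicator A t *\<^sub>R s t)))
      \<le> (\<integral>\<^sup>+t. e t * indicator A t \<partial>N))"
proof -
  interpret N: finite_measure N by (rule N)
  obtain g where g: "\<And>A. A \<in> sets N \<Longrightarrow> has_strong_bochner_integral N (\<lambda>t. indicator A t *\<^sub>R g t) (\<nu> A)"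
    using rnp N \<nu> unfolding radon_nikodym_property_def by blast
  have "has_strong_bochner_integral N (\<lambda>t. indicator (space N) t *\<^sub>R g t) (\<nu> (space N))" by (rule g) simp
  then obtain S where S: "\<And>i::nat. Bochner_Integration.simple_bochner_integrable N (S i)"
    "(\<lambda>i. \<integral>\<^sup>+t. ennreal (norm (indicator (space N) t *\<^sub>R g t - S i t)) \<partial>N) \<longlonglongrightarrow> 0"
    unfolding has_strong_bochner_integral_def by blast
  obtain i where i: "(\<integral>\<^sup>+t. ennreal (norm (indicator (space N) t *\<^sub>R g t - S i t)) \<partial>N) < \<epsilon>"
    using order_tendstoD(2)[OF S(2) \<epsilon>] by (auto simp: eventually_sequentially)
  define s where "s = S i"
  define e where "e t = ennreal (norm (indicator (space N) t *\<^sub>R g t - s t))" for t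
  have s: "Bochner_Integration.simple_bochner_integrable N s" "simple_function N s"
    using S(1)[of i] by (auto simp: s_def elim: Bochner_Integration.simple_bochner_integrable.cases)
  have gm: "(\<lambda>t. indicator A t *\<^sub>R g t) \<in> borel_measurable N" if "A \<in> sets N" for A
    using g[OF that] by (simp add: has_strong_bochner_integral_def)
  have em: "e \<in> borel_measurable N"
    unfolding e_def using borel_measurable_norm_diff_simple[OF gm[OF sets.top] s(2)] by simp
  have "ennreal (norm (\<nu> A - Bochner_Integration.simple_bochner_integral N (\<lambda>t. indicator A t *\<^sub>R s t)))
      \<le> (\<integral>\<^sup>+t. e t * indicator A t \<partial>N)" if A: "A \<in> sets N" for A
  proof -
    \<comment> \<open>The value at \<open>A\<close> comes with approximating simple functions of its
      own; they are compared with \<open>s\<close> through the common density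
      \<open>g\<close>.\<close>
    obtain R where R: "\<And>i::nat. Bochner_Integration.simple_bochner_integrable N (R i)"
      "(\<lambda>i. \<integral>\<^sup>+t. ennreal (norm (indicator A t *\<^sub>R g t - R i t)) \<partial>N) \<longlonglongrightarrow> 0"
      "(\<lambda>i. Bochner_Integration.simple_bochner_integral N (R i)) \<longlonglongrightarrow> \<nu> A"
      using g[OF A] unfolding has_strong_bochner_integral_def by blast
    have sA: "Bochner_Integration.simple_bochner_integrable N (\<lambda>t. indicator A t *\<^sub>R s t)"
    proof (rule Bochner_Integration.simple_bochner_integrable.intros)
      show "simple_function N (\<lambda>t. indicator A t *\<^sub>R s t)"
        by (rule simple_function_scaleR[OF simple_function_indicator[OF A] s(2)])
    qed (simp add: N.emeasure_eq_measure)
    have eq: "(\<integral>\<^sup>+t. ennreal (norm (indicator A t *\<^sub>R g t - indicator A t *\<^sub>R s t)) \<partial>N) = (\<integral>\<^sup>+t. e t * indicator A t \<partial>N)"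
      using sets.sets_into_space[OF A] by (intro nn_integral_cong) (auto simp: e_def indicator_def)
    have le: "ennreal (norm (Bochner_Integration.simple_bochner_integral N (R i) -
        Bochner_Integration.simple_bochner_integral N (\<lambda>t. indicator A t *\<^sub>R s t)))
      \<le> (\<integral>\<^sup>+t. ennreal (norm (indicator A t *\<^sub>R g t - R i t)) \<partial>N) + (\<integral>\<^sup>+t. e t * indicator A t \<partial>N)" for i
      using simple_bochner_integral_dist_le[OF gm[OF A] R(1) sA, of i] by (simp only: eq)
    have l1: "(\<lambda>i. ennreal (norm (Bochner_Integration.simple_bochner_integral N (R i) -
        Bochner_Integration.simple_bochner_integral N (\<lambda>t. indicator A t *\<^sub>R s t))))
      \<longlonglongrightarrow> ennreal (norm (\<nu> A - Bochner_Integration.simple_bochner_integral N (\<lambda>t. indicator A t *\<^sub>R s t)))"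
      by (intro tendsto_ennrealI tendsto_intros R)
    have l2: "(\<lambda>i. (\<integral>\<^sup>+t. ennreal (norm (indicator A t *\<^sub>R g t - R i t)) \<partial>N) + (\<integral>\<^sup>+t. e t * indicator A t \<partial>N))
      \<longlonglongrightarrow> 0 + (\<integral>\<^sup>+t. e t * indicator A t \<partial>N)"
      by (intro tendsto_add R tendsto_const)
    from LIMSEQ_le[OF l1 l2] le show ?thesis by auto
  qed
  moreover have "(\<integral>\<^sup>+t. e t \<partial>N) < \<epsilon>" using i by (simp add: e_def s_def)
  ultimately show ?thesis using s(2) em by blast
qed

context finite_measure_subalgebra
begin

lemma ae_class_cong: "AE t in M. f t = g t \<Longrightarrow> ae_class M F f = ae_class M F g"
  unfolding ae_class_def by (auto elim!: eventually_elim2)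

lemma integrable_powr_bounded:
  fixes f :: "'a \<Rightarrow> 'x::{banach, second_countable_topology}"
  assumes "f \<in> borel_measurable M" "AE t in M. norm (f t) \<le> h t" "integrable M (\<lambda>t. h t powr p)" "1 \<le> p"
  shows "integrable M (\<lambda>t. norm (f t) powr p)"
  by (rule Bochner_Integration.integrable_bound[OF assms(3)])
    (use assms in \<open>auto elim!: eventually_mono intro!: powr_mono2\<close>)

lemma Lp_fun_bounded:
  assumes "f \<in> borel_measurable F" "\<And>t. norm (f t) \<le> R" "1 \<le> p"
  shows "f \<in> Lp_fun M F p"
proof -
  have fM: "f \<in> borel_measurable M" by (rule measurable_from_subalg[OF subalg assms(1)])
  have "integrable M f" by (rule integrable_const_bound[where B = R]) (use fM assms(2) in auto)
  moreover have "integrable M (\<lambda>t. norm (f t) powr p)"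
    by (rule integrable_powr_bounded[OF fM, where h = "\<lambda>_. R"]) (use assms in auto)
  ultimately show ?thesis using assms(1) by (auto simp: Lp_fun_def)
qed

end

section \<open>The vector measure of a bounded functional on \<open>L_p\<close>\<close>

locale Lp_functional = finite_measure_subalgebra +
  fixes p :: real and \<phi> :: "('a \<Rightarrow> 'x::{banach, second_countable_topology}) set \<Rightarrow> real"
  assumes p: "1 \<le> p" and dual: "\<phi> \<in> Lp_dual M F p"
begin

definition \<Lambda> :: "('a \<Rightarrow> 'x) \<Rightarrow> real" where
  "\<Lambda> f = \<phi> (ae_class M F f)"

lemma \<Lambda>_add: "f \<in> Lp_fun M F p \<Longrightarrow> g \<in> Lp_fun M F p \<Longrightarrow> \<Lambda> (\<lambda>t. f t + g t) = \<Lambda> f + \<Lambda> g"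
  and \<Lambda>_scale: "f \<in> Lp_fun M F p \<Longrightarrow> \<Lambda> (\<lambda>t. c *\<^sub>R f t) = c * \<Lambda> f"
  using dual unfolding Lp_dual_def \<Lambda>_def by auto

lemma \<Lambda>_cong: "AE t in M. f t = g t \<Longrightarrow> \<Lambda> f = \<Lambda> g"
  unfolding \<Lambda>_def by (simp add: ae_class_cong)

lemma ex_\<Lambda>_bound: "\<exists>K\<ge>0. \<forall>f\<in>Lp_fun M F p. \<bar>\<Lambda> f\<bar> \<le> K * Lp_norm M p f"
proof -
  have "\<exists>K. \<forall>f\<in>Lp_fun M F p. \<bar>\<Lambda> f\<bar> \<le> K * Lp_norm M p f"
    using dual by (simp add: Lp_dual_def \<Lambda>_def)
  then obtain K where K: "\<And>f. f \<in> Lp_fun M F p \<Longrightarrow> \<bar>\<Lambda> f\<bar> \<le> K * Lp_norm M p f"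
    by blast
  have "\<bar>\<Lambda> f\<bar> \<le> \<bar>K\<bar> * Lp_norm M p f" if "f \<in> Lp_fun M F p" for f
    using K[OF that] mult_right_mono[OF abs_ge_self[of K], of "Lp_norm M p f"] by (simp add: Lp_norm_def)
  then show ?thesis by (intro exI[of _ "\<bar>K\<bar>"]) auto
qed

definition K :: real where
  "K = (SOME K. 0 \<le> K \<and> (\<forall>f\<in>Lp_fun M F p. \<bar>\<Lambda> f\<bar> \<le> K * Lp_norm M p f))"

lemma K_nonneg: "0 \<le> K" and \<Lambda>_bound: "f \<in> Lp_fun M F p \<Longrightarrow> \<bar>\<Lambda> f\<bar> \<le> K * Lp_norm M p f"
  using someI_ex[OF ex_\<Lambda>_bound[unfolded Bex_def]] unfolding K_def by auto

lemma Lp_norm_le: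
  assumes "f \<in> borel_measurable M" "AE t in M. norm (f t) powr p \<le> h t" "integrable M h" "(\<integral>t. h t \<partial>M) \<le> a"
  shows "Lp_norm M p f \<le> a powr (1 / p)"
proof -
  have "integrable M (\<lambda>t. norm (f t) powr p)"
    by (rule Bochner_Integration.integrable_bound[OF assms(3)]) (use assms in \<open>auto elim!: eventually_mono\<close>)
  then have "(\<integral>t. norm (f t) powr p \<partial>M) \<le> (\<integral>t. h t \<partial>M)"
    using assms by (intro integral_mono_AE) auto
  then have "(\<integral>t. norm (f t) powr p \<partial>M) \<le> a" using assms(4) by simp
  then show ?thesis unfolding Lp_norm_def using p
    by (intro powr_mono2) (auto intro!: Bochner_Integration.integral_nonneg)
qed

lemma \<Lambda>_sum:
  assumes "finite I" "\<And>i. i \<in> I \<Longrightarrow> f i \<in> borel_measurable F" "\<And>i t. i \<in> I \<Longrightarrow> norm (f i t) \<le> R i"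
  shows "\<Lambda> (\<lambda>t. \<Sum>i\<in>I. f i t) = (\<Sum>i\<in>I. \<Lambda> (f i))"
  using assms
proof (induction I rule: finite_induct)
  case empty
  have "(\<lambda>t. 0 :: 'x) \<in> Lp_fun M F p" by (rule Lp_fun_bounded[OF _ _ p, where R = 0]) auto
  from \<Lambda>_scale[OF this, of 0] show ?case by simp
next
  case (insert i I)
  have "f i \<in> Lp_fun M F p" using insert.prems by (intro Lp_fun_bounded[OF _ _ p, where R = "R i"]) auto
  moreover have "(\<lambda>t. \<Sum>i\<in>I. f i t) \<in> Lp_fun M F p"
    using insert.prems by (intro Lp_fun_bounded[OF _ _ p, where R = "\<Sum>i\<in>I. R i"]) (auto intro!: sum_norm_le)
  ultimately show ?case using insert \<Lambda>_add[of "f i" "\<lambda>t. \<Sum>i\<in>I. f i t"] by simp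
qed

lemma \<Lambda>_diff:
  assumes "f \<in> Lp_fun M F p" "g \<in> Lp_fun M F p"
  shows "\<Lambda> (\<lambda>t. f t - g t) = \<Lambda> f - \<Lambda> g"
proof -
  have "(\<lambda>t. (-1) *\<^sub>R g t) \<in> Lp_fun M F p" using assms(2) by (auto simp: Lp_fun_def)
  then show ?thesis using \<Lambda>_add[OF assms(1)] \<Lambda>_scale[OF assms(2), of "-1"] by fastforce
qed

text \<open>Bounded convergence almost everywhere implies convergence in the \<open>p\<close>-norm,
  for which the functional is continuous.\<close>

lemma \<Lambda>_bounded_limit:
  fixes u :: "nat \<Rightarrow> 'a \<Rightarrow> 'x"
  assumes u: "\<And>n. u n \<in> borel_measurable F" "\<And>n t. norm (u n t) \<le> R" and v: "v \<in> borel_measurable F" "\<And>t. norm (v t) \<le> R"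
    and lim: "AE t in M. (\<lambda>n. u n t) \<longlonglongrightarrow> v t"
  shows "(\<lambda>n. \<Lambda> (u n)) \<longlonglongrightarrow> \<Lambda> v"
proof -
  have L: "u n \<in> Lp_fun M F p" "v \<in> Lp_fun M F p" for n
    using u v by (auto intro: Lp_fun_bounded[OF _ _ p, where R = R])
  have bd: "norm (u n t - v t) \<le> 2 * R" for n t
    using norm_triangle_ineq4[of "u n t" "v t"] u(2)[of n t] v(2)[of t] by simp
  have d: "(\<lambda>t. u n t - v t) \<in> Lp_fun M F p" for n
    using u v bd by (intro Lp_fun_bounded[OF _ _ p, where R = "2 * R"]) auto
  have "(\<lambda>n. \<integral>t. norm (u n t - v t) powr p \<partial>M) \<longlonglongrightarrow> (\<integral>t. 0 \<partial>M)"
  proof (rule integral_dominated_convergence[where w = "\<lambda>_. (2 * R) powr p"])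
    show "AE t in M. (\<lambda>n. norm (u n t - v t) powr p) \<longlonglongrightarrow> 0"
      using lim
    proof eventually_elim
      case (elim t)
      then have "(\<lambda>n. norm (u n t - v t)) \<longlonglongrightarrow> 0" by (intro tendsto_norm_zero) (simp add: LIM_zero_iff)
      then show ?case using p by (intro tendsto_zero_powrI[where b = p]) (auto intro!: tendsto_const)
    qed
    show "AE t in M. norm (norm (u n t - v t) powr p) \<le> (2 * R) powr p" for n
      using bd p by (auto intro!: powr_mono2)
  qed (use d in \<open>auto simp: Lp_fun_def\<close>)
  then have "(\<lambda>n. (\<integral>t. norm (u n t - v t) powr p \<partial>M) powr (1 / p)) \<longlonglongrightarrow> 0"
    using p by (intro tendsto_zero_powrI[where b = "1 / p"]) (auto intro!: tendsto_const always_eventually Bochner_Integration.integral_nonneg)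
  then have lim0: "(\<lambda>n. K * Lp_norm M p (\<lambda>t. u n t - v t)) \<longlonglongrightarrow> 0"
    unfolding Lp_norm_def by (rule tendsto_mult_right_zero)
  have le: "norm (\<Lambda> (u n) - \<Lambda> v) \<le> K * Lp_norm M p (\<lambda>t. u n t - v t)" for n
    using \<Lambda>_bound[OF d, of n] \<Lambda>_diff[OF L, of n] by simp
  have "(\<lambda>n. \<Lambda> (u n) - \<Lambda> v) \<longlonglongrightarrow> 0"
    by (rule Lim_null_comparison[OF _ lim0]) (simp only: le eventually_True)
  then show ?thesis by (simp add: LIM_zero_iff)
qed

text \<open>The vector measure to which the Radon--Nikodym property will be applied. For
  \<open>A\<close> in \<open>F\<close> the abstracted map is bounded and linear; no claim is made
  about other sets.\<close>

definition charge :: "'a set \<Rightarrow> ('x \<Rightarrow>\<^sub>L real)" where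
  "charge A = Blinfun (\<lambda>x. \<Lambda> (\<lambda>t. indicator A t *\<^sub>R x))"

lemma indicator_scale_bounds:
  assumes "A \<in> sets F"
  shows "(\<lambda>t. indicator A t *\<^sub>R x) \<in> borel_measurable F" "norm (indicator A t *\<^sub>R (x::'x)) \<le> norm x"
    "(\<lambda>t. indicator A t *\<^sub>R x) \<in> Lp_fun M F p"
proof -
  show *: "(\<lambda>t. indicator A t *\<^sub>R x) \<in> borel_measurable F" using assms by measurable
  show **: "norm (indicator A t *\<^sub>R x) \<le> norm x" for t by (auto simp: indicator_def)
  show "(\<lambda>t. indicator A t *\<^sub>R x) \<in> Lp_fun M F p" by (rule Lp_fun_bounded[OF * ** p])
qed

lemma Lp_norm_indicator:
  assumes "A \<in> sets F"
  shows "Lp_norm M p (\<lambda>t. indicator A t *\<^sub>R x) = measure M A powr (1 / p) * norm x"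
proof -
  have "(\<integral>t. norm (indicator A t *\<^sub>R x) powr p \<partial>M) = (\<integral>t. indicator A t * norm x powr p \<partial>M)"
    by (rule Bochner_Integration.integral_cong) (auto simp: indicator_def)
  also have "\<dots> = measure M A * norm x powr p"
    using sets_subalg[OF assms] by simp
  finally have eq: "(\<integral>t. norm (indicator A t *\<^sub>R x) powr p \<partial>M) = measure M A * norm x powr p" .
  show ?thesis unfolding Lp_norm_def eq using p by (simp add: powr_mult powr_powr)
qed

lemma charge_apply:
  assumes A: "A \<in> sets F"
  shows "charge A x = \<Lambda> (\<lambda>t. indicator A t *\<^sub>R x)"
proof -
  have "bounded_linear (\<lambda>x. \<Lambda> (\<lambda>t. indicator A t *\<^sub>R x))"
  proof (rule bounded_linear_intro[where K = "K * measure M A powr (1 / p)"])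
    fix x y :: 'x and c :: real
    show "\<Lambda> (\<lambda>t. indicator A t *\<^sub>R (x + y)) = \<Lambda> (\<lambda>t. indicator A t *\<^sub>R x) + \<Lambda> (\<lambda>t. indicator A t *\<^sub>R y)"
      using \<Lambda>_add[OF indicator_scale_bounds(3)[OF A] indicator_scale_bounds(3)[OF A], of x y]
      by (simp add: scaleR_add_right)
    show "\<Lambda> (\<lambda>t. indicator A t *\<^sub>R (c *\<^sub>R x)) = c *\<^sub>R \<Lambda> (\<lambda>t. indicator A t *\<^sub>R x)"
      using \<Lambda>_scale[OF indicator_scale_bounds(3)[OF A], of c x] by (simp add: mult.commute)
    show "norm (\<Lambda> (\<lambda>t. indicator A t *\<^sub>R x)) \<le> norm x * (K * measure M A powr (1 / p))"
      using \<Lambda>_bound[OF indicator_scale_bounds(3)[OF A], of x] Lp_norm_indicator[OF A, of x] by (simp add: mult_ac)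
  qed
  then show ?thesis by (simp add: charge_def bounded_linear_Blinfun_apply)
qed

lemma norm_charge_le:
  assumes A: "A \<in> sets F"
  shows "norm (charge A) \<le> K * measure M A powr (1 / p)"
proof (rule norm_blinfun_bound)
  show "norm (charge A x) \<le> K * measure M A powr (1 / p) * norm x" for x
    using \<Lambda>_bound[OF indicator_scale_bounds(3)[OF A], of x] Lp_norm_indicator[OF A, of x]
    by (simp add: charge_apply[OF A] mult_ac)
qed (simp add: K_nonneg)

lemma charge_Un:
  assumes "A \<in> sets F" "B \<in> sets F" "A \<inter> B = {}"
  shows "charge (A \<union> B) = charge A + charge B"
proof (rule blinfun_eqI)
  fix x :: 'x
  have "(\<lambda>t. indicator (A \<union> B) t *\<^sub>R x) = (\<lambda>t. indicator A t *\<^sub>R x + indicator B t *\<^sub>R x)"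
    using assms(3) by (auto simp: indicator_def fun_eq_iff)
  then show "charge (A \<union> B) x = (charge A + charge B) x"
    using \<Lambda>_add[OF indicator_scale_bounds(3)[OF assms(1)] indicator_scale_bounds(3)[OF assms(2)], of x x] assms
    by (simp add: charge_apply blinfun.add_left)
qed

lemma charge_empty: "charge {} = 0"
  using charge_Un[of "{}" "{}"] by simp

text \<open>The remainder after \<open>n\<close> terms is the charge of \<open>B - U n\<close>,
  whose norm is at most \<open>K * measure M (B - U n) powr (1 / p)\<close>; as \<open>1 / p\<close>
  is positive, this tends to zero.\<close>

lemma vector_measure_charge: "vector_measure (restr_to_subalg M F) charge"
  unfolding vector_measure_def
proof (intro allI impI)
  fix A :: "nat \<Rightarrow> 'a set" assume "range A \<subseteq> sets (restr_to_subalg M F)" and dis: "disjoint_family A"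
  then have A: "A i \<in> sets F" for i using sets_restr_to_subalg[OF subalg] by auto
  define U where "U n = (\<Union>i<n. A i)" for n
  define B where "B = (\<Union>i. A i)"
  have U: "U n \<in> sets F" "U n \<subseteq> B" for n using A by (auto simp: U_def B_def)
  have B: "B \<in> sets F" using A by (auto simp: B_def)
  have sum: "charge (U n) = (\<Sum>i<n. charge (A i))" for n
  proof (induction n)
    case (Suc n)
    have "U (Suc n) = A n \<union> U n" by (auto simp: U_def lessThan_Suc)
    moreover have "A n \<inter> A i = {}" if "i < n" for i by (rule disjoint_family_onD[OF dis]) (use that in auto)
    then have "A n \<inter> U n = {}" by (auto simp: U_def)
    ultimately show ?case using charge_Un[OF A U(1)] Suc by simp
  qed (simp add: U_def charge_empty)
  have "(\<lambda>n. measure M (U n)) \<longlonglongrightarrow> measure M (\<Union>n. U n)"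
    using U sets_subalg by (intro finite_Lim_measure_incseq) (auto simp: U_def incseq_def intro: less_le_trans)
  moreover have "(\<Union>n. U n) = B" by (auto simp: U_def B_def)
  ultimately have "(\<lambda>n. measure M B - measure M (U n)) \<longlonglongrightarrow> measure M B - measure M B"
    by (intro tendsto_diff tendsto_const) simp
  moreover have "measure M (B - U n) = measure M B - measure M (U n)" for n
    using U B sets_subalg by (intro finite_measure_Diff) auto
  ultimately have "(\<lambda>n. measure M (B - U n)) \<longlonglongrightarrow> 0" by simp
  then have "(\<lambda>n. measure M (B - U n) powr (1 / p)) \<longlonglongrightarrow> 0"
    using p by (intro tendsto_zero_powrI[where b = "1 / p"]) (auto intro!: tendsto_const)
  then have lim0: "(\<lambda>n. K * measure M (B - U n) powr (1 / p)) \<longlonglongrightarrow> 0"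
    by (rule tendsto_mult_right_zero)
  have le: "norm (charge (U n) - charge B) \<le> K * measure M (B - U n) powr (1 / p)" for n
  proof -
    have "B = U n \<union> (B - U n)" using U(2) by blast
    then have "charge B = charge (U n) + charge (B - U n)"
      using charge_Un[of "U n" "B - U n"] U(1) B by (metis Diff_disjoint sets.Diff)
    then show ?thesis using norm_charge_le[of "B - U n"] U(1) B by (simp add: norm_minus_commute)
  qed
  have "(\<lambda>n. charge (U n) - charge B) \<longlonglongrightarrow> 0"
    by (rule Lim_null_comparison[OF _ lim0]) (simp only: le eventually_True)
  then show "(\<lambda>i. charge (A i)) sums charge (\<Union>i. A i)"
    by (simp add: sums_def sum[symmetric] B_def LIM_zero_iff)
qed

text \<open>A functional need not attain its norm on the unit ball, hence the loss
  \<open>e\<close>.\<close>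

lemma ex_almost_norming_vector:
  fixes \<xi> :: "'z::real_normed_vector \<Rightarrow>\<^sub>L real"
  assumes "0 < e"
  shows "\<exists>x. norm x \<le> 1 \<and> norm \<xi> - e \<le> \<xi> x"
proof (rule ccontr)
  assume neg: "\<not> ?thesis"
  then have less: "\<xi> x < norm \<xi> - e" if "norm x \<le> 1" for x using that by force
  have pos: "0 < norm \<xi> - e" using less[of 0] by simp
  have "norm \<xi> \<le> norm \<xi> - e"
  proof (rule norm_blinfun_bound)
    fix x
    show "norm (\<xi> x) \<le> (norm \<xi> - e) * norm x"
    proof (cases "x = 0")
      case False
      have "\<xi> (x /\<^sub>R norm x) < norm \<xi> - e" "\<xi> (- (x /\<^sub>R norm x)) < norm \<xi> - e"
        using False by (intro less; simp)+
      then have "\<xi> x / norm x < norm \<xi> - e" "- (\<xi> x / norm x) < norm \<xi> - e"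
        by (simp_all add: blinfun.scaleR_right blinfun.minus_right divide_inverse_commute)
      then have "\<xi> x < (norm \<xi> - e) * norm x" "- \<xi> x < (norm \<xi> - e) * norm x"
        using False by (simp_all add: field_simps)
      then show ?thesis by simp
    qed simp
  qed (use pos in simp)
  then show False using assms by simp
qed

text \<open>Almost norming vectors \<open>x A\<close> on the members of a partition form a step
  function of norm at most 1, because the members are disjoint. The functional at this step function
  is the sum of the \<open>charge A (x A)\<close>, so continuity bounds the variation.\<close>

lemma bounded_variation_charge: "bounded_variation (restr_to_subalg M F) charge"
  unfolding bounded_variation_def
proof (intro exI allI impI)
  fix P assume "finite P \<and> P \<subseteq> sets (restr_to_subalg M F) \<and> partition_on (space (restr_to_subalg M F)) P"
  then have P: "finite P" "\<And>A. A \<in> P \<Longrightarrow> A \<in> sets F" "disjoint P"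
    using sets_restr_to_subalg[OF subalg] by (auto simp: partition_on_def)
  show "(\<Sum>A\<in>P. norm (charge A)) \<le> K * measure M (space M) powr (1 / p)"
  proof (rule field_le_epsilon)
    fix e :: real assume e: "0 < e"
    \<comment> \<open>The permitted loss is shared among the members of the partition; the added 1
      keeps the denominator positive when \<open>P\<close> is empty.\<close>
    define d where "d = e / (real (card P) + 1)"
    have d: "0 < d" using e by (simp add: d_def)
    have "\<exists>x. norm x \<le> 1 \<and> norm (charge A) - d \<le> charge A x" for A
      by (rule ex_almost_norming_vector[OF d])
    then obtain x where x: "\<And>A. norm (x A) \<le> 1" "\<And>A. norm (charge A) - d \<le> charge A (x A)" by metis
    define u where "u t = (\<Sum>A\<in>P. indicator A t *\<^sub>R x A)" for t
    have u_le: "norm (u t) \<le> 1" for t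
    proof (cases "\<exists>A\<in>P. t \<in> A")
      case True
      then obtain A where A: "A \<in> P" "t \<in> A" by blast
      have "t \<notin> B" if "B \<in> P" "B \<noteq> A" for B
        using P(3) A that by (auto simp: disjoint_def)
      then have "u t = (\<Sum>B\<in>P. if B = A then x A else 0)"
        unfolding u_def using A by (intro sum.cong) (auto simp: indicator_def)
      then show ?thesis using A P(1) x(1) by simp
    next
      case False
      then have "u t = 0" unfolding u_def by (intro sum.neutral) (auto simp: indicator_def)
      then show ?thesis by simp
    qed
    have um: "u \<in> borel_measurable F" unfolding u_def[abs_def] using P(2) by (intro borel_measurable_sum indicator_scale_bounds)
    have "\<Lambda> u = (\<Sum>A\<in>P. charge A (x A))"
      unfolding u_def[abs_def] using P indicator_scale_bounds(1,2)
      by (subst \<Lambda>_sum[where R = "\<lambda>A. norm (x A)"]) (auto simp: charge_apply)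
    moreover have "\<bar>\<Lambda> u\<bar> \<le> K * Lp_norm M p u"
      by (rule \<Lambda>_bound[OF Lp_fun_bounded[OF um u_le p]])
    moreover have "Lp_norm M p u \<le> measure M (space M) powr (1 / p)"
    proof (rule Lp_norm_le[where h = "\<lambda>_. 1"])
      show "AE t in M. norm (u t) powr p \<le> 1" using u_le p by (auto intro!: powr_le1)
    qed (use measurable_from_subalg[OF subalg um] in auto)
    ultimately have "(\<Sum>A\<in>P. charge A (x A)) \<le> K * measure M (space M) powr (1 / p)"
      using mult_left_mono[OF _ K_nonneg, of "Lp_norm M p u"] by (smt (verit))
    moreover have "(\<Sum>A\<in>P. norm (charge A)) \<le> (\<Sum>A\<in>P. charge A (x A) + d)"
      using x(2) by (intro sum_mono) (simp add: algebra_simps)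
    moreover have "(\<Sum>A\<in>P. d) \<le> e" using e by (simp add: d_def field_simps)
    ultimately show "(\<Sum>A\<in>P. norm (charge A)) \<le> K * measure M (space M) powr (1 / p) + e"
      by (simp add: sum.distrib)
  qed
qed

end

section \<open>Approximation of a functional by simple densities\<close>

context Lp_functional
begin

text \<open>On step functions the error is a sum of values at disjoint sets of a measure with total
  mass below \<open>\<epsilon>\<close>, so it does not grow with the number of steps. Bounded
  convergence extends this to bounded functions, and the factor 2 is the cost of approximating
  them.\<close>

lemma ex_simple_density:
  assumes rnp: "radon_nikodym_property TYPE('a) TYPE('x \<Rightarrow>\<^sub>L real)" and \<epsilon>: "0 < \<epsilon>"
  shows "\<exists>s. simple_function (restr_to_subalg M F) s \<and>
    (\<forall>u R. u \<in> borel_measurable F \<longrightarrow> (\<forall>t. norm (u t) \<le> R) \<longrightarrow>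
      \<bar>\<Lambda> u - (\<integral>t. blinfun_apply (s t) (u t) \<partial>M)\<bar> \<le> 2 * R * \<epsilon>)"
proof -
  let ?N = "restr_to_subalg M F"
  have setsN: "sets ?N = sets F" and spaceN: "space ?N = space M"
    by (simp_all add: sets_restr_to_subalg[OF subalg] space_restr_to_subalg)
  interpret N: finite_measure ?N
    by (rule finite_measure_restr_to_subalg[OF subalg]) (rule finite_measure_axioms)
  have null: "charge A = 0" if "A \<in> null_sets ?N" for A
  proof -
    have A: "A \<in> sets F" "measure M A = 0"
      using that null_sets_restr_to_subalg[OF subalg] by (auto simp: measure_def)
    then have "norm (charge A) \<le> 0" using norm_charge_le[OF A(1)] p by simp
    then show ?thesis by simp
  qed
  obtain s e where s: "simple_function ?N s" and e: "e \<in> borel_measurable ?N" "(\<integral>\<^sup>+t. e t \<partial>?N) < ennreal \<epsilon>"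
    and bound: "\<And>A. A \<in> sets ?N \<Longrightarrow>
      ennreal (norm (charge A - Bochner_Integration.simple_bochner_integral ?N (\<lambda>t. indicator A t *\<^sub>R s t)))
        \<le> (\<integral>\<^sup>+t. e t * indicator A t \<partial>?N)"
    using radon_nikodym_simple_approx[OF rnp N.finite_measure_axioms vector_measure_charge bounded_variation_charge null, of "ennreal \<epsilon>"] \<epsilon>
    by auto
  \<comment> \<open>The error measure: its values on disjoint pieces add up to at most
    \<open>\<epsilon>\<close>.\<close>
  define D where "D = density ?N e"
  have emD: "emeasure D A = (\<integral>\<^sup>+t. e t * indicator A t \<partial>?N)" if "A \<in> sets F" for A
    unfolding D_def using that e(1) setsN by (simp add: emeasure_density)
  have setsD: "sets D = sets F" "space D = space M" by (simp_all add: D_def setsN spaceN)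
  have "emeasure D (space D) = (\<integral>\<^sup>+t. e t \<partial>?N)"
    unfolding D_def using e(1) by (auto simp: emeasure_density intro!: nn_integral_cong)
  then have Dfin: "emeasure D (space D) < ennreal \<epsilon>" using e(2) by simp
  then interpret D: finite_measure D by (intro finite_measureI) auto
  have D\<epsilon>: "measure D A \<le> \<epsilon>" for A
  proof -
    have "measure D A \<le> measure D (space D)" by (rule D.bounded_measure)
    also have "ennreal \<dots> \<le> ennreal \<epsilon>" using Dfin by (simp add: D.emeasure_eq_measure)
    then have "measure D (space D) \<le> \<epsilon>" using \<epsilon> by simp
    finally show ?thesis .
  qed
  have sm: "s \<in> measurable ?N (count_space UNIV)" using s by (rule measurable_simple_function)
  have sfin: "finite (s ` space M)" using simple_functionD(1)[OF s] by (simp add: spaceN)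
  define S where "S y = {t \<in> space M. s t = y}" for y
  have SF: "S y \<in> sets F" for y
  proof -
    have "S y = s -` {y} \<inter> space ?N" by (auto simp: S_def spaceN)
    then show ?thesis using measurable_sets[OF sm, of "{y}"] setsN by simp
  qed
  have s_sum: "s t x = (\<Sum>y\<in>s ` space M. indicator (S y) t * y x)" if "t \<in> space M" for t x
  proof -
    have "(\<Sum>y\<in>s ` space M. indicator (S y) t * y x) = (\<Sum>y\<in>s ` space M. if y = s t then s t x else 0)"
      using that by (intro sum.cong) (auto simp: S_def indicator_def)
    then show ?thesis using that sfin by simp
  qed
  have s_meas: "(\<lambda>t. s t (u t)) \<in> borel_measurable F" if u: "u \<in> borel_measurable F" for u
  proof -
    have "(\<lambda>t. \<Sum>y\<in>s ` space M. indicator (S y) t * y (u t)) \<in> borel_measurable F"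
      using SF by (intro borel_measurable_sum borel_measurable_times measurable_compose[OF u borel_measurable_blinfun]) auto
    then show ?thesis
      by (rule measurable_cong[THEN iffD1, rotated]) (simp add: s_sum[symmetric] space_subalg)
  qed
  obtain C where C: "\<And>t. t \<in> space M \<Longrightarrow> norm (s t) \<le> C" "0 \<le> C"
  proof -
    have "norm (s t) \<le> (\<Sum>y\<in>s ` space M. norm y)" if "t \<in> space M" for t
      using sfin that by (intro member_le_sum) auto
    then show ?thesis using that by (meson norm_ge_zero sum_nonneg)
  qed
  have s_bd: "AE t in M. norm (s t (u t)) \<le> C * R" if "\<And>t. norm (u t) \<le> R" for u R
  proof (rule AE_I2)
    fix t assume t: "t \<in> space M"
    have "norm (s t (u t)) \<le> norm (s t) * norm (u t)" by (rule norm_blinfun)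
    also have "\<dots> \<le> C * R" using C t that by (intro mult_mono) auto
    finally show "norm (s t (u t)) \<le> C * R" .
  qed
  have s_int: "integrable M (\<lambda>t. s t (u t))" if "u \<in> borel_measurable F" "\<And>t. norm (u t) \<le> R" for u R
    using s_bd[OF that(2)] measurable_from_subalg[OF subalg s_meas[OF that(1)]]
    by (intro integrable_const_bound[where B = "C * R"]) auto
  have atom: "\<bar>\<Lambda> (\<lambda>t. indicator A t *\<^sub>R x) - (\<integral>t. s t (indicator A t *\<^sub>R x) \<partial>M)\<bar> \<le> norm x * measure D A"
    if A: "A \<in> sets F" for A x
  proof -
    let ?I = "Bochner_Integration.simple_bochner_integral ?N (\<lambda>t. indicator A t *\<^sub>R s t)"
    have sA: "Bochner_Integration.simple_bochner_integrable ?N (\<lambda>t. indicator A t *\<^sub>R s t)"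
    proof (rule Bochner_Integration.simple_bochner_integrable.intros)
      show "simple_function ?N (\<lambda>t. indicator A t *\<^sub>R s t)"
        using A setsN by (intro simple_function_scaleR[OF simple_function_indicator s]) simp
    qed (simp add: N.emeasure_eq_measure)
    have lin: "linear (\<lambda>\<xi>::'x \<Rightarrow>\<^sub>L real. \<xi> x)"
      by (intro linearI) (simp_all add: blinfun.add_left blinfun.scaleR_left)
    have "?I x = Bochner_Integration.simple_bochner_integral ?N (\<lambda>t. (indicator A t *\<^sub>R s t) x)"
      by (rule Bochner_Integration.simple_bochner_integral_linear[OF lin sA, symmetric])
    also have "\<dots> = (\<integral>t. (indicator A t *\<^sub>R s t) x \<partial>?N)"
      by (intro Bochner_Integration.simple_bochner_integrable_eq_integral
          Bochner_Integration.simple_bochner_integrable_compose2[where p = "\<lambda>\<xi> _. blinfun_apply \<xi> x", OF _ sA sA]) simp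
    also have "\<dots> = (\<integral>t. s t (indicator A t *\<^sub>R x) \<partial>?N)"
      by (simp add: blinfun.scaleR_left blinfun.scaleR_right)
    also have "\<dots> = (\<integral>t. s t (indicator A t *\<^sub>R x) \<partial>M)"
      by (rule integral_subalgebra2[OF subalg s_meas[OF indicator_scale_bounds(1)[OF A]]])
    finally have I: "?I x = (\<integral>t. s t (indicator A t *\<^sub>R x) \<partial>M)" .
    have "ennreal (norm (charge A - ?I)) \<le> ennreal (measure D A)"
      using bound[of A] A setsN emD[OF A] by (simp only: D.emeasure_eq_measure)
    then have "norm (charge A - ?I) \<le> measure D A" by simp
    then have "norm ((charge A - ?I) x) \<le> measure D A * norm x"
      using norm_blinfun[of "charge A - ?I" x] mult_right_mono[of _ _ "norm x"] by (meson norm_ge_zero order_trans)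
    then show ?thesis by (simp add: blinfun.diff_left I charge_apply[OF A] mult.commute)
  qed
  have simple: "\<bar>\<Lambda> u - (\<integral>t. s t (u t) \<partial>M)\<bar> \<le> R * \<epsilon>"
    if u: "simple_function ?N u" "\<And>t. t \<in> space M \<Longrightarrow> norm (u t) \<le> R" and R: "0 \<le> R" for u R
  proof -
    define X where "X = u ` space M"
    have X: "finite X" using simple_functionD(1)[OF u(1)] by (simp add: X_def spaceN)
    define B where "B x = {t \<in> space M. u t = x}" for x
    have BF: "B x \<in> sets F" for x
    proof -
      have "B x = u -` {x} \<inter> space ?N" by (auto simp: B_def spaceN)
      then show ?thesis using simple_functionD(2)[OF u(1), of "{x}"] setsN by simp
    qed
    define v where "v t = (\<Sum>x\<in>X. indicator (B x) t *\<^sub>R x)" for t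
    have uv: "u t = v t" if "t \<in> space M" for t
    proof -
      have "v t = (\<Sum>x\<in>X. if x = u t then u t else 0)"
        unfolding v_def using that by (intro sum.cong) (auto simp: B_def indicator_def)
      then show ?thesis using that X by (simp add: X_def)
    qed
    have "\<Lambda> u = \<Lambda> v" by (rule \<Lambda>_cong) (use uv in \<open>auto intro!: AE_I2\<close>)
    also have "\<dots> = (\<Sum>x\<in>X. \<Lambda> (\<lambda>t. indicator (B x) t *\<^sub>R x))"
      unfolding v_def using X indicator_scale_bounds[OF BF] by (intro \<Lambda>_sum[where R = norm]) auto
    finally have 1: "\<Lambda> u = (\<Sum>x\<in>X. \<Lambda> (\<lambda>t. indicator (B x) t *\<^sub>R x))" .
    have "(\<integral>t. s t (u t) \<partial>M) = (\<integral>t. (\<Sum>x\<in>X. s t (indicator (B x) t *\<^sub>R x)) \<partial>M)"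
      by (rule Bochner_Integration.integral_cong) (simp_all add: uv v_def blinfun.sum_right)
    also have "\<dots> = (\<Sum>x\<in>X. \<integral>t. s t (indicator (B x) t *\<^sub>R x) \<partial>M)"
      using s_int[OF indicator_scale_bounds(1,2)[OF BF]] by (intro Bochner_Integration.integral_sum) auto
    finally have 2: "(\<integral>t. s t (u t) \<partial>M) = (\<Sum>x\<in>X. \<integral>t. s t (indicator (B x) t *\<^sub>R x) \<partial>M)" .
    have "\<bar>\<Lambda> u - (\<integral>t. s t (u t) \<partial>M)\<bar> \<le> (\<Sum>x\<in>X. norm x * measure D (B x))"
      unfolding 1 2 sum_subtractf[symmetric] using atom[OF BF] by (intro order_trans[OF sum_abs] sum_mono)
    also have "\<dots> \<le> (\<Sum>x\<in>X. R * measure D (B x))"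
      using u(2) by (intro sum_mono mult_right_mono) (auto simp: X_def)
    also have "\<dots> = R * measure D (\<Union>x\<in>X. B x)"
    proof -
      have "disjoint_family_on B X" by (auto simp: disjoint_family_on_def B_def)
      then have "measure D (\<Union>x\<in>X. B x) = (\<Sum>x\<in>X. measure D (B x))"
        using X BF setsD by (intro D.finite_measure_finite_Union) auto
      then show ?thesis by (simp add: sum_distrib_left)
    qed
    also have "\<dots> \<le> R * \<epsilon>" using R D\<epsilon> by (intro mult_left_mono)
    finally show ?thesis .
  qed
  have "\<bar>\<Lambda> u - (\<integral>t. s t (u t) \<partial>M)\<bar> \<le> 2 * R * \<epsilon>"
    if u: "u \<in> borel_measurable F" "\<And>t. norm (u t) \<le> R" for u R
  proof -
    have "u \<in> borel_measurable ?N" by (rule measurable_in_subalg[OF subalg u(1)])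
    \<comment> \<open>The simple approximants are only bounded by twice the norm of
      \<open>u\<close>, whence \<open>2 * R\<close> below.\<close>
    from borel_measurable_implies_sequence_metric[OF this, of 0]
    obtain w where "(\<forall>i. simple_function ?N (w i)) \<and> (\<forall>t\<in>space ?N. (\<lambda>i. w i t) \<longlonglongrightarrow> u t) \<and>
      (\<forall>i. \<forall>t\<in>space ?N. dist (w i t) 0 \<le> 2 * dist (u t) 0)" by (elim exE)
    then have w: "\<And>i. simple_function ?N (w i)" "\<And>t. t \<in> space M \<Longrightarrow> (\<lambda>i. w i t) \<longlonglongrightarrow> u t"
      and wb: "\<And>i t. t \<in> space M \<Longrightarrow> norm (w i t) \<le> 2 * norm (u t)"
      by (simp_all add: spaceN)
    have wb2: "norm (w i t) \<le> 2 * R" if "t \<in> space M" for i t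
      using wb[OF that, of i] u(2)[of t] by simp
    \<comment> \<open>The continuity of the functional is stated for functions bounded at every
      point, so the approximants are set to zero outside of the space.\<close>
    define w' where "w' i t = (if t \<in> space M then w i t else 0)" for i t
    have R: "0 \<le> R" using u(2) norm_ge_zero order_trans by blast
    have w'F: "w' i \<in> borel_measurable F" for i
    proof -
      have "w i \<in> borel_measurable F"
        using borel_measurable_simple_function[OF w(1)] by (rule measurable_in_subalg'[OF subalg])
      then show ?thesis
        by (rule measurable_cong[THEN iffD1, rotated]) (simp add: w'_def space_subalg)
    qed
    have w'b: "norm (w' i t) \<le> 2 * R" for i t using wb2 R by (simp add: w'_def)
    have w'lim: "AE t in M. (\<lambda>i. w' i t) \<longlonglongrightarrow> u t" using w(2) by (intro AE_I2) (simp add: w'_def)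
    have "(\<lambda>i. \<Lambda> (w' i)) \<longlonglongrightarrow> \<Lambda> u"
      using w'F w'b u w'lim R by (intro \<Lambda>_bounded_limit[where R = "2 * R"]) (auto intro: order_trans[of _ R])
    moreover have "(\<lambda>i. \<integral>t. s t (w' i t) \<partial>M) \<longlonglongrightarrow> (\<integral>t. s t (u t) \<partial>M)"
    proof (rule integral_dominated_convergence[where w = "\<lambda>_. C * (2 * R)"])
      show "AE t in M. (\<lambda>i. s t (w' i t)) \<longlonglongrightarrow> s t (u t)"
        using w'lim by eventually_elim (intro tendsto_intros)
      show "AE t in M. norm (s t (w' i t)) \<le> C * (2 * R)" for i by (rule s_bd[OF w'b])
      show "(\<lambda>t. s t (u t)) \<in> borel_measurable M"
        by (rule measurable_from_subalg[OF subalg s_meas[OF u(1)]])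
      show "(\<lambda>t. s t (w' i t)) \<in> borel_measurable M" for i
        by (rule measurable_from_subalg[OF subalg s_meas[OF w'F]])
    qed simp
    ultimately have "(\<lambda>i. \<bar>\<Lambda> (w' i) - (\<integral>t. s t (w' i t) \<partial>M)\<bar>) \<longlonglongrightarrow> \<bar>\<Lambda> u - (\<integral>t. s t (u t) \<partial>M)\<bar>"
      by (intro tendsto_intros)
    moreover have "\<bar>\<Lambda> (w' i) - (\<integral>t. s t (w' i t) \<partial>M)\<bar> \<le> 2 * R * \<epsilon>" for i
    proof -
      have "\<Lambda> (w' i) = \<Lambda> (w i)" by (rule \<Lambda>_cong) (auto simp: w'_def intro!: AE_I2)
      moreover have "(\<integral>t. s t (w' i t) \<partial>M) = (\<integral>t. s t (w i t) \<partial>M)"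
        by (rule Bochner_Integration.integral_cong) (auto simp: w'_def)
      ultimately show ?thesis using simple[OF w(1) wb2, of i] R by simp
    qed
    ultimately show ?thesis by (intro LIMSEQ_le_const2[of "\<lambda>i. \<bar>\<Lambda> (w' i) - (\<integral>t. s t (w' i t) \<partial>M)\<bar>"]) auto
  qed
  then show ?thesis using s by blast
qed

end

context finite_measure_subalgebra
begin

text \<open>Jensen's inequality for the power on the open half-line makes the conditional
  expectation of \<open>h\<close> a dominating function in \<open>L_p\<close>; the bound
  \<open>1 \<le> h t\<close> keeps the values in that half-line.\<close>

lemma
  fixes f :: "'a \<Rightarrow> 'x::{banach, second_countable_topology}"
  assumes p: "1 \<le> p" and h: "integrable M h" "integrable M (\<lambda>t. h t powr p)" "\<And>t. 1 \<le> h t"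
  shows integrable_cond_exp_powr: "integrable M (\<lambda>t. real_cond_exp M F h t powr p)"
    and cond_exp_norm_le: "\<And>f g. integrable M f \<Longrightarrow> AE t in M. norm (f t) \<le> h t \<Longrightarrow> is_cond_exp M F f g \<Longrightarrow>
      AE t in M. norm (g t) \<le> real_cond_exp M F h t"
    and Lp_fun_cond_exp: "integrable M f \<Longrightarrow> AE t in M. norm (f t) \<le> h t \<Longrightarrow> is_cond_exp M F f g \<Longrightarrow>
      g \<in> Lp_fun M F p"
proof -
  have h0: "AE t in M. h t \<in> {0<..}" using h(3) by (auto intro!: AE_I2 less_le_trans[OF zero_less_one])
  have q: "convex_on {0<..} (\<lambda>x. x powr p)" "(\<lambda>x::real. x powr p) \<in> borel_measurable borel"
    using powr_convex[OF p] by auto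
  show int: "integrable M (\<lambda>t. real_cond_exp M F h t powr p)"
    by (rule integrable_convex_cond_exp[OF h(1) h0 _ h(2) q]) auto
  show le: "AE t in M. norm (g t) \<le> real_cond_exp M F h t"
    if f: "integrable M f" "AE t in M. norm (f t) \<le> h t" "is_cond_exp M F f g" for f g :: "'a \<Rightarrow> 'z::{banach, second_countable_topology}"
  proof -
    have "AE t in M. real_cond_exp M F (\<lambda>t. norm (f t)) t \<le> real_cond_exp M F h t"
      using f h by (intro real_cond_exp_mono) auto
    then show ?thesis using is_cond_exp_norm_le[OF f(1,3)] by eventually_elim simp
  qed
  assume f: "integrable M f" "AE t in M. norm (f t) \<le> h t" "is_cond_exp M F f g"
  have "g \<in> borel_measurable F" "integrable M g" using f(3) by (auto simp: is_cond_exp_def)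
  moreover from this have "integrable M (\<lambda>t. norm (g t) powr p)"
    by (intro integrable_powr_bounded[OF _ le[OF f] int p]) auto
  ultimately show "g \<in> Lp_fun M F p" by (simp add: Lp_fun_def)
qed

end

section \<open>Weak convergence of conditional expectations\<close>

context Lp_functional
begin

lemma Lp_fun_indicator:
  assumes "g \<in> Lp_fun M F p" "A \<in> sets F"
  shows "(\<lambda>t. indicator A t *\<^sub>R g t) \<in> Lp_fun M F p"
proof -
  have g: "g \<in> borel_measurable F" "integrable M g" "integrable M (\<lambda>t. norm (g t) powr p)"
    using assms(1) by (auto simp: Lp_fun_def)
  have AM: "A \<in> sets M" by (rule sets_subalg[OF assms(2)])
  have i1: "integrable M (\<lambda>t. indicator A t *\<^sub>R g t)" by (rule integrable_mult_indicator[OF AM g(2)])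
  moreover have "integrable M (\<lambda>t. norm (indicator A t *\<^sub>R g t) powr p)"
  proof (rule Bochner_Integration.integrable_bound[OF g(3)])
    show "(\<lambda>t. norm (indicator A t *\<^sub>R g t) powr p) \<in> borel_measurable M"
      using borel_measurable_integrable[OF i1] by measurable
  qed (auto simp: indicator_def intro!: AE_I2)
  moreover have "(\<lambda>t. indicator A t *\<^sub>R g t) \<in> borel_measurable F" using g(1) assms(2) by measurable
  ultimately show ?thesis by (simp add: Lp_fun_def)
qed

text \<open>On each level set of \<open>s\<close> the pairing is with one fixed functional, and the
  level sets belong to \<open>F\<close>, so there \<open>g\<close> can be replaced by
  \<open>f\<close>. Only the integrals of \<open>f\<close> over sets of \<open>F\<close>
  remain.\<close>

lemma integral_simple_density:
  fixes f :: "'a \<Rightarrow> 'x" and s :: "'a \<Rightarrow> ('x \<Rightarrow>\<^sub>L real)"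
  assumes s: "simple_function (restr_to_subalg M F) s" and A: "A \<in> sets F"
    and f: "integrable M f" and g: "is_cond_exp M F f g"
  shows "(\<integral>t. blinfun_apply (s t) (indicator A t *\<^sub>R g t) \<partial>M) =
    (\<Sum>y\<in>s ` space M. blinfun_apply y (LINT t:A \<inter> {t \<in> space M. s t = y}|M. f t))"
proof -
  have sfin: "finite (s ` space M)" using simple_functionD(1)[OF s] by (simp add: space_restr_to_subalg)
  define S where "S y = A \<inter> {t \<in> space M. s t = y}" for y
  have SF: "S y \<in> sets F" for y
  proof -
    have "{t \<in> space M. s t = y} = s -` {y} \<inter> space (restr_to_subalg M F)"
      by (auto simp: space_restr_to_subalg)
    then show ?thesis using simple_functionD(2)[OF s, of "{y}"] A
      by (simp add: S_def sets_restr_to_subalg[OF subalg] sets.Int)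
  qed
  have gi: "integrable M g" using g by (simp add: is_cond_exp_def)
  have "(\<integral>t. blinfun_apply (s t) (indicator A t *\<^sub>R g t) \<partial>M) = (\<integral>t. (\<Sum>y\<in>s ` space M. indicator (S y) t *\<^sub>R y (g t)) \<partial>M)"
  proof (rule Bochner_Integration.integral_cong)
    fix t assume t: "t \<in> space M"
    have "(\<Sum>y\<in>s ` space M. indicator (S y) t *\<^sub>R y (g t)) = (\<Sum>y\<in>s ` space M. if y = s t then indicator A t *\<^sub>R s t (g t) else 0)"
      using t by (intro sum.cong) (auto simp: S_def indicator_def)
    then show "s t (indicator A t *\<^sub>R g t) = (\<Sum>y\<in>s ` space M. indicator (S y) t *\<^sub>R y (g t))"
      using t sfin by (simp add: blinfun.scaleR_right)
  qed simp
  also have "\<dots> = (\<Sum>y\<in>s ` space M. LINT t:S y|M. y (g t))"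
  proof -
    have "integrable M (\<lambda>t. indicator (S y) t *\<^sub>R y (g t))" for y
    proof (rule integrable_mult_indicator)
      show "S y \<in> sets M" by (rule sets_subalg[OF SF])
      show "integrable M (\<lambda>t. y (g t))" by (rule integrable_blinfun[OF gi])
    qed
    then show ?thesis
    unfolding set_lebesgue_integral_def
      by (rule Bochner_Integration.integral_sum)
  qed
  also have "\<dots> = (\<Sum>y\<in>s ` space M. y (LINT t:S y|M. f t))"
    using g SF by (intro sum.cong) (auto simp: set_integral_blinfun[OF gi] sets_subalg is_cond_exp_def)
  finally show ?thesis by (simp add: S_def)
qed

text \<open>The conditional expectation \<open>\<eta>\<close> of \<open>h\<close> dominates all the
  functions \<open>g n\<close> and \<open>g'\<close>. Where \<open>\<eta>\<close> is at most
  \<open>R\<close> they are bounded, and the functional is nearly a finite combination of convergent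
  integrals; the remainder is small in the \<open>p\<close>-norm uniformly in
  \<open>n\<close>.\<close>

lemma \<Lambda>_cond_exp_limit:
  fixes f :: "nat \<Rightarrow> 'a \<Rightarrow> 'x"
  assumes rnp: "radon_nikodym_property TYPE('a) TYPE('x \<Rightarrow>\<^sub>L real)"
    and h: "integrable M h" "integrable M (\<lambda>t. h t powr p)" "\<And>t. 1 \<le> h t"
    and f: "\<And>n. integrable M (f n)" "\<And>n. AE t in M. norm (f n t) \<le> h t" "\<And>n. is_cond_exp M F (f n) (g n)"
    and f': "integrable M f'" "AE t in M. norm (f' t) \<le> h t" "is_cond_exp M F f' g'"
    and lim: "\<And>A \<xi>::'x \<Rightarrow>\<^sub>L real. A \<in> sets F \<Longrightarrow> (\<lambda>n. \<xi> (LINT t:A|M. f n t)) \<longlonglongrightarrow> \<xi> (LINT t:A|M. f' t)"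
  shows "(\<lambda>n. \<Lambda> (g n)) \<longlonglongrightarrow> \<Lambda> g'"
proof (rule tendstoI)
  fix e :: real assume e: "0 < e"
  define \<eta> where "\<eta> = real_cond_exp M F h"
  have \<eta>F: "\<eta> \<in> borel_measurable F" by (simp add: \<eta>_def)
  have \<eta>M: "\<eta> \<in> borel_measurable M" by (rule measurable_from_subalg[OF subalg \<eta>F])
  have \<eta>p: "integrable M (\<lambda>t. \<eta> t powr p)" unfolding \<eta>_def by (rule integrable_cond_exp_powr[OF p h])
  define T where "T R = {t \<in> space F. real R < \<eta> t}" for R :: nat
  define A where "A R = {t \<in> space F. \<eta> t \<le> real R}" for R :: nat
  have TF: "T R \<in> sets F" and AF: "A R \<in> sets F" for R
    unfolding T_def A_def using \<eta>F by measurable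
  define \<theta> where "\<theta> R = (\<integral>t. indicator (T R) t * \<eta> t powr p \<partial>M)" for R
  have \<theta>int: "integrable M (\<lambda>t. indicator (T R) t * \<eta> t powr p)" for R
    using integrable_mult_indicator[OF sets_subalg[OF TF] \<eta>p] by simp
  have "\<theta> \<longlonglongrightarrow> (\<integral>t. 0 \<partial>M)" unfolding \<theta>_def
  proof (rule integral_dominated_convergence[where w = "\<lambda>t. \<eta> t powr p"])
    show "AE t in M. (\<lambda>R. indicator (T R) t * \<eta> t powr p) \<longlonglongrightarrow> 0"
    proof (rule AE_I2, rule tendsto_eventually)
      fix t
      obtain R0 :: nat where "\<eta> t \<le> real R0" using real_arch_simple by blast
      then show "\<forall>\<^sub>F R in sequentially. indicator (T R) t * \<eta> t powr p = 0"
        by (intro eventually_sequentiallyI[of R0]) (auto simp: T_def)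
    qed
  qed (use \<eta>p \<theta>int in \<open>auto simp: indicator_def\<close>)
  moreover have "0 \<le> \<theta> R" for R unfolding \<theta>_def by (intro Bochner_Integration.integral_nonneg) simp
  ultimately have "(\<lambda>R. \<theta> R powr (1 / p)) \<longlonglongrightarrow> 0"
    using p by (intro tendsto_zero_powrI[where b = "1 / p"]) (auto intro!: tendsto_const)
  then have "(\<lambda>R. K * \<theta> R powr (1 / p)) \<longlonglongrightarrow> 0" by (rule tendsto_mult_right_zero)
  then obtain R where R: "K * \<theta> R powr (1 / p) < e / 5"
    using order_tendstoD(2)[of "\<lambda>R. K * \<theta> R powr (1 / p)" 0 sequentially "e / 5"] e
    by (auto simp: eventually_sequentially)
  \<comment> \<open>With the factor \<open>2 * R\<close> of the simple density this costs at most
    \<open>e / 5\<close>; the added 1 covers \<open>R = 0\<close>.\<close>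
  define \<epsilon> where "\<epsilon> = e / 10 / (real R + 1)"
  have \<epsilon>: "0 < \<epsilon>" using e by (simp add: \<epsilon>_def)
  have R\<epsilon>: "2 * real R * \<epsilon> \<le> e / 5"
  proof -
    have "2 * real R * \<epsilon> \<le> 2 * (real R + 1) * \<epsilon>" using \<epsilon> by (intro mult_right_mono) auto
    also have "\<dots> = e / 5"
    proof -
      have "(real R + 1) * \<epsilon> = e / 10" 
        unfolding \<epsilon>_def using of_nat_0_le_iff[of R, where ?'a = real] by (simp add: field_simps)
      then show ?thesis by (simp add: algebra_simps)
    qed
    finally show ?thesis .
  qed
  obtain s :: "'a \<Rightarrow> ('x \<Rightarrow>\<^sub>L real)" where s: "simple_function (restr_to_subalg M F) s"
    and approx: "\<And>u R. u \<in> borel_measurable F \<Longrightarrow> (\<And>t. norm (u t) \<le> R) \<Longrightarrow>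
      \<bar>\<Lambda> u - (\<integral>t. blinfun_apply (s t) (u t) \<partial>M)\<bar> \<le> 2 * R * \<epsilon>"
    using ex_simple_density[OF rnp \<epsilon>] by blast
  define I where "I f = (\<Sum>y\<in>s ` space M. blinfun_apply y (LINT t:A R \<inter> {t \<in> space M. s t = y}|M. f t))" for f
  \<comment> \<open>One fifth of \<open>e\<close> for the tail and one for the simple density. This
    is spent on \<open>g n\<close> and again on \<open>g'\<close>, which leaves one fifth for the
    convergence.\<close>
  have near: "\<bar>\<Lambda> g - I f\<bar> \<le> 2 * (e / 5)"
    if fg: "integrable M f" "AE t in M. norm (f t) \<le> h t" "is_cond_exp M F f g" for f g :: "'a \<Rightarrow> 'x"
  proof -
    have gL: "g \<in> Lp_fun M F p" by (rule Lp_fun_cond_exp[OF p h fg])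
    have g\<eta>: "AE t in M. norm (g t) \<le> \<eta> t" unfolding \<eta>_def by (rule cond_exp_norm_le[OF p h fg])
    have gF: "g \<in> borel_measurable F" using fg(3) by (simp add: is_cond_exp_def)
    note gT = Lp_fun_indicator[OF gL TF, of R] and gA = Lp_fun_indicator[OF gL AF, of R]
    have "\<Lambda> g = \<Lambda> (\<lambda>t. indicator (A R) t *\<^sub>R g t + indicator (T R) t *\<^sub>R g t)"
      by (rule \<Lambda>_cong) (auto simp: A_def T_def indicator_def space_subalg intro!: AE_I2)
    also have "\<dots> = \<Lambda> (\<lambda>t. indicator (A R) t *\<^sub>R g t) + \<Lambda> (\<lambda>t. indicator (T R) t *\<^sub>R g t)"
      by (rule \<Lambda>_add[OF gA gT])
    finally have split: "\<Lambda> g = \<Lambda> (\<lambda>t. indicator (A R) t *\<^sub>R g t) + \<Lambda> (\<lambda>t. indicator (T R) t *\<^sub>R g t)" .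
    have "Lp_norm M p (\<lambda>t. indicator (T R) t *\<^sub>R g t) \<le> \<theta> R powr (1 / p)"
    proof (rule Lp_norm_le[OF _ _ \<theta>int])
      show "AE t in M. norm (indicator (T R) t *\<^sub>R g t) powr p \<le> indicator (T R) t * \<eta> t powr p"
        using g\<eta> by eventually_elim (use p in \<open>auto simp: indicator_def intro!: powr_mono2\<close>)
    qed (use gT in \<open>auto simp: Lp_fun_def \<theta>_def\<close>)
    then have "K * Lp_norm M p (\<lambda>t. indicator (T R) t *\<^sub>R g t) \<le> K * \<theta> R powr (1 / p)"
      by (rule mult_left_mono[OF _ K_nonneg])
    then have tail: "\<bar>\<Lambda> (\<lambda>t. indicator (T R) t *\<^sub>R g t)\<bar> \<le> e / 5"
      using \<Lambda>_bound[OF gT] R by linarith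
    \<comment> \<open>The bound by \<open>\<eta>\<close> holds almost everywhere only, so the
      bounded part is cut off once more to be bounded at every point.\<close>
    define u where "u t = (if t \<in> A R \<and> norm (g t) \<le> real R then g t else 0)" for t
    have uF: "u \<in> borel_measurable F" unfolding u_def using gF AF[of R] by measurable
    have ub: "norm (u t) \<le> real R" for t by (simp add: u_def)
    have ug: "AE t in M. u t = indicator (A R) t *\<^sub>R g t"
      using g\<eta> by eventually_elim (auto simp: u_def A_def indicator_def)
    have "(\<integral>t. blinfun_apply (s t) (u t) \<partial>M) = (\<integral>t. blinfun_apply (s t) (indicator (A R) t *\<^sub>R g t) \<partial>M)"
    proof (rule integral_cong_AE)
      have meas: "(\<lambda>t. s t (w t)) \<in> borel_measurable M" if w: "w \<in> borel_measurable M" for w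
      proof (rule measurable_compose_countable'[where f = "\<lambda>(y::'x \<Rightarrow>\<^sub>L real) t. blinfun_apply y (w t)" and g = s and I = "s ` space M"])
        show "(\<lambda>t. blinfun_apply y (w t)) \<in> borel_measurable M" for y :: "'x \<Rightarrow>\<^sub>L real"
          by (rule measurable_compose[OF w borel_measurable_blinfun])
        have sfin: "finite (s ` space M)" using simple_functionD(1)[OF s] by (simp add: space_restr_to_subalg)
        then show "countable (s ` space M)" by (rule countable_finite)
        have "s -` {y} \<inter> space M \<in> sets M" for y
          using simple_functionD(2)[OF s, of "{y}"] by (simp add: space_restr_to_subalg sets_restr_to_subalg[OF subalg] sets_subalg)
        then show "s \<in> M \<rightarrow>\<^sub>M count_space (s ` space M)"
          using sfin by (subst measurable_count_space_eq2) auto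
      qed
      show "(\<lambda>t. blinfun_apply (s t) (u t)) \<in> borel_measurable M"
        by (rule meas[OF measurable_from_subalg[OF subalg uF]])
      show "(\<lambda>t. blinfun_apply (s t) (indicator (A R) t *\<^sub>R g t)) \<in> borel_measurable M"
        by (rule meas) (use gA in \<open>auto simp: Lp_fun_def\<close>)
      show "AE t in M. blinfun_apply (s t) (u t) = blinfun_apply (s t) (indicator (A R) t *\<^sub>R g t)"
        using ug by eventually_elim simp
    qed
    also have "\<dots> = I f" unfolding I_def by (rule integral_simple_density[OF s AF fg(1,3)])
    finally have "\<bar>\<Lambda> u - I f\<bar> \<le> e / 5" using approx[OF uF ub] R\<epsilon> by simp
    moreover have "\<Lambda> u = \<Lambda> (\<lambda>t. indicator (A R) t *\<^sub>R g t)" by (rule \<Lambda>_cong[OF ug])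
    ultimately show ?thesis using split tail by linarith
  qed
  have "(\<lambda>n. I (f n)) \<longlonglongrightarrow> I f'" unfolding I_def
  proof (intro tendsto_sum lim)
    fix y
    have "{t \<in> space M. s t = y} = s -` {y} \<inter> space (restr_to_subalg M F)"
      by (auto simp: space_restr_to_subalg)
    then have "{t \<in> space M. s t = y} \<in> sets F"
      using simple_functionD(2)[OF s, of "{y}"] by (simp add: sets_restr_to_subalg[OF subalg])
    then show "A R \<inter> {t \<in> space M. s t = y} \<in> sets F" using AF by blast
  qed
  then have "\<forall>\<^sub>F n in sequentially. dist (I (f n)) (I f') < e / 5" using e by (intro tendstoD) auto
  then show "\<forall>\<^sub>F n in sequentially. dist (\<Lambda> (g n)) (\<Lambda> g') < e"
  proof eventually_elim
    case (elim n)
    then show ?case using near[OF f(1,2,3), of n] near[OF f'] e unfolding dist_real_def by linarith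
  qed
qed

end

section \<open>The set of conditional expectations of selections\<close>

text \<open>Nonempty values make the given bound nonnegative almost everywhere, so its power agrees
  with that of its absolute value. Adding 1 ensures \<open>h t \<le> h t powr p\<close>, so that
  integrability of the power yields integrability of \<open>h\<close>.\<close>

lemma (in finite_measure) p_integrably_bounded_dominated:
  fixes \<Phi> :: "'a \<Rightarrow> 'x::real_normed_vector set"
  assumes ne: "correspondence_on (space M) \<Phi>" and bd: "p_integrably_bounded M p \<Phi>" and p: "1 \<le> p"
  shows "\<exists>h. integrable M h \<and> integrable M (\<lambda>t. h t powr p) \<and> (\<forall>t. 1 \<le> h t) \<and> (AE t in M. \<forall>x\<in>\<Phi> t. norm x \<le> h t)"
proof -
  obtain a :: "'a \<Rightarrow> real" where a: "a \<in> borel_measurable M" "integrable M (\<lambda>t. a t powr p)"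
    "AE t in M. \<forall>x\<in>\<Phi> t. norm x \<le> a t"
    using bd unfolding p_integrably_bounded_def by blast
  have a0: "AE t in M. 0 \<le> a t"
    using a(3) AE_space
  proof eventually_elim
    case (elim t)
    then obtain x where "x \<in> \<Phi> t" using ne by (auto simp: correspondence_on_def)
    then show ?case using elim(1) norm_ge_zero order_trans by blast
  qed
  define h where "h t = \<bar>a t\<bar> + 1" for t
  have hm: "h \<in> borel_measurable M" unfolding h_def using a(1) by measurable
  have hp: "h t powr p \<le> 2 powr p * (\<bar>a t\<bar> powr p + 1)" for t
  proof -
    define m where "m = max \<bar>a t\<bar> 1"
    have "h t \<le> 2 * m" by (auto simp: h_def m_def)
    then have "h t powr p \<le> (2 * m) powr p" using p by (intro powr_mono2) (auto simp: h_def)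
    also have "\<dots> = 2 powr p * m powr p" by (simp add: powr_mult m_def)
    also have "m powr p \<le> \<bar>a t\<bar> powr p + 1" by (auto simp: m_def max_def)
    finally show ?thesis by simp
  qed
  have int_p: "integrable M (\<lambda>t. h t powr p)"
  proof (rule Bochner_Integration.integrable_bound)
    show "integrable M (\<lambda>t. 2 powr p * (a t powr p + 1))" using a(2) by auto
    show "AE t in M. norm (h t powr p) \<le> norm (2 powr p * (a t powr p + 1))"
      using a0
    proof eventually_elim
      case (elim t)
      then show ?case using hp[of t] by simp
    qed
  qed (use hm in measurable)
  have "integrable M h"
  proof (rule Bochner_Integration.integrable_bound[OF int_p hm], rule AE_I2)
    fix t
    have "h t powr 1 \<le> h t powr p" using p by (intro powr_mono) (auto simp: h_def)
    then show "norm (h t) \<le> norm (h t powr p)" by (simp add: h_def)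
  qed
  moreover have "AE t in M. \<forall>x\<in>\<Phi> t. norm x \<le> h t"
    using a(3) by eventually_elim (auto simp: h_def intro: order_trans)
  ultimately show ?thesis using int_p by (intro exI[of _ h]) (auto simp: h_def)
qed

lemma tendsto_coordinatewise:
  fixes x :: "nat \<Rightarrow> nat \<Rightarrow> real"
  assumes "\<And>i. (\<lambda>k. x k i) \<longlonglongrightarrow> l i"
  shows "x \<longlonglongrightarrow> l"
proof -
  have "limitin (product_topology (\<lambda>i. euclidean) UNIV) x l sequentially"
    using assms by (simp add: limitin_componentwise)
  then show ?thesis by (simp add: euclidean_product_topology)
qed

text \<open>Sequential convergence suffices in the needed direction: the property passes through
  finite intersections and unions, so it has to be checked on generating sets only.\<close>

lemma eventually_in_weak_open:
  assumes U: "openin (weak_topology_by V D) U" and c: "c \<in> U" and cn: "\<And>n. c' n \<in> V"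
    and lim: "\<And>\<phi>. \<phi> \<in> D \<Longrightarrow> (\<lambda>n. \<phi> (c' n)) \<longlonglongrightarrow> (\<phi> c :: real)"
  shows "\<forall>\<^sub>F n in sequentially. c' n \<in> U"
proof -
  have "generate_topology_on {{x \<in> V. \<phi> x \<in> U} |\<phi> U. \<phi> \<in> D \<and> open U} U"
    using U unfolding weak_topology_by_def by (rule openin_topology_generated_by)
  then have "c \<in> U \<longrightarrow> (\<forall>\<^sub>F n in sequentially. c' n \<in> U)"
  proof (induction rule: generate_topology_on.induct)
    case (Int a b)
    then show ?case by (auto intro: eventually_conj)
  next
    case (UN \<U>)
    show ?case
    proof
      assume "c \<in> \<Union>\<U>"
      then obtain S where S: "S \<in> \<U>" "c \<in> S" by blast
      then have "\<forall>\<^sub>F n in sequentially. c' n \<in> S" using UN by blast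
      then show "\<forall>\<^sub>F n in sequentially. c' n \<in> \<Union>\<U>" by eventually_elim (use S(1) in blast)
    qed
  next
    case (Basis s)
    then obtain \<phi> W where s: "s = {x \<in> V. \<phi> x \<in> W}" "\<phi> \<in> D" "open W" by blast
    show ?case
    proof
      assume "c \<in> s"
      then have "\<forall>\<^sub>F n in sequentially. \<phi> (c' n) \<in> W"
        using lim[OF s(2)] s by (auto intro: topological_tendstoD)
      then show "\<forall>\<^sub>F n in sequentially. c' n \<in> s" by eventually_elim (use cn s(1) in blast)
    qed
  qed simp
  then show ?thesis using c by blast
qed

context finite_measure_subalgebra
begin

text \<open>Dynkin induction; thus countably many integrals determine all integrals over sets of
  \<open>F\<close>.\<close>

lemma set_integral_eq_on_generator:
  fixes f g :: "'a \<Rightarrow> 'x::{banach, second_countable_topology}"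
  assumes f: "integrable M f" and g: "integrable M g"
    and P: "Int_stable P" "P \<subseteq> sets F" "space F \<in> P" "sets F = sigma_sets (space F) P"
    and eq: "\<And>A. A \<in> P \<Longrightarrow> (LINT t:A|M. f t) = (LINT t:A|M. g t)" and A: "A \<in> sets F"
  shows "(LINT t:A|M. f t) = (LINT t:A|M. g t)"
proof -
  have int: "set_integrable M A f" "set_integrable M A g" if "A \<in> sets F" for A
    using f g sets_subalg[OF that] unfolding set_integrable_def by (auto intro: integrable_mult_indicator)
  have "P \<subseteq> Pow (space F)" using P(2) sets.space_closed by blast
  from P(1) this A[unfolded P(4)] show ?thesis
  proof (induction rule: sigma_sets_induct_disjoint)
    case (compl A)
    then have A: "A \<in> sets F" by (simp add: P(4))
    have "(LINT t:space F|M. w t) = (LINT t:A|M. w t) + (LINT t:space F - A|M. w t)"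
      if "\<And>A. A \<in> sets F \<Longrightarrow> set_integrable M A w" for w :: "'a \<Rightarrow> 'x"
    proof -
      have "A \<union> (space F - A) = space F" using sets.sets_into_space[OF A] by auto
      then show ?thesis using set_integral_Un[of A "space F - A" M w] that A by auto
    qed
    from this[of f] this[of g] show ?case using int eq[OF P(3)] compl(2) by simp
  next
    case (union A)
    then have A: "A i \<in> sets F" for i by (auto simp: P(4))
    have "(LINT t:(\<Union>i. A i)|M. w t) = (\<Sum>i. LINT t:A i|M. w t)"
      if "\<And>A. A \<in> sets F \<Longrightarrow> set_integrable M A w" for w :: "'a \<Rightarrow> 'x"
    proof (rule lebesgue_integral_countable_add)
      show "A i \<inter> A j = {}" if "i \<noteq> j" for i j
        by (rule disjoint_family_onD[OF union(1)]) (use that in auto)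
    qed (use A sets_subalg that in auto)
    from this[of f] this[of g] show ?case using int union(3) by simp
  qed (use eq in \<open>auto simp: set_lebesgue_integral_def\<close>)
qed

text \<open>The functional is a variable here, so that one sequence can be tested against the whole
  dual.\<close>

lemma dual_cond_exp_limit:
  fixes f :: "nat \<Rightarrow> 'a \<Rightarrow> 'x::{banach, second_countable_topology}"
  assumes "1 \<le> p" "\<phi> \<in> Lp_dual M F p" "radon_nikodym_property TYPE('a) TYPE('x \<Rightarrow>\<^sub>L real)"
    and "integrable M h" "integrable M (\<lambda>t. h t powr p)" "\<And>t. 1 \<le> h t"
    and "\<And>n. integrable M (f n)" "\<And>n. AE t in M. norm (f n t) \<le> h t" "\<And>n. is_cond_exp M F (f n) (g n)"
    and "integrable M f'" "AE t in M. norm (f' t) \<le> h t" "is_cond_exp M F f' g'"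
    and "\<And>A \<xi>::'x \<Rightarrow>\<^sub>L real. A \<in> sets F \<Longrightarrow> (\<lambda>n. \<xi> (LINT t:A|M. f n t)) \<longlonglongrightarrow> \<xi> (LINT t:A|M. f' t)"
  shows "(\<lambda>n. \<phi> (ae_class M F (g n))) \<longlonglongrightarrow> \<phi> (ae_class M F g')"
proof -
  interpret Lp_functional M F p \<phi> using assms(1,2) by unfold_locales
  show ?thesis using \<Lambda>_cond_exp_limit[OF assms(3-)] by (simp add: \<Lambda>_def)
qed

end

context complete_nowhere_equivalent
begin

text \<open>A selection is a mixture with the single weight 1.\<close>

lemma ex_limit_of_selections:
  fixes f :: "nat \<Rightarrow> 'a \<Rightarrow> 'x::{banach, second_countable_topology}"
  assumes f: "\<And>n. integrable M (f n)" "\<And>n. AE t in M. f n t \<in> \<Phi> n t"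
    and meas: "\<And>n. measurable_correspondence F (\<Phi> n)"
    and comp: "AE t in M. compactin weak_topology (\<Phi>' t)"
    and uhc: "AE t in M. \<forall>V. openin weak_topology V \<and> \<Phi>' t \<subseteq> V \<longrightarrow> (\<forall>\<^sub>F n in sequentially. \<Phi> n t \<subseteq> V)"
    and h: "integrable M h" "\<And>n. AE t in M. \<forall>x\<in>\<Phi> n t. norm x \<le> h t" "AE t in M. \<forall>x\<in>\<Phi>' t. norm x \<le> h t"
  shows "\<exists>r f'. strict_mono r \<and> integrable M f' \<and> (AE t in M. f' t \<in> \<Phi>' t) \<and>
    (\<forall>\<xi>::'x \<Rightarrow>\<^sub>L real. \<forall>A\<in>sets F. (\<lambda>k. \<xi> (LINT t:A|M. f (r k) t)) \<longlonglongrightarrow> \<xi> (LINT t:A|M. f' t))"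
proof -
  define \<kappa> :: "nat \<Rightarrow> ('a, 'x) mix" where "\<kappa> n = (1, \<lambda>_ _. 1, \<lambda>_. f n)" for n
  have \<kappa>: "mixture M (\<Phi> n) (\<kappa> n)" for n
    using f(1)[of n] f(2)[of n] by (auto simp: mixture_def \<kappa>_def)
  have mexp: "(LINT t:A|M. mexp (\<kappa> n) (blinfun_apply \<xi>) t) = \<xi> (LINT t:A|M. f n t)"
    if "A \<in> sets F" for A n and \<xi> :: "'x \<Rightarrow>\<^sub>L real"
    using set_integral_blinfun[OF f(1) sets_subalg[OF that], of \<xi> n] by (simp add: mexp_def \<kappa>_def)
  from ex_limit_selection[where \<kappa> = \<kappa>, OF \<kappa> meas comp uhc h]
  obtain r f' where rf: "strict_mono r \<and> integrable M f' \<and> (AE t in M. f' t \<in> \<Phi>' t) \<and>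
    (\<forall>\<xi>::'x \<Rightarrow>\<^sub>L real. \<forall>A\<in>sets F. (\<lambda>k. LINT t:A|M. mexp (\<kappa> (r k)) \<xi> t) \<longlonglongrightarrow> \<xi> (LINT t:A|M. f' t))"
    by (elim exE)
  then have "(\<lambda>k. \<xi> (LINT t:A|M. f (r k) t)) \<longlonglongrightarrow> \<xi> (LINT t:A|M. f' t)" if A: "A \<in> sets F"
    for A and \<xi> :: "'x \<Rightarrow>\<^sub>L real"
    using A by (simp add: mexp[OF A, symmetric])
  then show ?thesis using rf by blast
qed

lemma ex_integrable_selection:
  fixes \<Phi> :: "'a \<Rightarrow> 'x::{banach, second_countable_topology} set"
  assumes ne: "\<And>t. t \<in> space M \<Longrightarrow> \<Phi> t \<noteq> {}" and meas: "measurable_correspondence F \<Phi>"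
    and comp: "AE t in M. compactin weak_topology (\<Phi> t)"
    and h: "integrable M h" "AE t in M. \<forall>x\<in>\<Phi> t. norm x \<le> h t"
  shows "\<exists>f. integrable M f \<and> (AE t in M. f t \<in> \<Phi> t)"
proof -
  have "\<exists>s\<in>borel_measurable F. \<forall>t\<in>space F. s t \<in> closure (\<Phi> t)"
    by (rule kuratowski_ryll_nardzewski)
      (use ne measurable_correspondence_fsigma[OF meas open_fsigma] in \<open>auto simp: space_subalg\<close>)
  then obtain s where s: "s \<in> borel_measurable F" "\<And>t. t \<in> space M \<Longrightarrow> s t \<in> closure (\<Phi> t)"
    by (auto simp: space_subalg)
  have s\<Phi>: "AE t in M. s t \<in> \<Phi> t"
    using comp AE_space
  proof eventually_elim
    case (elim t)
    then show ?case using s(2)[OF elim(2)] closure_closed[OF compactin_weak_imp_closed[OF elim(1)]] by simp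
  qed
  have "AE t in M. norm (s t) \<le> norm (h t)" using s\<Phi> h(2) by eventually_elim auto
  then have "integrable M s"
    by (intro Bochner_Integration.integrable_bound[OF h(1) measurable_from_subalg[OF subalg s(1)]]) auto
  then show ?thesis using s\<Phi> by blast
qed

section \<open>Conditional expectations of selections given a smaller algebra\<close>

context
  fixes G :: "'a measure"
  assumes G: "subalgebra F G"
begin

lemma subalgebra_G: "subalgebra M G"
  using subalg G by (auto simp: subalgebra_def)

interpretation G: finite_measure_subalgebra M G
  by unfold_locales (rule subalgebra_G)

lemma sets_GF: "A \<in> sets G \<Longrightarrow> A \<in> sets F"
  using G by (auto simp: subalgebra_def)

text \<open>Equality of the integrals over \<open>F\<close> includes the sets of \<open>G\<close>,
  so exchanging one selection for another keeps the class.\<close>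

lemma CI_eqI:
  fixes \<Phi> :: "'a \<Rightarrow> 'x::{banach, second_countable_topology} set"
  assumes "integrable M f" "AE t in M. f t \<in> \<Phi> t" "is_cond_exp M G f' g"
    and "\<And>A. A \<in> sets F \<Longrightarrow> (LINT t:A|M. f t) = (LINT t:A|M. f' t)"
  shows "ae_class M G g \<in> CI M G \<Phi>"
proof -
  have "is_cond_exp M G f g" using assms(3,4) sets_GF by (auto simp: is_cond_exp_def)
  then show ?thesis using assms(1,2) unfolding CI_def by blast
qed

lemma convex_classes_CI:
  fixes \<Phi> :: "'a \<Rightarrow> 'x::{banach, second_countable_topology} set"
  assumes meas: "measurable_correspondence F \<Phi>" and comp: "AE t in M. compactin weak_topology (\<Phi> t)"
  shows "convex_classes M G (CI M G \<Phi>)"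
  unfolding convex_classes_def
proof (intro ballI allI impI)
  \<comment> \<open>Membership of a class provides some representative that is a conditional
    expectation; convexity is stated for arbitrary ones, which have to inherit the property.\<close>
  have rep: "\<exists>f. integrable M f \<and> (AE t in M. f t \<in> \<Phi> t) \<and> is_cond_exp M G f g"
    if gm: "g \<in> borel_measurable G" and g: "ae_class M G g \<in> CI M G \<Phi>" for g :: "'a \<Rightarrow> 'x"
  proof -
    obtain f g' where f: "integrable M f" "AE t in M. f t \<in> \<Phi> t" and g': "is_cond_exp M G f g'"
      and eq: "ae_class M G g = ae_class M G g'"
      using g unfolding CI_def by blast
    have "g \<in> ae_class M G g" using gm by (simp add: ae_class_def)
    then have ae: "AE t in M. g t = g' t" unfolding eq by (simp add: ae_class_def)
    have gM: "g \<in> borel_measurable M" "g' \<in> borel_measurable M"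
      using gm g' measurable_from_subalg[OF subalgebra_G] by (auto simp: is_cond_exp_def)
    have "integrable M g" using g' integrable_cong_AE[OF gM ae] by (simp add: is_cond_exp_def)
    moreover have "(LINT t:D|M. g t) = (LINT t:D|M. g' t)" if "D \<in> sets G" for D
      by (rule set_lebesgue_integral_cong_AE) (use gM ae G.sets_subalg[OF that] in auto)
    ultimately have "is_cond_exp M G f g" using gm g' by (auto simp: is_cond_exp_def)
    then show ?thesis using f by blast
  qed
  fix g1 g2 :: "'a \<Rightarrow> 'x" and u v :: real
  assume g: "g1 \<in> borel_measurable G" "g2 \<in> borel_measurable G" and uv: "0 \<le> u" "0 \<le> v"
    and C: "ae_class M G g1 \<in> CI M G \<Phi> \<and> ae_class M G g2 \<in> CI M G \<Phi> \<and> u + v = 1"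
  obtain f1 where f1: "integrable M f1" "AE t in M. f1 t \<in> \<Phi> t" "is_cond_exp M G f1 g1"
    using rep[OF g(1)] C by blast
  obtain f2 where f2: "integrable M f2" "AE t in M. f2 t \<in> \<Phi> t" "is_cond_exp M G f2 g2"
    using rep[OF g(2)] C by blast
  obtain h where h: "integrable M h" "AE t in M. h t \<in> \<Phi> t"
    and eq: "\<And>A. A \<in> sets F \<Longrightarrow> (LINT t:A|M. h t) = u *\<^sub>R (LINT t:A|M. f1 t) + v *\<^sub>R (LINT t:A|M. f2 t)"
    using ex_selection_convex_combination[OF meas comp f1(1,2) f2(1,2) uv] C by blast
  have "is_cond_exp M G h (\<lambda>t. u *\<^sub>R g1 t + v *\<^sub>R g2 t)"
    unfolding is_cond_exp_def
  proof (intro conjI ballI)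
    show "(\<lambda>t. u *\<^sub>R g1 t + v *\<^sub>R g2 t) \<in> borel_measurable G" using g by measurable
    have gi: "integrable M g1" "integrable M g2" using f1(3) f2(3) by (auto simp: is_cond_exp_def)
    then show "integrable M (\<lambda>t. u *\<^sub>R g1 t + v *\<^sub>R g2 t)" by auto
    fix D assume D: "D \<in> sets G"
    have int: "set_integrable M D g1" "set_integrable M D g2"
      using gi G.sets_subalg[OF D] unfolding set_integrable_def by (auto intro: integrable_mult_indicator)
    have "(LINT t:D|M. u *\<^sub>R g1 t + v *\<^sub>R g2 t) = u *\<^sub>R (LINT t:D|M. g1 t) + v *\<^sub>R (LINT t:D|M. g2 t)"
      using int by (subst set_integral_add) (auto simp: set_integral_scaleR_right)
    also have "\<dots> = (LINT t:D|M. h t)"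
      using f1(3) f2(3) D by (simp add: eq[OF sets_GF[OF D]] is_cond_exp_def)
    finally show "(LINT t:D|M. h t) = (LINT t:D|M. u *\<^sub>R g1 t + v *\<^sub>R g2 t)" by simp
  qed
  then show "ae_class M G (\<lambda>t. u *\<^sub>R g1 t + v *\<^sub>R g2 t) \<in> CI M G \<Phi>" using h unfolding CI_def by blast
qed

lemma CI_closed_hull:
  fixes \<Phi> :: "'a \<Rightarrow> 'x::{banach, second_countable_topology} set"
  assumes ne: "\<And>t. t \<in> space M \<Longrightarrow> \<Phi> t \<noteq> {}" and meas: "measurable_correspondence F \<Phi>"
    and comp: "AE t in M. compactin weak_topology (\<Phi> t)"
    and h: "integrable M h" "AE t in M. \<forall>x\<in>\<Phi> t. norm x \<le> h t"
  shows "CI M G \<Phi> = CI M G (\<lambda>t. closure (convex hull \<Phi> t))"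
proof (intro equalityI subsetI)
  fix c assume "c \<in> CI M G \<Phi>"
  then obtain f g where "integrable M f" "AE t in M. f t \<in> \<Phi> t" "is_cond_exp M G f g" "c = ae_class M G g"
    unfolding CI_def by blast
  moreover from this(2) have "AE t in M. f t \<in> closure (convex hull \<Phi> t)"
    by eventually_elim (meson closure_subset hull_subset subsetD)
  ultimately show "c \<in> CI M G (\<lambda>t. closure (convex hull \<Phi> t))" unfolding CI_def by blast
next
  fix c assume "c \<in> CI M G (\<lambda>t. closure (convex hull \<Phi> t))"
  then obtain f g where f: "integrable M f" "AE t in M. f t \<in> closure (convex hull \<Phi> t)"
    and g: "is_cond_exp M G f g" and c: "c = ae_class M G g"
    unfolding CI_def by blast
  obtain f' where "integrable M f'" "AE t in M. f' t \<in> \<Phi> t"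
    "\<And>A. A \<in> sets F \<Longrightarrow> (LINT t:A|M. f' t) = (LINT t:A|M. f t)"
    using ex_selection_closed_hull[OF ne meas comp h f] by blast
  then show "c \<in> CI M G \<Phi>" unfolding c using g by (intro CI_eqI)
qed

context
  fixes p :: real
  assumes p: "1 \<le> p"
    and rnp: "radon_nikodym_property TYPE('a) TYPE('x::{banach, second_countable_topology} \<Rightarrow>\<^sub>L real)"
begin

lemma CI_subset_Lp_space:
  fixes \<Phi> :: "'a \<Rightarrow> 'x set"
  assumes h: "integrable M h" "integrable M (\<lambda>t. h t powr p)" "\<And>t. 1 \<le> h t"
    and \<Phi>h: "AE t in M. \<forall>x\<in>\<Phi> t. norm x \<le> h t"
  shows "CI M G \<Phi> \<subseteq> Lp_space M G p"
proof
  fix c assume "c \<in> CI M G \<Phi>"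
  then obtain f g where f: "integrable M f" "AE t in M. f t \<in> \<Phi> t" "is_cond_exp M G f g" and c: "c = ae_class M G g"
    unfolding CI_def by blast
  have "AE t in M. norm (f t) \<le> h t" using f(2) \<Phi>h by eventually_elim blast
  then have "g \<in> Lp_fun M G p" using f by (intro G.Lp_fun_cond_exp[OF p h])
  then show "c \<in> Lp_space M G p" unfolding c Lp_space_def by blast
qed

text \<open>A selection enters \<open>CI\<close> only through its integrals over the sets of \<open>F\<close>, and countably many
  scalar integrals determine these.  So \<open>CI\<close> is the continuous image of a subset of a countable
  product of lines, which is sequentially compact, hence compact.\<close>

lemma compactin_CI:
  fixes \<Phi> :: "'a \<Rightarrow> 'x set"
  assumes meas: "measurable_correspondence F \<Phi>" and comp: "AE t in M. compactin weak_topology (\<Phi> t)"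
    and h: "integrable M h" "integrable M (\<lambda>t. h t powr p)" "\<And>t. 1 \<le> h t"
    and \<Phi>h: "AE t in M. \<forall>x\<in>\<Phi> t. norm x \<le> h t"
  shows "compactin (Lp_weak_topology M G p) (CI M G \<Phi>)"
proof -
  obtain \<psi> :: "nat \<Rightarrow> ('x \<Rightarrow>\<^sub>L real)" where \<psi>: "norming \<psi>" using ex_norming by blast
  obtain P :: "nat \<Rightarrow> 'a set" where P: "Int_stable (range P)" "range P \<subseteq> sets F" "space F \<in> range P"
      "sets F = sigma_sets (space F) (range P)"
    using countably_generated_Int_stable[OF cg] by blast
  have PF: "P j \<in> sets F" for j using P(2) by auto
  define Sel where "Sel = {f. integrable M f \<and> (AE t in M. f t \<in> \<Phi> t)}"
  have SelD: "integrable M f" "AE t in M. f t \<in> \<Phi> t" "AE t in M. norm (f t) \<le> h t" if "f \<in> Sel" for f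
  proof -
    show *: "integrable M f" "AE t in M. f t \<in> \<Phi> t" using that by (auto simp: Sel_def)
    show "AE t in M. norm (f t) \<le> h t" using *(2) \<Phi>h by eventually_elim blast
  qed
  define I where "I f n = (case prod_decode n of (j, i) \<Rightarrow> \<psi> i (LINT t:P j|M. f t))" for f n
  \<comment> \<open>The choice is harmless: selections with equal coordinates have equal integrals
    over \<open>F\<close>, hence the same class.\<close>
  define J where "J z = (SOME c. \<exists>f g. f \<in> Sel \<and> I f = z \<and> is_cond_exp M G f g \<and> c = ae_class M G g)" for z
  have I_eq: "(LINT t:A|M. f t) = (LINT t:A|M. f' t)" if f: "f \<in> Sel" "f' \<in> Sel" "I f = I f'" and A: "A \<in> sets F" for f f' A
  proof (rule set_integral_eq_on_generator[OF SelD(1)[OF f(1)] SelD(1)[OF f(2)] P _ A])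
    fix B assume "B \<in> range P"
    then obtain j where B: "B = P j" by blast
    show "(LINT t:B|M. f t) = (LINT t:B|M. f' t)"
    proof (rule norming_eqI[OF \<psi>])
      fix i
      show "\<psi> i (LINT t:B|M. f t) = \<psi> i (LINT t:B|M. f' t)"
        using fun_cong[OF f(3), of "prod_encode (j, i)"] by (simp add: I_def B)
    qed
  qed
  have J_eq: "J (I f) = ae_class M G g" if f: "f \<in> Sel" and g: "is_cond_exp M G f g" for f g
  proof -
    have "\<exists>c f' g'. f' \<in> Sel \<and> I f' = I f \<and> is_cond_exp M G f' g' \<and> c = ae_class M G g'" using f g by blast
    from someI_ex[OF this] obtain f' g' where f': "f' \<in> Sel" "I f' = I f" "is_cond_exp M G f' g'"
      and J: "J (I f) = ae_class M G g'" unfolding J_def by blast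
    have "AE t in M. g' t = g t"
      using I_eq[OF f'(1) f f'(2)] sets_GF
      by (intro G.is_cond_exp_unique[OF SelD(1)[OF f'(1)] SelD(1)[OF f] f'(3) g]) auto
    then show ?thesis unfolding J by (rule G.ae_class_cong)
  qed
  have CE: "\<exists>g. is_cond_exp M G f g" if "f \<in> Sel" for f by (rule G.ex_is_cond_exp[OF SelD(1)[OF that]])
  have J_image: "CI M G \<Phi> = J ` (I ` Sel)"
  proof (intro equalityI subsetI)
    fix c assume "c \<in> CI M G \<Phi>"
    then obtain f g where "f \<in> Sel" "is_cond_exp M G f g" "c = ae_class M G g"
      unfolding CI_def Sel_def by blast
    then show "c \<in> J ` (I ` Sel)" using J_eq by (auto simp: image_iff)
  next
    fix c assume "c \<in> J ` (I ` Sel)"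
    then obtain f where f: "f \<in> Sel" "c = J (I f)" by blast
    obtain g where "is_cond_exp M G f g" using CE[OF f(1)] by blast
    then show "c \<in> CI M G \<Phi>" using f J_eq[OF f(1)] unfolding CI_def Sel_def by auto
  qed
  \<comment> \<open>One subsequence gives convergence of the coordinates and of every functional in
    the dual.\<close>
  have seq: "\<exists>r f'. strict_mono r \<and> f' \<in> Sel \<and> (\<lambda>k. I (f (r k))) \<longlonglongrightarrow> I f' \<and>
      (\<forall>\<phi>\<in>Lp_dual M G p. (\<lambda>k. \<phi> (J (I (f (r k))))) \<longlonglongrightarrow> \<phi> (J (I f')))"
    if f: "\<And>n. f n \<in> Sel" for f :: "nat \<Rightarrow> 'a \<Rightarrow> 'x"
  proof -
    have "AE t in M. \<forall>V. openin weak_topology V \<and> \<Phi> t \<subseteq> V \<longrightarrow> (\<forall>\<^sub>F n::nat in sequentially. \<Phi> t \<subseteq> V)"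
      by auto
    from ex_limit_of_selections[where f = f, OF SelD(1)[OF f] SelD(2)[OF f] meas comp this h(1) \<Phi>h \<Phi>h]
    obtain r f' where rf: "strict_mono r \<and> integrable M f' \<and> (AE t in M. f' t \<in> \<Phi> t) \<and>
      (\<forall>\<xi>::'x \<Rightarrow>\<^sub>L real. \<forall>A\<in>sets F. (\<lambda>k. \<xi> (LINT t:A|M. f (r k) t)) \<longlonglongrightarrow> \<xi> (LINT t:A|M. f' t))"
      by (elim exE)
    have f': "f' \<in> Sel" using rf by (simp add: Sel_def)
    have lim: "(\<lambda>k. \<xi> (LINT t:A|M. f (r k) t)) \<longlonglongrightarrow> \<xi> (LINT t:A|M. f' t)" if "A \<in> sets F"
      for A and \<xi> :: "'x \<Rightarrow>\<^sub>L real" using rf that by blast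
    have "(\<lambda>k. I (f (r k))) \<longlonglongrightarrow> I f'"
    proof (rule tendsto_coordinatewise)
      fix n
      obtain j i where "prod_decode n = (j, i)" by (cases "prod_decode n")
      then show "(\<lambda>k. I (f (r k)) n) \<longlonglongrightarrow> I f' n" using lim[OF PF] by (simp add: I_def)
    qed
    moreover have "(\<lambda>k. \<phi> (J (I (f (r k))))) \<longlonglongrightarrow> \<phi> (J (I f'))" if \<phi>: "\<phi> \<in> Lp_dual M G p" for \<phi>
    proof -
      obtain g where g: "\<And>n. is_cond_exp M G (f n) (g n)" using CE[OF f] by metis
      obtain g' where g': "is_cond_exp M G f' g'" using CE[OF f'] by blast
      have "(\<lambda>k. \<phi> (ae_class M G (g (r k)))) \<longlonglongrightarrow> \<phi> (ae_class M G g')"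
        by (rule G.dual_cond_exp_limit[OF p \<phi> rnp h SelD(1)[OF f] SelD(3)[OF f] g SelD(1)[OF f'] SelD(3)[OF f'] g'])
          (rule lim[OF sets_GF])
      then show ?thesis by (simp add: J_eq[OF f g] J_eq[OF f' g'])
    qed
    ultimately show ?thesis using rf f' by (intro exI[of _ r] exI[of _ f']) simp
  qed
  have pick: "\<exists>f. \<forall>n. f n \<in> Sel \<and> z n = I (f n)" if "\<forall>n. z n \<in> I ` Sel" for z :: "nat \<Rightarrow> nat \<Rightarrow> real"
    by (rule choice) (use that in \<open>simp add: image_iff Bex_def\<close>)
  have "seq_compact (I ` Sel)"
    unfolding seq_compact_def
  proof (intro allI impI)
    fix z :: "nat \<Rightarrow> nat \<Rightarrow> real" assume "\<forall>n. z n \<in> I ` Sel"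
    from pick[OF this] obtain f where "\<forall>n. f n \<in> Sel \<and> z n = I (f n)" ..
    then have f: "f n \<in> Sel" "z n = I (f n)" for n by simp_all
    obtain r f' where "strict_mono r" "f' \<in> Sel" "(\<lambda>k. I (f (r k))) \<longlonglongrightarrow> I f'" using seq[of f, OF f(1)] by blast
    then show "\<exists>l\<in>I ` Sel. \<exists>r. strict_mono r \<and> (z \<circ> r) \<longlonglongrightarrow> l"
      by (intro bexI[of _ "I f'"] exI[of _ r]) (auto simp: f(2) comp_def)
  qed
  then have "compact (I ` Sel)" by (simp add: compact_eq_seq_compact_metric)
  then have K: "compactin (subtopology euclidean (I ` Sel)) (I ` Sel)"
    by (simp add: compactin_subtopology)
  have "continuous_map (subtopology euclidean (I ` Sel)) (Lp_weak_topology M G p) J"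
    unfolding Lp_weak_topology_def
  proof (rule continuous_map_into_weak_topology_by)
    fix z assume "z \<in> topspace (subtopology euclidean (I ` Sel))"
    then have "J z \<in> CI M G \<Phi>" unfolding J_image by simp
    then show "J z \<in> Lp_space M G p" using CI_subset_Lp_space[OF h \<Phi>h] by blast
  next
    have "(\<lambda>_. 0) \<in> (Lp_dual M G p :: (('a \<Rightarrow> 'x) set \<Rightarrow> real) set)"
      by (auto simp: Lp_dual_def intro!: exI[of _ 0])
    then show "(Lp_dual M G p :: (('a \<Rightarrow> 'x) set \<Rightarrow> real) set) \<noteq> {}" by blast
  next
    fix \<phi> :: "('a \<Rightarrow> 'x) set \<Rightarrow> real" assume \<phi>: "\<phi> \<in> Lp_dual M G p"
    have "continuous_on (I ` Sel) (\<lambda>z. \<phi> (J z))"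
      unfolding continuous_on_sequentially
    proof (intro ballI allI impI)
      fix z zn assume z: "z \<in> I ` Sel" and zn: "(\<forall>n. zn n \<in> I ` Sel) \<and> zn \<longlonglongrightarrow> z"
      from pick[OF conjunct1[OF zn]] obtain f where "\<forall>n. f n \<in> Sel \<and> zn n = I (f n)" ..
      then have f: "f n \<in> Sel" "zn n = I (f n)" for n by simp_all
      \<comment> \<open>Each subsequence has a further one with a limit selection \<open>f'\<close>.
        Its coordinates must be \<open>z\<close>, so the value \<open>J z\<close> does not depend on
        the subsequence.\<close>
      show "((\<lambda>z. \<phi> (J z)) \<circ> zn) \<longlonglongrightarrow> \<phi> (J z)"
      proof (rule tendsto_subseq_criterion)
        fix s :: "nat \<Rightarrow> nat" assume s: "strict_mono s"
        obtain r f' where r: "strict_mono r" and l: "(\<lambda>k. I (f (s (r k)))) \<longlonglongrightarrow> I f'"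
          and l\<phi>: "\<forall>\<phi>\<in>Lp_dual M G p. (\<lambda>k. \<phi> (J (I (f (s (r k)))))) \<longlonglongrightarrow> \<phi> (J (I f'))"
          using seq[of "\<lambda>n. f (s n)", OF f(1)] by blast
        have "strict_mono (s \<circ> r)" using s r by (rule strict_mono_o)
        then have "(\<lambda>k. I (f (s (r k)))) \<longlonglongrightarrow> z"
          using LIMSEQ_subseq_LIMSEQ[of zn z "s \<circ> r"] zn by (simp add: comp_def f(2))
        then have "I f' = z" using l LIMSEQ_unique by blast
        then show "\<exists>r. strict_mono r \<and> (\<lambda>k. ((\<lambda>z. \<phi> (J z)) \<circ> zn) (s (r k))) \<longlonglongrightarrow> \<phi> (J z)"
          using r l\<phi> \<phi> by (intro exI[of _ r]) (auto simp: f(2))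
      qed
    qed
    then show "continuous_map (subtopology euclidean (I ` Sel)) euclideanreal (\<lambda>z. \<phi> (J z))"
      by (simp add: continuous_map_iff_continuous)
  qed
  from image_compactin[OF K this] show ?thesis by (simp only: J_image)
qed

text \<open>If the property failed at \<open>y0\<close>, points \<open>Y n\<close> tending to
  \<open>y0\<close> would carry selections whose classes lie outside of \<open>V\<close>. A limit
  selection belongs to the value at \<open>y0\<close>, so its class is in \<open>V\<close>, and weak
  convergence along a subsequence puts late classes into \<open>V\<close>.\<close>

lemma upper_hemicontinuous_CI:
  fixes \<Psi> :: "'a \<Rightarrow> 'x set" and \<Phi> :: "'a \<Rightarrow> 'y::metric_space \<Rightarrow> 'x set"
  assumes \<Psi>c: "AE t in M. compactin weak_topology (\<Psi> t)"
    and h: "integrable M h" "integrable M (\<lambda>t. h t powr p)" "\<And>t. 1 \<le> h t"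
    and \<Psi>h: "AE t in M. \<forall>x\<in>\<Psi> t. norm x \<le> h t"
    and ne: "\<And>t y. t \<in> space M \<Longrightarrow> \<Phi> t y \<noteq> {}"
    and cl: "\<And>y. AE t in M. closedin weak_topology (\<Phi> t y)" and sub: "\<And>y. AE t in M. \<Phi> t y \<subseteq> \<Psi> t"
    and meas: "\<And>y. measurable_correspondence F (\<lambda>t. \<Phi> t y)"
    and uhc: "\<And>t. t \<in> space M \<Longrightarrow> upper_hemicontinuous_on euclidean weak_topology (\<Phi> t)"
  shows "upper_hemicontinuous_on euclidean (Lp_weak_topology M G p) (\<lambda>y. CI M G (\<lambda>t. \<Phi> t y))"
proof -
  have comp: "AE t in M. compactin weak_topology (\<Phi> t y)" for y
    using \<Psi>c cl[of y] sub[of y] by eventually_elim (rule closed_compactin)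
  have \<Phi>h: "AE t in M. \<forall>x\<in>\<Phi> t y. norm x \<le> h t" for y
    using \<Psi>h sub[of y] by eventually_elim blast
  have CI_Lp: "CI M G (\<lambda>t. \<Phi> t y) \<subseteq> Lp_space M G p" for y by (rule CI_subset_Lp_space[OF h \<Phi>h])
  have CI_ne: "CI M G (\<lambda>t. \<Phi> t y) \<noteq> {}" for y
  proof -
    obtain f where f: "integrable M f" "AE t in M. f t \<in> \<Phi> t y"
      using ex_integrable_selection[OF ne meas comp h(1) \<Phi>h] by blast
    obtain g where "is_cond_exp M G f g" using G.ex_is_cond_exp[OF f(1)] by blast
    then have "ae_class M G g \<in> CI M G (\<lambda>t. \<Phi> t y)" using f unfolding CI_def by blast
    then show ?thesis by blast
  qed
  have "\<exists>U. open U \<and> y0 \<in> U \<and> (\<forall>y\<in>U. CI M G (\<lambda>t. \<Phi> t y) \<subseteq> V)"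
    if V: "openin (Lp_weak_topology M G p) V" and y0: "CI M G (\<lambda>t. \<Phi> t y0) \<subseteq> V" for y0 V
  proof (rule ccontr)
    assume neg: "\<not> ?thesis"
    have "\<exists>y. dist y0 y < 1 / real (Suc n) \<and> \<not> CI M G (\<lambda>t. \<Phi> t y) \<subseteq> V" for n
    proof (rule ccontr)
      assume "\<not> ?thesis"
      then have "\<forall>y\<in>ball y0 (1 / real (Suc n)). CI M G (\<lambda>t. \<Phi> t y) \<subseteq> V" by auto
      moreover have "y0 \<in> ball y0 (1 / real (Suc n))" by simp
      ultimately show False using neg open_ball by blast
    qed
    then obtain Y where Y: "\<And>n. dist y0 (Y n) < 1 / real (Suc n)" "\<And>n. \<not> CI M G (\<lambda>t. \<Phi> t (Y n)) \<subseteq> V"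
      by metis
    have Ylim: "Y \<longlonglongrightarrow> y0"
    proof (rule metric_LIMSEQ_I)
      fix e :: real assume "0 < e"
      then obtain N where N: "1 / real (Suc N) < e" by (metis nat_approx_posE)
      have "dist (Y n) y0 < e" if "N \<le> n" for n
      proof -
        have "1 / real (Suc n) \<le> 1 / real (Suc N)" using that by (intro divide_left_mono) auto
        then show ?thesis using Y(1)[of n] N by (simp add: dist_commute)
      qed
      then show "\<exists>N. \<forall>n\<ge>N. dist (Y n) y0 < e" by blast
    qed
    have "\<exists>f g. integrable M f \<and> (AE t in M. f t \<in> \<Phi> t (Y n)) \<and> is_cond_exp M G f g \<and> ae_class M G g \<notin> V" for n
      using Y(2)[of n] unfolding CI_def by blast
    then obtain f g where f: "\<And>n. integrable M (f n)" "\<And>n. AE t in M. f n t \<in> \<Phi> t (Y n)"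
      and g: "\<And>n. is_cond_exp M G (f n) (g n)" "\<And>n. ae_class M G (g n) \<notin> V" by metis
    have "AE t in M. \<forall>V. openin weak_topology V \<and> \<Phi> t y0 \<subseteq> V \<longrightarrow> (\<forall>\<^sub>F n in sequentially. \<Phi> t (Y n) \<subseteq> V)"
    proof (rule AE_I2, intro allI impI)
      fix t V assume t: "t \<in> space M" and V: "openin weak_topology V \<and> \<Phi> t y0 \<subseteq> V"
      have "\<exists>U. open U \<and> y0 \<in> U \<and> (\<forall>y\<in>U. \<Phi> t y \<subseteq> V)"
        using uhc[OF t] V by (simp add: upper_hemicontinuous_on_def)
      then obtain U where U: "open U" "y0 \<in> U" "\<And>y. y \<in> U \<Longrightarrow> \<Phi> t y \<subseteq> V" by blast
      have "\<forall>\<^sub>F n in sequentially. Y n \<in> U" using Ylim U(1,2) by (rule topological_tendstoD)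
      then show "\<forall>\<^sub>F n in sequentially. \<Phi> t (Y n) \<subseteq> V" by eventually_elim (rule U(3))
    qed
    from ex_limit_of_selections[where \<Phi> = "\<lambda>n t. \<Phi> t (Y n)", OF f meas comp this h(1) \<Phi>h \<Phi>h]
    obtain r f' where rf: "strict_mono r \<and> integrable M f' \<and> (AE t in M. f' t \<in> \<Phi> t y0) \<and>
      (\<forall>\<xi>::'x \<Rightarrow>\<^sub>L real. \<forall>A\<in>sets F. (\<lambda>k. \<xi> (LINT t:A|M. f (r k) t)) \<longlonglongrightarrow> \<xi> (LINT t:A|M. f' t))"
      by (elim exE)
    obtain g' where g': "is_cond_exp M G f' g'" using G.ex_is_cond_exp rf by blast
    have fh: "AE t in M. norm (f n t) \<le> h t" for n using f(2)[of n] \<Phi>h[of "Y n"] by eventually_elim blast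
    have "AE t in M. f' t \<in> \<Phi> t y0" using rf by blast
    then have f'h: "AE t in M. norm (f' t) \<le> h t" using \<Phi>h[of y0] by eventually_elim blast
    have "ae_class M G g' \<in> CI M G (\<lambda>t. \<Phi> t y0)" using rf g' unfolding CI_def by blast
    then have "ae_class M G g' \<in> V" using y0 by blast
    have "\<forall>\<^sub>F k in sequentially. ae_class M G (g (r k)) \<in> V"
    proof (rule eventually_in_weak_open[OF V[unfolded Lp_weak_topology_def] \<open>ae_class M G g' \<in> V\<close>])
      show "ae_class M G (g (r k)) \<in> Lp_space M G p" for k
        unfolding Lp_space_def using G.Lp_fun_cond_exp[OF p h f(1) fh g(1)] by blast
      show "(\<lambda>k. \<phi> (ae_class M G (g (r k)))) \<longlonglongrightarrow> \<phi> (ae_class M G g')" if \<phi>: "\<phi> \<in> Lp_dual M G p" for \<phi>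
        by (rule G.dual_cond_exp_limit[OF p \<phi> rnp h f(1) fh g(1) _ f'h g']) (use rf sets_GF in auto)
    qed
    then show False using g(2) by simp
  qed
  then show ?thesis
    unfolding upper_hemicontinuous_on_def correspondence_on_def
    using CI_ne CI_Lp by (simp add: topspace_Lp_weak_topology)
qed

end

end

end

theorem theorem1:
  fixes M F :: "'a measure"
  assumes "prob_space M" and "complete_measure M" and "atomless M"
    and "subalgebra M F" and "countably_generated F"
    and "radon_nikodym_property TYPE('a) TYPE('x::{banach, second_countable_topology} \<Rightarrow>\<^sub>L real)"
    and "nowhere_equivalent M F"
  shows "\<forall>G. subalgebra F G \<longrightarrow>
    (\<forall>\<Phi> :: 'a \<Rightarrow> 'x set.
      correspondence_on (space M) \<Phi> \<and> measurable_correspondence F \<Phi> \<and>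
      weakly_compact_valued M \<Phi>
      \<longrightarrow> convex_classes M G (CI M G \<Phi>)) \<and>
    (\<forall>p\<ge>1. \<forall>\<Phi> :: 'a \<Rightarrow> 'x set.
      correspondence_on (space M) \<Phi> \<and> measurable_correspondence F \<Phi> \<and>
      p_integrably_bounded M p \<Phi> \<and> weakly_compact_valued M \<Phi>
      \<longrightarrow> compactin (Lp_weak_topology M G p) (CI M G \<Phi>)) \<and>
    (\<forall>p\<ge>1. \<forall>\<Phi> :: 'a \<Rightarrow> 'x set.
      correspondence_on (space M) \<Phi> \<and> measurable_correspondence F \<Phi> \<and>
      p_integrably_bounded M p \<Phi> \<and> weakly_compact_valued M \<Phi>
      \<longrightarrow> CI M G \<Phi> = CI M G (\<lambda>t. closure (convex hull \<Phi> t))) \<and>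
    (\<forall>p\<ge>1. \<forall>(\<Psi> :: 'a \<Rightarrow> 'x set) (\<Phi> :: 'a \<Rightarrow> 'y::metric_space \<Rightarrow> 'x set).
      correspondence_on (space M) \<Psi> \<and> measurable_correspondence F \<Psi> \<and>
      p_integrably_bounded M p \<Psi> \<and> weakly_compact_valued M \<Psi> \<and>
      correspondence_on (space M \<times> UNIV) (\<lambda>(t, y). \<Phi> t y) \<and>
      (\<forall>y. weakly_closed_valued M (\<lambda>t. \<Phi> t y)) \<and>
      (\<forall>y. AE t in M. \<Phi> t y \<subseteq> \<Psi> t) \<and>
      (\<forall>y. measurable_correspondence F (\<lambda>t. \<Phi> t y)) \<and>
      (\<forall>t\<in>space M. upper_hemicontinuous_on euclidean weak_topology (\<Phi> t))
      \<longrightarrow> upper_hemicontinuous_on euclidean (Lp_weak_topology M G p)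
            (\<lambda>y. CI M G (\<lambda>t. \<Phi> t y)))"
proof -
  interpret prob_space M by (rule assms(1))
  interpret complete_measure M by (rule assms(2))
  interpret complete_nowhere_equivalent M F
    using assms(4,5,7) by unfold_locales
  note rnp = assms(6)
  show ?thesis
  proof (intro allI impI conjI; (elim conjE)?)
    fix G and \<Phi> :: "'a \<Rightarrow> 'x set"
    assume "subalgebra F G" "measurable_correspondence F \<Phi>" "weakly_compact_valued M \<Phi>"
    then show "convex_classes M G (CI M G \<Phi>)"
      by (intro convex_classes_CI) (auto simp: weakly_compact_valued_def)
  next
    fix G and p :: real and \<Phi> :: "'a \<Rightarrow> 'x set"
    assume G: "subalgebra F G" and p: "1 \<le> p" and \<Phi>: "correspondence_on (space M) \<Phi>"
      "measurable_correspondence F \<Phi>" "p_integrably_bounded M p \<Phi>" "weakly_compact_valued M \<Phi>"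
    obtain h where h: "integrable M h" "integrable M (\<lambda>t. h t powr p)" "\<And>t. 1 \<le> h t"
      "AE t in M. \<forall>x\<in>\<Phi> t. norm x \<le> h t"
      using p_integrably_bounded_dominated[OF \<Phi>(1,3) p] by blast
    show "compactin (Lp_weak_topology M G p) (CI M G \<Phi>)"
      by (rule compactin_CI[OF G p rnp \<Phi>(2) \<Phi>(4)[unfolded weakly_compact_valued_def] h])
  next
    fix G and p :: real and \<Phi> :: "'a \<Rightarrow> 'x set"
    assume G: "subalgebra F G" and p: "1 \<le> p" and \<Phi>: "correspondence_on (space M) \<Phi>"
      "measurable_correspondence F \<Phi>" "p_integrably_bounded M p \<Phi>" "weakly_compact_valued M \<Phi>"
    obtain h where h: "integrable M h" "AE t in M. \<forall>x\<in>\<Phi> t. norm x \<le> h t"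
      using p_integrably_bounded_dominated[OF \<Phi>(1,3) p] by blast
    show "CI M G \<Phi> = CI M G (\<lambda>t. closure (convex hull \<Phi> t))"
      by (rule CI_closed_hull[OF G _ \<Phi>(2) \<Phi>(4)[unfolded weakly_compact_valued_def] h])
        (use \<Phi>(1) in \<open>auto simp: correspondence_on_def\<close>)
  next
    fix G and p :: real and \<Psi> :: "'a \<Rightarrow> 'x set" and \<Phi> :: "'a \<Rightarrow> 'y \<Rightarrow> 'x set"
    assume G: "subalgebra F G" and p: "1 \<le> p" and \<Psi>: "correspondence_on (space M) \<Psi>"
      "p_integrably_bounded M p \<Psi>" "weakly_compact_valued M \<Psi>"
      and \<Phi>: "correspondence_on (space M \<times> UNIV) (\<lambda>(t, y). \<Phi> t y)"
      "\<forall>y. weakly_closed_valued M (\<lambda>t. \<Phi> t y)" "\<forall>y. AE t in M. \<Phi> t y \<subseteq> \<Psi> t"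
      "\<forall>y. measurable_correspondence F (\<lambda>t. \<Phi> t y)"
      "\<forall>t\<in>space M. upper_hemicontinuous_on euclidean weak_topology (\<Phi> t)"
    obtain h where h: "integrable M h" "integrable M (\<lambda>t. h t powr p)" "\<And>t. 1 \<le> h t"
      "AE t in M. \<forall>x\<in>\<Psi> t. norm x \<le> h t"
      using p_integrably_bounded_dominated[OF \<Psi>(1,2) p] by blast
    show "upper_hemicontinuous_on euclidean (Lp_weak_topology M G p) (\<lambda>y. CI M G (\<lambda>t. \<Phi> t y))"
      by (rule upper_hemicontinuous_CI[OF G p rnp \<Psi>(3)[unfolded weakly_compact_valued_def] h])
        (use \<Phi> in \<open>auto simp: correspondence_on_def weakly_closed_valued_def\<close>)
  qed
qed

end
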